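(* Let $\gamma:[0,\infty)\to\mathbb{R}^3$ be Hölder continuous with an exponent $\alpha>\frac34$ (so $\alpha\in(\frac34,1]$), and let $\Gamma=\{(\gamma(t),t)\in\mathbb{R}^3\times(0,\infty):\ t>0\}$. Then there exist a vector field $u=u(x,t)$ with values in $\mathbb{R}^3$ and a scalar pressure $p=p(x,t)$ which are smooth (of class $C^\infty$) on $(\mathbb{R}^3\times(0,\infty))\setminus\Gamma$, which satisfy the Navier-Stokes system $$\partial_tu-\Delta u+(u\cdot\nabla)u+\nabla p=0,\qquad \operatorname{div}u=0$$ at every point $(x,t)\in(\mathbb{R}^3\times(0,\infty))\setminus\Gamma$, and which are singular on the curve $\Gamma$.
   Context: Hölder continuity of $\gamma$ with exponent $\alpha\in(0,1]$ means: for every $T>0$ there is a constant $C(T)>0$ such that $|\gamma(t)-\gamma(s)|\le C(T)|t-s|^\alpha$ for all $t,s\in[0,T]$. "Singular on $\Gamma$" means: for every $t>0$, neither $u(\cdot,t)$ nor $p(\cdot,t)$ is bounded on any punctured neighbourhood of the point $x=\gamma(t)$ in $\mathbb{R}^3$. *)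

theory Defs
  imports "HOL-Analysis.Analysis"
begin

text \<open>Only the restriction of \<open>g\<close> to \<open>[0,\<infinity>)\<close> matters. For \<open>s = t\<close> the bound reads
  \<open>0 \<le> 0\<close>, since \<open>0 powr a = 0\<close>.\<close>

definition locally_holder :: "real \<Rightarrow> (real \<Rightarrow> 'a::real_normed_vector) \<Rightarrow> bool" where
  "locally_holder \<alpha> g \<longleftrightarrow>
    (\<forall>T>0. \<exists>C>0. \<forall>t\<in>{0..T}. \<forall>s\<in>{0..T}. norm (g t - g s) \<le> C * \<bar>t - s\<bar> powr \<alpha>)"

text \<open>Class \<open>C\<^sup>k\<close> on an open subset of a finite-dimensional space. A function is \<open>C\<^sup>k\<^sup>+\<^sup>1\<close> if
  it is differentiable and all its directional derivatives are \<open>C\<^sup>k\<close>; in finite dimension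
  this is the same as the derivative, as a map into the linear operators, being \<open>C\<^sup>k\<close>.\<close>

primrec Ck_on :: "nat \<Rightarrow> 'a::euclidean_space set \<Rightarrow> ('a \<Rightarrow> 'b::real_normed_vector) \<Rightarrow> bool" where
  "Ck_on 0 S f \<longleftrightarrow> continuous_on S f"
| "Ck_on (Suc k) S f \<longleftrightarrow>
    (\<forall>z\<in>S. f differentiable (at z)) \<and>
    (\<forall>v. Ck_on k S (\<lambda>z. frechet_derivative f (at z) v))"

definition smooth_on :: "'a::euclidean_space set \<Rightarrow> ('a \<Rightarrow> 'b::real_normed_vector) \<Rightarrow> bool" where
  "smooth_on S f \<longleftrightarrow> (\<forall>k. Ck_on k S f)"

type_synonym spacetime = "(real^3) \<times> real"

definition curve_graph :: "(real \<Rightarrow> real^3) \<Rightarrow> spacetime set" where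
  "curve_graph \<gamma> = {(\<gamma> t, t) | t. t > 0}"

definition off_curve :: "(real \<Rightarrow> real^3) \<Rightarrow> spacetime set" where
  "off_curve \<gamma> = (UNIV \<times> {0<..}) - curve_graph \<gamma>"

text \<open>The value of \<open>vector_derivative\<close> is unspecified where the derivative fails
  to exist; the operators below are meant for functions that are smooth near the point.\<close>

definition dt :: "(spacetime \<Rightarrow> 'b::real_normed_vector) \<Rightarrow> spacetime \<Rightarrow> 'b" where
  "dt f z = vector_derivative (\<lambda>s. f (fst z, s)) (at (snd z))"

definition dx :: "3 \<Rightarrow> (spacetime \<Rightarrow> 'b::real_normed_vector) \<Rightarrow> spacetime \<Rightarrow> 'b" where
  "dx i f z = vector_derivative (\<lambda>h. f (fst z + h *\<^sub>R axis i 1, snd z)) (at 0)"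

definition laplacian :: "(spacetime \<Rightarrow> 'b::real_normed_vector) \<Rightarrow> spacetime \<Rightarrow> 'b" where
  "laplacian f z = (\<Sum>i\<in>UNIV. dx i (dx i f) z)"

definition grad :: "(spacetime \<Rightarrow> real) \<Rightarrow> spacetime \<Rightarrow> real^3" where
  "grad p z = (\<chi> i. dx i p z)"

definition divergence :: "(spacetime \<Rightarrow> real^3) \<Rightarrow> spacetime \<Rightarrow> real" where
  "divergence u z = (\<Sum>i\<in>UNIV. dx i (\<lambda>w. u w $ i) z)"

definition convection :: "(spacetime \<Rightarrow> real^3) \<Rightarrow> spacetime \<Rightarrow> real^3" where
  "convection u z = (\<Sum>i\<in>UNIV. (u z $ i) *\<^sub>R dx i u z)"

definition navier_stokes_at ::
  "(spacetime \<Rightarrow> real^3) \<Rightarrow> (spacetime \<Rightarrow> real) \<Rightarrow> spacetime \<Rightarrow> bool" where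
  "navier_stokes_at u p z \<longleftrightarrow>
    dt u z - laplacian u z + convection u z + grad p z = 0 \<and> divergence u z = 0"

definition singular_on_curve ::
  "(real \<Rightarrow> real^3) \<Rightarrow> (spacetime \<Rightarrow> real^3) \<Rightarrow> (spacetime \<Rightarrow> real) \<Rightarrow> bool" where
  "singular_on_curve \<gamma> u p \<longleftrightarrow>
    (\<forall>t>0. \<forall>U. open U \<and> \<gamma> t \<in> U \<longrightarrow>
      \<not> bounded ((\<lambda>x. u (x, t)) ` (U - {\<gamma> t})) \<and>
      \<not> bounded ((\<lambda>x. p (x, t)) ` (U - {\<gamma> t})))"

end

theory Submission
  imports Defs
begin

text \<open>
  Potential flows \<open>u = \<nabla>\<phi>\<close>, \<open>p = - \<partial>\<^sub>t\<phi> - \<bar>\<nabla>\<phi>\<bar>\<^sup>2 / 2\<close> with \<open>\<phi>\<close> harmonic in \<open>x\<close> solve the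
  Navier-Stokes system exactly, so it suffices to find \<open>\<phi>\<close> that is smooth off the curve, harmonic in
  \<open>x\<close>, not identically zero and decaying at infinity. A multipole at \<open>\<gamma>(t)\<close> is not smooth in \<open>t\<close>; instead
  \<open>\<phi>\<close> is a limit of multipole expansions centred at polynomial curves \<open>g\<^sub>n\<close> converging to \<open>\<gamma>\<close>. Passing
  from \<open>g\<^sub>n\<close> to \<open>g\<^sub>n\<^sub>+\<^sub>1\<close>, the expansion is re-centred by Taylor's formula (Runge's pole pushing). Since
  the \<open>k\<close>-th derivatives of \<open>1 / \<bar>y\<bar>\<close> are of size \<open>C\<^sup>k k! / \<bar>y\<bar>\<^sup>k\<^sup>+\<^sup>1\<close>, a long Taylor polynomial makes the
  error as small as desired, with all derivatives up to order \<open>n\<close>, outside a ball whose radius is a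
  fixed multiple of \<open>\<bar>g\<^sub>n\<^sub>+\<^sub>1 - g\<^sub>n\<bar>\<close>.

  That \<open>u\<close> and \<open>p\<close> are unbounded near \<open>\<gamma>(t)\<close> follows from Liouville-type arguments. If \<open>\<nabla>\<phi>\<close> were bounded near \<open>\<gamma>(t)\<close>, its components would extend to harmonic
  functions vanishing at infinity, hence be zero. If \<open>p\<close> were bounded, then \<open>\<partial>\<^sub>t\<phi>\<close> would be bounded above
  near \<open>\<gamma>(t)\<close>, hence nonpositive; as it decays faster than \<open>1 / \<bar>x\<bar>\<close>, it would vanish, and again \<open>\<nabla>\<phi>\<close>
  would be bounded.
\<close>

section \<open>Iterated directional derivatives\<close>

text \<open>One re-centring controls finitely many derivatives, on a bounded time interval and
  outside a ball. Step \<open>n\<close> therefore covers times up to \<open>n\<close>, orders up to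
  \<open>n\<close> and distances beyond \<open>(1/2) ^ n\<close>; every point off the curve and
  every order is covered from some step on, which is all that smoothness of the limit asks for.
  Polynomial curves keep the expansions closed under time derivatives.

  The limit must not vanish, and this shapes the estimates. Re-centring alters an expansion only by
  O(\<open>1 / norm x ^ 3\<close>) at infinity, so each expansion keeps the dipole it starts with,
  but these constants are not uniform in \<open>n\<close>. Hence each step error also carries an
  inverse square of the distance and a small numerical factor: all steps from some \<open>N\<close>
  on sum to at most \<open>1 / (8 * (norm x)\<^sup>2)\<close>, too little to cancel a dipole on its
  axis. The start is a dipole and not a monopole because the argument for the pressure needs the
  faster decay.\<close>

primrec iter_deriv :: "'a::euclidean_space list \<Rightarrow> ('a \<Rightarrow> 'b::real_normed_vector) \<Rightarrow> 'a \<Rightarrow> 'b" where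
  "iter_deriv [] f = f"
| "iter_deriv (v # vs) f = (\<lambda>z. frechet_derivative (iter_deriv vs f) (at z) v)"

lemma iter_deriv_append: "iter_deriv (vs @ ws) f = iter_deriv vs (iter_deriv ws f)"
  by (induction vs) auto

lemma frechet_derivative_cong_open:
  assumes "open S" "z \<in> S" "\<And>w. w \<in> S \<Longrightarrow> f w = g w"
  shows "frechet_derivative f (at z) = frechet_derivative g (at z)"
proof -
  have "(f has_derivative D) (at z) \<longleftrightarrow> (g has_derivative D) (at z)" for D
    using has_derivative_transform_within_open[of f D z UNIV S g]
      has_derivative_transform_within_open[of g D z UNIV S f] assms by fastforce
  then show ?thesis
    unfolding frechet_derivative_def by simp
qed

lemma differentiable_cong_open:
  assumes "open S" "z \<in> S" "\<And>w. w \<in> S \<Longrightarrow> f w = g w"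
  shows "f differentiable (at z) \<longleftrightarrow> g differentiable (at z)"
proof -
  have "(f has_derivative D) (at z) \<longleftrightarrow> (g has_derivative D) (at z)" for D
    using has_derivative_transform_within_open[of f D z UNIV S g]
      has_derivative_transform_within_open[of g D z UNIV S f] assms by fastforce
  then show ?thesis
    unfolding differentiable_def by simp
qed

lemma iter_deriv_cong_open:
  assumes "open S" "\<And>w. w \<in> S \<Longrightarrow> f w = g w" "z \<in> S"
  shows "iter_deriv vs f z = iter_deriv vs g z"
  using assms(3)
proof (induction vs arbitrary: z)
  case Nil
  then show ?case using assms by simp
next
  case (Cons v vs)
  then have "frechet_derivative (iter_deriv vs f) (at z) = frechet_derivative (iter_deriv vs g) (at z)"
    by (intro frechet_derivative_cong_open[OF assms(1)])
  then show ?case by simp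
qed

text \<open>The recursion of \<open>Ck_on\<close> differentiates \<open>f\<close> first and so peels
  directions off the end of the list, whereas \<open>iter_deriv\<close> peels them off the front.
  Hence the induction generalises over \<open>f\<close> and splits
  \<open>vs = ws @ [w]\<close>.\<close>

lemma Ck_on_iff_iter_deriv:
  "Ck_on k S f \<longleftrightarrow> (\<forall>vs. length vs < k \<longrightarrow> (\<forall>z\<in>S. iter_deriv vs f differentiable (at z))) \<and>
     (\<forall>vs. length vs = k \<longrightarrow> continuous_on S (iter_deriv vs f))"
proof (induction k arbitrary: f)
  case 0
  then show ?case by simp
next
  case (Suc k)
  have snoc: "iter_deriv vs (\<lambda>z. frechet_derivative f (at z) v) = iter_deriv (vs @ [v]) f" for vs v
    by (simp add: iter_deriv_append)
  have dest: "length vs = Suc n \<Longrightarrow> \<exists>ws w. vs = ws @ [w] \<and> length ws = n" for vs :: "'a list" and n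
    by (metis length_Suc_conv_rev)
  show ?case
  proof
    assume C: "Ck_on (Suc k) S f"
    have d: "iter_deriv vs f differentiable (at z)" if vs: "length vs < Suc k" and "z \<in> S" for vs z
    proof (cases "length vs")
      case 0
      with C that show ?thesis by simp
    next
      case (Suc n)
      then obtain ws w where "vs = ws @ [w]" "length ws = n" using dest by blast
      with C that Suc show ?thesis by (auto simp: Suc.IH snoc)
    qed
    have "continuous_on S (iter_deriv vs f)" if vs: "length vs = Suc k" for vs
    proof -
      obtain ws w where "vs = ws @ [w]" "length ws = k" using dest[OF vs] by blast
      with C show ?thesis by (auto simp: Suc.IH snoc)
    qed
    with d show "(\<forall>vs. length vs < Suc k \<longrightarrow> (\<forall>z\<in>S. iter_deriv vs f differentiable (at z))) \<and>
      (\<forall>vs. length vs = Suc k \<longrightarrow> continuous_on S (iter_deriv vs f))" by blast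
  next
    assume R: "(\<forall>vs. length vs < Suc k \<longrightarrow> (\<forall>z\<in>S. iter_deriv vs f differentiable (at z))) \<and>
      (\<forall>vs. length vs = Suc k \<longrightarrow> continuous_on S (iter_deriv vs f))"
    then have "f differentiable (at z)" if "z \<in> S" for z
      using that by (metis iter_deriv.simps(1) list.size(3) zero_less_Suc)
    with R show "Ck_on (Suc k) S f"
      by (simp add: Suc.IH snoc)
  qed
qed

text \<open>Continuity at each order comes for free from differentiability of the same iterated
  derivative.\<close>

lemma smooth_on_iff_iter_deriv:
  "smooth_on S f \<longleftrightarrow> (\<forall>vs. \<forall>z\<in>S. iter_deriv vs f differentiable (at z))"
proof
  assume "smooth_on S f"
  then have "Ck_on (Suc (length vs)) S f" for vs :: "'a list"
    by (simp only: smooth_on_def)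
  then show "\<forall>vs. \<forall>z\<in>S. iter_deriv vs f differentiable (at z)"
    unfolding Ck_on_iff_iter_deriv by blast
next
  assume d: "\<forall>vs. \<forall>z\<in>S. iter_deriv vs f differentiable (at z)"
  then have "continuous_on S (iter_deriv vs f)" for vs
    by (simp add: differentiable_imp_continuous_on differentiable_at_imp_differentiable_on)
  with d show "smooth_on S f"
    unfolding smooth_on_def Ck_on_iff_iter_deriv by blast
qed

lemma smooth_on_iter_deriv: "smooth_on S f \<Longrightarrow> smooth_on S (iter_deriv vs f)"
  unfolding smooth_on_iff_iter_deriv by (metis iter_deriv_append)

lemma smooth_on_subset: "smooth_on S f \<Longrightarrow> T \<subseteq> S \<Longrightarrow> smooth_on T f"
  unfolding smooth_on_iff_iter_deriv by blast

lemma smooth_on_imp_continuous_on: "smooth_on S f \<Longrightarrow> continuous_on S f"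
  by (metis smooth_on_def Ck_on.simps(1))

lemma iter_deriv_has_derivative:
  assumes "smooth_on S f" "z \<in> S"
  shows "(iter_deriv vs f has_derivative (\<lambda>h. iter_deriv (h # vs) f z)) (at z)"
  using assms unfolding smooth_on_iff_iter_deriv iter_deriv.simps
  by (metis frechet_derivative_works)

lemma linear_iter_deriv:
  assumes "smooth_on S f" "z \<in> S"
  shows "linear (\<lambda>h. iter_deriv (h # vs) f z)"
  using has_derivative_linear[OF iter_deriv_has_derivative[OF assms]] .

section \<open>Linear operations on smooth functions and their iterated derivatives\<close>

lemma smooth_on_const: "smooth_on S (\<lambda>z. c)"
proof -
  have "iter_deriv vs (\<lambda>z::'a. c) = (\<lambda>z. if vs = [] then c else 0)" for vs
  proof (induction vs)
    case (Cons v vs)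
    show ?case by (simp add: Cons frechet_derivative_const)
  qed auto
  then show ?thesis
    by (simp add: smooth_on_iff_iter_deriv)
qed

lemma
  assumes f: "smooth_on S f" and g: "smooth_on S g" and S: "open S"
  shows iter_deriv_add: "z \<in> S \<Longrightarrow> iter_deriv vs (\<lambda>z. f z + g z) z = iter_deriv vs f z + iter_deriv vs g z"
    and smooth_on_add: "smooth_on S (\<lambda>z. f z + g z)"
proof -
  have main: "iter_deriv vs (\<lambda>z. f z + g z) z = iter_deriv vs f z + iter_deriv vs g z \<and>
     iter_deriv vs (\<lambda>z. f z + g z) differentiable (at z)" if "z \<in> S" for vs z
    using that
  proof (induction vs arbitrary: z)
    case Nil
    then show ?case using iter_deriv_has_derivative[OF f, of z "[]"] iter_deriv_has_derivative[OF g, of z "[]"]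
      by (auto simp: differentiable_def dest: has_derivative_add)
  next
    case (Cons v vs)
    have e: "iter_deriv (v # vs) (\<lambda>z. f z + g z) w = iter_deriv (v # vs) f w + iter_deriv (v # vs) g w" if "w \<in> S" for w
    proof -
      have "frechet_derivative (iter_deriv vs (\<lambda>z. f z + g z)) (at w) =
        frechet_derivative (\<lambda>z. iter_deriv vs f z + iter_deriv vs g z) (at w)"
        using Cons that by (intro frechet_derivative_cong_open[OF S]) auto
      also have "\<dots> = (\<lambda>h. iter_deriv (h # vs) f w + iter_deriv (h # vs) g w)"
        by (rule sym, rule frechet_derivative_at, rule has_derivative_add)
          (rule iter_deriv_has_derivative[OF f that] iter_deriv_has_derivative[OF g that])+
      finally show ?thesis by simp
    qed
    have "iter_deriv (v # vs) (\<lambda>z. f z + g z) differentiable (at z) \<longleftrightarrow>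
       (\<lambda>w. iter_deriv (v # vs) f w + iter_deriv (v # vs) g w) differentiable (at z)"
      by (rule differentiable_cong_open[OF S Cons.prems e])
    moreover have "(\<lambda>w. iter_deriv (v # vs) f w + iter_deriv (v # vs) g w) differentiable (at z)"
      using f g Cons.prems unfolding smooth_on_iff_iter_deriv by (metis differentiable_add)
    ultimately show ?case using e Cons.prems by blast
  qed
  then show "z \<in> S \<Longrightarrow> iter_deriv vs (\<lambda>z. f z + g z) z = iter_deriv vs f z + iter_deriv vs g z"
    by blast
  from main show "smooth_on S (\<lambda>z. f z + g z)"
    by (simp add: smooth_on_iff_iter_deriv)
qed

lemma
  assumes f: "smooth_on S f" and L: "bounded_linear L" and S: "open S"
  shows iter_deriv_bounded_linear: "z \<in> S \<Longrightarrow> iter_deriv vs (\<lambda>z. L (f z)) z = L (iter_deriv vs f z)"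
    and smooth_on_bounded_linear: "smooth_on S (\<lambda>z. L (f z))"
proof -
  have dL: "((\<lambda>z. L (iter_deriv vs f z)) has_derivative (\<lambda>h. L (iter_deriv (h # vs) f z))) (at z)" if "z \<in> S" for vs z
    by (rule bounded_linear.has_derivative[OF L iter_deriv_has_derivative[OF f that]])
  have e: "iter_deriv vs (\<lambda>z. L (f z)) z = L (iter_deriv vs f z)" if "z \<in> S" for vs z
    using that
  proof (induction vs arbitrary: z)
    case (Cons v vs)
    have "frechet_derivative (iter_deriv vs (\<lambda>z. L (f z))) (at z) =
        frechet_derivative (\<lambda>z. L (iter_deriv vs f z)) (at z)"
      using Cons by (intro frechet_derivative_cong_open[OF S]) auto
    also have "\<dots> = (\<lambda>h. L (iter_deriv (h # vs) f z))"
      by (rule sym, rule frechet_derivative_at, rule dL[OF Cons.prems])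
    finally show ?case by simp
  qed auto
  then show "z \<in> S \<Longrightarrow> iter_deriv vs (\<lambda>z. L (f z)) z = L (iter_deriv vs f z)" by blast
  show "smooth_on S (\<lambda>z. L (f z))"
    unfolding smooth_on_iff_iter_deriv
  proof (intro allI ballI)
    fix vs z assume z: "z \<in> S"
    have "iter_deriv vs (\<lambda>z. L (f z)) differentiable (at z) \<longleftrightarrow> (\<lambda>z. L (iter_deriv vs f z)) differentiable (at z)"
      by (rule differentiable_cong_open[OF S z e])
    with dL[OF z] show "iter_deriv vs (\<lambda>z. L (f z)) differentiable (at z)"
      by (auto simp: differentiable_def)
  qed
qed

lemma
  fixes f g :: "'a::euclidean_space \<Rightarrow> 'b::real_normed_vector"
  assumes f: "smooth_on S f" and g: "smooth_on S g" and S: "open S"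
  shows iter_deriv_diff: "z \<in> S \<Longrightarrow> iter_deriv vs (\<lambda>z. f z - g z) z = iter_deriv vs f z - iter_deriv vs g z"
    and smooth_on_diff: "smooth_on S (\<lambda>z. f z - g z)"
proof -
  have bl: "bounded_linear (\<lambda>x::'b. - x)"
    by (simp add: bounded_linear_minus bounded_linear_ident)
  note n = smooth_on_bounded_linear[OF g bl S]
  show "z \<in> S \<Longrightarrow> iter_deriv vs (\<lambda>z. f z - g z) z = iter_deriv vs f z - iter_deriv vs g z"
    using iter_deriv_add[OF f n S] iter_deriv_bounded_linear[OF g bl S] by simp
  show "smooth_on S (\<lambda>z. f z - g z)"
    using smooth_on_add[OF f n S] by simp
qed

lemma
  fixes f :: "'a::euclidean_space \<Rightarrow> real"
  assumes f: "smooth_on S f" and S: "open S"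
  shows iter_deriv_cmult: "z \<in> S \<Longrightarrow> iter_deriv vs (\<lambda>z. c * f z) z = c * iter_deriv vs f z"
    and smooth_on_cmult: "smooth_on S (\<lambda>z. c * f z)"
  using iter_deriv_bounded_linear[OF f bounded_linear_mult_right S]
    smooth_on_bounded_linear[OF f bounded_linear_mult_right S] by auto

lemma
  fixes f :: "'i \<Rightarrow> 'a::euclidean_space \<Rightarrow> 'b::real_normed_vector"
  assumes S: "open S" and f: "\<And>i. i \<in> I \<Longrightarrow> smooth_on S (f i)"
  shows smooth_on_sum: "smooth_on S (\<lambda>z. \<Sum>i\<in>I. f i z)"
    and iter_deriv_sum: "z \<in> S \<Longrightarrow> iter_deriv vs (\<lambda>z. \<Sum>i\<in>I. f i z) z = (\<Sum>i\<in>I. iter_deriv vs (f i) z)"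
proof -
  have zero: "z \<in> S \<Longrightarrow> iter_deriv vs (\<lambda>z. 0::'b) z = 0" for vs and z :: 'a
    using iter_deriv_bounded_linear[OF smooth_on_const[of S "0::'b"] bounded_linear_zero[where 'b='b] S] by simp
  have "smooth_on S (\<lambda>z. \<Sum>i\<in>I. f i z) \<and> (z \<in> S \<longrightarrow> iter_deriv vs (\<lambda>z. \<Sum>i\<in>I. f i z) z = (\<Sum>i\<in>I. iter_deriv vs (f i) z))" for z vs
    using f
  proof (induction I rule: infinite_finite_induct)
    case (insert i I)
    have si: "smooth_on S (f i)" and sI: "smooth_on S (\<lambda>z. \<Sum>i\<in>I. f i z)"
      using insert by auto
    show ?case using insert smooth_on_add[OF si sI S] iter_deriv_add[OF si sI S] by auto
  qed (auto simp: smooth_on_const zero)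
  then show "smooth_on S (\<lambda>z. \<Sum>i\<in>I. f i z)"
    "z \<in> S \<Longrightarrow> iter_deriv vs (\<lambda>z. \<Sum>i\<in>I. f i z) z = (\<Sum>i\<in>I. iter_deriv vs (f i) z)" by blast+
qed

section \<open>C^k functions: locality, sums, products and families closed under
  differentiation\<close>

lemma Ck_on_SucD: "Ck_on (Suc k) S f \<Longrightarrow> Ck_on k S f"
proof (induction k arbitrary: f)
  case 0
  then show ?case
    by (simp add: differentiable_imp_continuous_on differentiable_at_imp_differentiable_on)
next
  case (Suc k)
  then show ?case by (metis Ck_on.simps(2))
qed

lemma Ck_on_cong_open:
  assumes "open S" "\<And>w. w \<in> S \<Longrightarrow> f w = g w"
  shows "Ck_on k S f \<longleftrightarrow> Ck_on k S g"
proof -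
  have "continuous_on S (iter_deriv vs f) \<longleftrightarrow> continuous_on S (iter_deriv vs g)" for vs
    by (rule continuous_on_cong) (auto intro: iter_deriv_cong_open[OF assms])
  moreover have "iter_deriv vs f differentiable (at z) \<longleftrightarrow> iter_deriv vs g differentiable (at z)" if "z \<in> S" for vs z
    by (rule differentiable_cong_open[OF assms(1) that]) (rule iter_deriv_cong_open[OF assms])
  ultimately show ?thesis
    unfolding Ck_on_iff_iter_deriv by simp
qed

lemma Ck_on_add: "Ck_on k S f \<Longrightarrow> Ck_on k S g \<Longrightarrow> open S \<Longrightarrow> Ck_on k S (\<lambda>z. f z + g z)"
proof (induction k arbitrary: f g)
  case (Suc k)
  have "Ck_on k S (\<lambda>z. frechet_derivative (\<lambda>z. f z + g z) (at z) v)" for v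
  proof (subst Ck_on_cong_open[OF \<open>open S\<close>])
    show "frechet_derivative (\<lambda>z. f z + g z) (at w) v = frechet_derivative f (at w) v + frechet_derivative g (at w) v"
      if "w \<in> S" for w
    proof -
      have "(f has_derivative frechet_derivative f (at w)) (at w)" "(g has_derivative frechet_derivative g (at w)) (at w)"
        using that Suc.prems by (simp_all flip: frechet_derivative_works)
      from frechet_derivative_at[OF has_derivative_add[OF this]] show ?thesis by metis
    qed
    show "Ck_on k S (\<lambda>w. frechet_derivative f (at w) v + frechet_derivative g (at w) v)"
      using Suc by simp
  qed
  then show ?case using Suc.prems by (simp add: differentiable_add)
qed (auto intro: continuous_on_add)

text \<open>Induction on the order needs only the product rule once; with \<open>iter_deriv\<close>
  an explicit Leibniz formula over sublists of directions would be required.\<close>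

lemma Ck_on_mult:
  fixes f g :: "'a::euclidean_space \<Rightarrow> real"
  shows "Ck_on k S f \<Longrightarrow> Ck_on k S g \<Longrightarrow> open S \<Longrightarrow> Ck_on k S (\<lambda>z. f z * g z)"
proof (induction k arbitrary: f g)
  case (Suc k)
  have "Ck_on k S (\<lambda>z. frechet_derivative (\<lambda>z. f z * g z) (at z) v)" for v
  proof (subst Ck_on_cong_open[OF \<open>open S\<close>])
    show "frechet_derivative (\<lambda>z. f z * g z) (at w) v = f w * frechet_derivative g (at w) v + frechet_derivative f (at w) v * g w"
      if w: "w \<in> S" for w
    proof -
      have "(f has_derivative frechet_derivative f (at w)) (at w)" "(g has_derivative frechet_derivative g (at w)) (at w)"
        using w Suc.prems by (simp_all flip: frechet_derivative_works)
      from frechet_derivative_at[OF has_derivative_mult[OF this]] show ?thesis by metis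
    qed
    show "Ck_on k S (\<lambda>w. f w * frechet_derivative g (at w) v + frechet_derivative f (at w) v * g w)"
    proof (intro Ck_on_add Suc.IH \<open>open S\<close>)
      show "Ck_on k S f" "Ck_on k S g" using Suc.prems Ck_on_SucD by blast+
    qed (use Suc.prems in auto)
  qed
  then show ?case using Suc.prems by (simp add: differentiable_mult)
qed (auto intro: continuous_on_mult)

lemma smooth_on_mult:
  fixes f g :: "'a::euclidean_space \<Rightarrow> real"
  shows "smooth_on S f \<Longrightarrow> smooth_on S g \<Longrightarrow> open S \<Longrightarrow> smooth_on S (\<lambda>z. f z * g z)"
  by (simp add: smooth_on_def Ck_on_mult)

text \<open>Smoothness without formulas for higher derivatives: it is enough that a class of
  functions contains the directional derivatives of its members. Applied to
  \<open>kernel_poly\<close> and to \<open>multipole\<close>.\<close>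

lemma Ck_on_family:
  assumes S: "open S" and "f \<in> F"
    and F: "\<And>f. f \<in> F \<Longrightarrow> \<exists>f'. (\<forall>b. f' b \<in> F) \<and> (\<forall>z\<in>S. (f has_derivative (\<lambda>h. f' h z)) (at z))"
  shows "Ck_on k S f"
  using \<open>f \<in> F\<close>
proof (induction k arbitrary: f)
  case 0
  from F[OF 0] have "f differentiable (at z)" if "z \<in> S" for z
    using that unfolding differentiable_def by blast
  then show ?case
    by (simp add: differentiable_imp_continuous_on differentiable_at_imp_differentiable_on)
next
  case (Suc k)
  obtain f' where f': "\<forall>b. f' b \<in> F" "\<forall>z\<in>S. (f has_derivative (\<lambda>h. f' h z)) (at z)"
    using F[OF Suc.prems] by blast
  have "Ck_on k S (\<lambda>z. frechet_derivative f (at z) v)" for v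
  proof (subst Ck_on_cong_open[OF S])
    show "frechet_derivative f (at w) v = f' v w" if "w \<in> S" for w
      using frechet_derivative_at f' that by metis
    show "Ck_on k S (f' v)" using f' Suc by blast
  qed
  with f' show ?case by (auto simp: differentiable_def)
qed

lemma smooth_on_family:
  assumes "open S" "f \<in> F"
    "\<And>f. f \<in> F \<Longrightarrow> \<exists>f'. (\<forall>b. f' b \<in> F) \<and> (\<forall>z\<in>S. (f has_derivative (\<lambda>h. f' h z)) (at z))"
  shows "smooth_on S f"
  unfolding smooth_on_def using Ck_on_family[OF assms] by blast

text \<open>Serves for translates of \<open>newton\<close> and, with \<open>A x = (x, 0)\<close>,
  for restricting a function on spacetime to a fixed time.\<close>

lemma
  fixes A :: "'a::euclidean_space \<Rightarrow> 'b::euclidean_space"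
  assumes f: "smooth_on S f" and A: "linear A" and S: "open S"
  shows iter_deriv_affine: "A x + c \<in> S \<Longrightarrow> iter_deriv vs (\<lambda>x. f (A x + c)) x = iter_deriv (map A vs) f (A x + c)"
    and smooth_on_affine: "smooth_on {x. A x + c \<in> S} (\<lambda>x. f (A x + c))"
proof -
  have bl: "bounded_linear A" using A by (simp add: linear_conv_bounded_linear)
  have o: "open {x. A x + c \<in> S}"
  proof -
    have "open ((\<lambda>x. A x + c) -` S)"
      by (rule open_vimage[OF S]) (intro continuous_intros bounded_linear.continuous_on[OF bl])
    then show ?thesis by (simp add: vimage_def)
  qed
  have d: "((\<lambda>x. iter_deriv ws f (A x + c)) has_derivative (\<lambda>h. iter_deriv (A h # ws) f (A x + c))) (at x)"
    if "A x + c \<in> S" for x ws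
  proof -
    have "((\<lambda>x. A x + c) has_derivative A) (at x)"
      using bounded_linear.has_derivative[OF bl has_derivative_ident] has_derivative_add_const by blast
    from has_derivative_compose[OF this iter_deriv_has_derivative[OF f that]] show ?thesis by simp
  qed
  have e: "iter_deriv vs (\<lambda>x. f (A x + c)) x = iter_deriv (map A vs) f (A x + c)" if "A x + c \<in> S" for x vs
    using that
  proof (induction vs arbitrary: x)
    case (Cons v vs)
    have "frechet_derivative (iter_deriv vs (\<lambda>x. f (A x + c))) (at x) =
        frechet_derivative (\<lambda>x. iter_deriv (map A vs) f (A x + c)) (at x)"
      using Cons by (intro frechet_derivative_cong_open[OF o]) auto
    also have "\<dots> = (\<lambda>h. iter_deriv (A h # map A vs) f (A x + c))"
      by (rule sym, rule frechet_derivative_at, rule d[OF Cons.prems])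
    finally show ?case by simp
  qed auto
  then show "A x + c \<in> S \<Longrightarrow> iter_deriv vs (\<lambda>x. f (A x + c)) x = iter_deriv (map A vs) f (A x + c)" by blast
  show "smooth_on {x. A x + c \<in> S} (\<lambda>x. f (A x + c))"
    unfolding smooth_on_iff_iter_deriv
  proof (intro allI ballI)
    fix vs x assume x: "x \<in> {x. A x + c \<in> S}"
    have "iter_deriv vs (\<lambda>x. f (A x + c)) differentiable (at x) \<longleftrightarrow> (\<lambda>x. iter_deriv (map A vs) f (A x + c)) differentiable (at x)"
      by (rule differentiable_cong_open[OF o x]) (auto intro: e)
    with d x show "iter_deriv vs (\<lambda>x. f (A x + c)) differentiable (at x)"
      by (auto simp: differentiable_def)
  qed
qed

text \<open>Two applications of the mean value theorem to the second difference of \<open>f\<close>, which is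
  symmetric in \<open>v\<close> and \<open>w\<close>.\<close>

lemma second_difference_mean_value:
  fixes f :: "'a::euclidean_space \<Rightarrow> real"
  assumes f: "smooth_on S f" and "0 < h"
    and sub: "\<And>s t. 0 \<le> s \<Longrightarrow> s \<le> h \<Longrightarrow> 0 \<le> t \<Longrightarrow> t \<le> h \<Longrightarrow> x + s *\<^sub>R v + t *\<^sub>R w \<in> S"
  shows "\<exists>s t. 0 \<le> s \<and> s \<le> h \<and> 0 \<le> t \<and> t \<le> h \<and>
    f (x + h *\<^sub>R v + h *\<^sub>R w) - f (x + h *\<^sub>R v) - f (x + h *\<^sub>R w) + f x =
      h * h * iter_deriv [w, v] f (x + s *\<^sub>R v + t *\<^sub>R w)"
proof -
  have dv: "((\<lambda>s. iter_deriv vs f (x + s *\<^sub>R v + t *\<^sub>R w)) has_real_derivative iter_deriv (v # vs) f (x + s *\<^sub>R v + t *\<^sub>R w)) (at s)"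
    if "x + s *\<^sub>R v + t *\<^sub>R w \<in> S" for vs s t
  proof -
    have "((\<lambda>s. x + s *\<^sub>R v + t *\<^sub>R w) has_derivative (\<lambda>h. h *\<^sub>R v)) (at s)"
      by (auto intro!: derivative_eq_intros)
    from has_derivative_compose[OF this iter_deriv_has_derivative[OF f that, of vs]]
    show ?thesis unfolding has_field_derivative_def
      using linear_scale[OF linear_iter_deriv[OF f that, of vs]]
      by (elim has_derivative_eq_rhs) (auto simp: mult.commute)
  qed
  have dw: "((\<lambda>t. iter_deriv vs f (x + s *\<^sub>R v + t *\<^sub>R w)) has_real_derivative iter_deriv (w # vs) f (x + s *\<^sub>R v + t *\<^sub>R w)) (at t)"
    if "x + s *\<^sub>R v + t *\<^sub>R w \<in> S" for vs s t
  proof -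
    have "((\<lambda>t. x + s *\<^sub>R v + t *\<^sub>R w) has_derivative (\<lambda>h. h *\<^sub>R w)) (at t)"
      by (auto intro!: derivative_eq_intros)
    from has_derivative_compose[OF this iter_deriv_has_derivative[OF f that, of vs]]
    show ?thesis unfolding has_field_derivative_def
      using linear_scale[OF linear_iter_deriv[OF f that, of vs]]
      by (elim has_derivative_eq_rhs) (auto simp: mult.commute)
  qed
  have "\<exists>s>0. s < h \<and> (f (x + h *\<^sub>R v + h *\<^sub>R w) - f (x + h *\<^sub>R v + 0 *\<^sub>R w)) - (f (x + 0 *\<^sub>R v + h *\<^sub>R w) - f (x + 0 *\<^sub>R v + 0 *\<^sub>R w)) =
     (h - 0) * (iter_deriv [v] f (x + s *\<^sub>R v + h *\<^sub>R w) - iter_deriv [v] f (x + s *\<^sub>R v + 0 *\<^sub>R w))"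
    by (rule MVT2[OF \<open>0 < h\<close>])
      (use dv[of _ _ "[]"] sub \<open>0 < h\<close> in \<open>auto intro!: DERIV_diff simp del: scaleR_zero_left\<close>)
  then obtain s where s: "0 < s" "s < h" and s_eq:
    "f (x + h *\<^sub>R v + h *\<^sub>R w) - f (x + h *\<^sub>R v) - f (x + h *\<^sub>R w) + f x =
     h * (iter_deriv [v] f (x + s *\<^sub>R v + h *\<^sub>R w) - iter_deriv [v] f (x + s *\<^sub>R v + 0 *\<^sub>R w))" by auto
  have "\<exists>t>0. t < h \<and> iter_deriv [v] f (x + s *\<^sub>R v + h *\<^sub>R w) - iter_deriv [v] f (x + s *\<^sub>R v + 0 *\<^sub>R w) =
     (h - 0) * iter_deriv [w, v] f (x + s *\<^sub>R v + t *\<^sub>R w)"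
    by (rule MVT2[OF \<open>0 < h\<close>]) (use dw[of _ _ "[v]"] sub s in auto)
  then show ?thesis using s s_eq by (metis less_imp_le mult.assoc diff_zero)
qed

text \<open>Schwarz's theorem. The same second difference is \<open>h * h\<close> times either mixed
  derivative at some point near \<open>x\<close>, so the two agree there in value; continuity at
  \<open>x\<close>, with \<open>e\<close> half of the supposed gap, gives the contradiction.\<close>

lemma iter_deriv_commute2:
  fixes f :: "'a::euclidean_space \<Rightarrow> real"
  assumes f: "smooth_on S f" and S: "open S" and x: "x \<in> S"
  shows "iter_deriv [v, w] f x = iter_deriv [w, v] f x"
proof (rule ccontr)
  assume ne: "iter_deriv [v, w] f x \<noteq> iter_deriv [w, v] f x"
  define e where "e = \<bar>iter_deriv [v, w] f x - iter_deriv [w, v] f x\<bar> / 2"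
  have e: "e > 0" using ne by (simp add: e_def)
  have cont: "isCont (iter_deriv vs f) x" for vs
    using smooth_on_imp_continuous_on[OF smooth_on_iter_deriv[OF f]] S x
    by (metis continuous_on_eq_continuous_at)
  obtain r1 where r1: "r1 > 0" "\<And>y. dist y x < r1 \<Longrightarrow> dist (iter_deriv [v, w] f y) (iter_deriv [v, w] f x) < e"
    using cont[of "[v, w]"] e unfolding continuous_at_eps_delta by metis
  obtain r2 where r2: "r2 > 0" "\<And>y. dist y x < r2 \<Longrightarrow> dist (iter_deriv [w, v] f y) (iter_deriv [w, v] f x) < e"
    using cont[of "[w, v]"] e unfolding continuous_at_eps_delta by metis
  obtain r3 where r3: "r3 > 0" "ball x r3 \<subseteq> S" using S x open_contains_ball by blast
  define r where "r = min r1 (min r2 r3)"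
  define h where "h = r / (norm v + norm w + 1) / 2"
  have r: "r > 0" using r1 r2 r3 by (simp add: r_def)
  have nv: "norm v + norm w + 1 > 0" by (smt (verit) norm_ge_zero)
  have h: "h > 0" using r nv by (simp add: h_def)
  have near: "dist (x + s *\<^sub>R v + t *\<^sub>R w) x < r" if "0 \<le> s" "s \<le> h" "0 \<le> t" "t \<le> h" for s t
  proof -
    have "dist (x + s *\<^sub>R v + t *\<^sub>R w) x \<le> norm (s *\<^sub>R v) + norm (t *\<^sub>R w)"
      by (simp add: dist_norm add.assoc norm_triangle_ineq del: norm_scaleR)
    also have "\<dots> \<le> h * norm v + h * norm w"
      using that by (auto intro!: add_mono mult_right_mono)
    also have "\<dots> \<le> h * (norm v + norm w + 1)" using h by (simp add: algebra_simps)
    also have "\<dots> = r / 2" using nv unfolding h_def by (simp only: divide_divide_eq_left) (simp add: field_simps)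
    also have "\<dots> < r" using r by simp
    finally show ?thesis .
  qed
  have near': "dist (x + s *\<^sub>R w + t *\<^sub>R v) x < r" if "0 \<le> s" "s \<le> h" "0 \<le> t" "t \<le> h" for s t
    using near[of t s] that by (simp add: algebra_simps)
  have in_S: "dist y x < r \<Longrightarrow> y \<in> S" for y using r3 by (auto simp: r_def dist_commute subset_iff)
  obtain s t where st: "0 \<le> s" "s \<le> h" "0 \<le> t" "t \<le> h"
    "f (x + h *\<^sub>R v + h *\<^sub>R w) - f (x + h *\<^sub>R v) - f (x + h *\<^sub>R w) + f x = h * h * iter_deriv [w, v] f (x + s *\<^sub>R v + t *\<^sub>R w)"
    using second_difference_mean_value[OF f h, of x v w] near in_S by blast
  obtain s' t' where st': "0 \<le> s'" "s' \<le> h" "0 \<le> t'" "t' \<le> h"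
    "f (x + h *\<^sub>R w + h *\<^sub>R v) - f (x + h *\<^sub>R w) - f (x + h *\<^sub>R v) + f x = h * h * iter_deriv [v, w] f (x + s' *\<^sub>R w + t' *\<^sub>R v)"
    using second_difference_mean_value[OF f h, of x w v] near' in_S by blast
  have "f (x + h *\<^sub>R w + h *\<^sub>R v) = f (x + h *\<^sub>R v + h *\<^sub>R w)" by (simp add: algebra_simps)
  then have "h * h * iter_deriv [v, w] f (x + s' *\<^sub>R w + t' *\<^sub>R v) = h * h * iter_deriv [w, v] f (x + s *\<^sub>R v + t *\<^sub>R w)"
    using st(5) st'(5) by linarith
  then have "iter_deriv [v, w] f (x + s' *\<^sub>R w + t' *\<^sub>R v) = iter_deriv [w, v] f (x + s *\<^sub>R v + t *\<^sub>R w)"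
    using h by simp
  moreover have "dist (iter_deriv [v, w] f (x + s' *\<^sub>R w + t' *\<^sub>R v)) (iter_deriv [v, w] f x) < e"
    using r1 near'[OF st'(1-4)] by (simp add: r_def)
  moreover have "dist (iter_deriv [w, v] f (x + s *\<^sub>R v + t *\<^sub>R w)) (iter_deriv [w, v] f x) < e"
    using r2 near[OF st(1-4)] by (simp add: r_def)
  ultimately show False unfolding e_def dist_real_def by argo
qed

lemma iter_deriv_swap:
  fixes f :: "'a::euclidean_space \<Rightarrow> real"
  assumes f: "smooth_on S f" and S: "open S" and x: "x \<in> S"
  shows "iter_deriv (us @ v # w # vs) f x = iter_deriv (us @ w # v # vs) f x"
proof -
  have "iter_deriv (v # w # vs) f y = iter_deriv (w # v # vs) f y" if "y \<in> S" for y
    using iter_deriv_commute2[OF smooth_on_iter_deriv[OF f] S that, where v = v and w = w and vs1 = vs] by simp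
  then show ?thesis
    unfolding iter_deriv_append by (rule iter_deriv_cong_open[OF S _ x])
qed

lemma iter_deriv_move:
  fixes f :: "'a::euclidean_space \<Rightarrow> real"
  assumes "smooth_on S f" "open S" "x \<in> S"
  shows "iter_deriv (us @ v # vs) f x = iter_deriv (v # us @ vs) f x"
proof (induction us arbitrary: vs rule: rev_induct)
  case Nil
  show ?case by simp
next
  case (snoc u us)
  have "iter_deriv (us @ v # u # vs) f x = iter_deriv (us @ u # v # vs) f x"
    by (rule iter_deriv_swap[OF assms])
  then show ?case
    using snoc.IH[of "u # vs"] by (metis append_Cons append_Nil append_assoc)
qed

section \<open>Derivatives of the Newtonian potential\<close>

definition newton :: "real^3 \<Rightarrow> real" where
  "newton y = 1 / norm y"

text \<open>Minus the logarithmic derivative of \<open>newton\<close> along \<open>v\<close>. With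
  these functions as generators, differentiation produces nothing but polynomials in
  \<open>newton\<close> and \<open>incl\<close>.\<close>

definition incl :: "real^3 \<Rightarrow> real^3 \<Rightarrow> real" where
  "incl v y = (v \<bullet> y) / (norm y)\<^sup>2"

lemma newton_has_derivative:
  assumes "y \<noteq> 0"
  shows "(newton has_derivative (\<lambda>h. - (incl h y * newton y))) (at y)"
proof -
  have n: "(norm has_derivative (\<lambda>h. sgn y \<bullet> h)) (at y)"
    by (rule has_derivative_eq_rhs[OF has_derivative_norm[OF assms]]) (simp add: inner_commute fun_eq_iff)
  have "((\<lambda>y. inverse (norm y)) has_derivative (\<lambda>h. - (inverse (norm y) * (sgn y \<bullet> h) * inverse (norm y)))) (at y)"
    by (rule Deriv.has_derivative_inverse[OF _ n]) (simp add: assms)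
  moreover have "(\<lambda>h. - (inverse (norm y) * (sgn y \<bullet> h) * inverse (norm y))) = (\<lambda>h. - (incl h y * newton y))"
    using assms
    by (simp add: fun_eq_iff incl_def newton_def sgn_div_norm inner_commute divide_inverse power2_eq_square)
  moreover have "newton = (\<lambda>y. inverse (norm y))"
    by (simp add: fun_eq_iff newton_def divide_inverse)
  ultimately show ?thesis by simp
qed

lemma incl_has_derivative:
  assumes "y \<noteq> 0"
  shows "(incl v has_derivative (\<lambda>h. (v \<bullet> h) * (newton y * newton y) - 2 * (incl h y * incl v y))) (at y)"
proof -
  have eq: "incl v = (\<lambda>y. (v \<bullet> y) * (newton y * newton y))" for v
    by (simp add: fun_eq_iff incl_def newton_def power2_eq_square)
  have n: "((\<lambda>y. newton y * newton y) has_derivative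
     (\<lambda>h. newton y * - (incl h y * newton y) + - (incl h y * newton y) * newton y)) (at y)"
    by (intro has_derivative_mult newton_has_derivative assms)
  have "((\<lambda>y. v \<bullet> y) has_derivative (\<lambda>h. v \<bullet> h)) (at y)"
    by (rule bounded_linear_imp_has_derivative[OF bounded_linear_inner_right])
  from has_derivative_mult[OF this n] show ?thesis
    unfolding eq[of v] by (rule has_derivative_eq_rhs) (simp add: fun_eq_iff algebra_simps)
qed

text \<open>\<open>kernel_poly q c\<close>: polynomials, homogeneous of degree \<open>q\<close>, in \<open>newton\<close> and the \<open>incl v\<close>, whose
  coefficients have total size at most \<open>c\<close> when the \<open>v\<close> are normalised. A derivative turns
  each of the \<open>q\<close> factors of a monomial into at most three new monomials; this gives the factor \<open>3 * q\<close> below.\<close>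

inductive kernel_poly :: "nat \<Rightarrow> real \<Rightarrow> (real^3 \<Rightarrow> real) \<Rightarrow> bool" where
  kp_const: "\<bar>a\<bar> \<le> c \<Longrightarrow> kernel_poly 0 c (\<lambda>y. a)"
| kp_newton: "kernel_poly q c f \<Longrightarrow> kernel_poly (Suc q) c (\<lambda>y. newton y * f y)"
| kp_incl: "kernel_poly q c f \<Longrightarrow> kernel_poly (Suc q) (norm v * c) (\<lambda>y. incl v y * f y)"
| kp_add: "kernel_poly q c f \<Longrightarrow> kernel_poly q d g \<Longrightarrow> kernel_poly q (c + d) (\<lambda>y. f y + g y)"

lemma kernel_poly_nonneg: "kernel_poly q c f \<Longrightarrow> 0 \<le> c"
  by (induction rule: kernel_poly.induct) auto

lemma kernel_poly_zero: "0 \<le> c \<Longrightarrow> kernel_poly q c (\<lambda>y. 0)"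
proof (induction q)
  case 0
  then show ?case using kp_const[of 0 c] by simp
next
  case (Suc q)
  then show ?case using kp_newton[of q c "\<lambda>y. 0"] by simp
qed

lemma kernel_poly_mono: "kernel_poly q c f \<Longrightarrow> c \<le> d \<Longrightarrow> kernel_poly q d f"
  using kp_add[of q c f "d - c" "\<lambda>y. 0"] kernel_poly_zero[of "d - c" q] by simp

lemma kernel_poly_scale: "kernel_poly q c f \<Longrightarrow> kernel_poly q (\<bar>a\<bar> * c) (\<lambda>y. a * f y)"
proof (induction rule: kernel_poly.induct)
  case (kp_const b c)
  then show ?case by (intro kernel_poly.kp_const) (simp add: abs_mult mult_left_mono)
next
  case (kp_newton q c f)
  from kernel_poly.kp_newton[OF kp_newton.IH] show ?case by (simp add: mult.left_commute)
next
  case (kp_incl q c f v)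
  from kernel_poly.kp_incl[OF kp_incl.IH, of v] show ?case by (simp add: mult.left_commute)
next
  case (kp_add q c f d g)
  from kernel_poly.kp_add[OF kp_add.IH] show ?case by (simp add: distrib_left)
qed

lemma kernel_poly_bound:
  assumes "kernel_poly q c f" "y \<noteq> 0"
  shows "\<bar>f y\<bar> \<le> c / norm y ^ q"
  using assms(1)
proof (induction rule: kernel_poly.induct)
  case (kp_newton q c f)
  then show ?case using assms(2) by (simp add: newton_def abs_mult divide_simps mult.commute)
next
  case (kp_incl q c f v)
  have "\<bar>incl v y\<bar> \<le> norm v / norm y"
    using Cauchy_Schwarz_ineq2[of v y] assms(2) by (simp add: incl_def divide_simps power2_eq_square)
  then have "\<bar>incl v y\<bar> * \<bar>f y\<bar> \<le> (norm v / norm y) * (c / norm y ^ q)"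
    using kp_incl by (intro mult_mono) auto
  then show ?case by (simp add: abs_mult)
next
  case (kp_add q c f d g)
  then show ?case using abs_triangle_ineq[of "f y" "g y"] by (simp add: add_divide_distrib)
qed auto

lemma kernel_poly_has_derivative:
  assumes "kernel_poly q c f"
  shows "\<exists>f'. (\<forall>h. kernel_poly (Suc q) (3 * real q * c * norm h) (f' h)) \<and>
    (\<forall>y. y \<noteq> 0 \<longrightarrow> (f has_derivative (\<lambda>h. f' h y)) (at y))"
  using assms
proof (induction rule: kernel_poly.induct)
  case (kp_const a c)
  show ?case by (rule exI[of _ "\<lambda>h y. 0"]) (simp add: kernel_poly_zero)
next
  case (kp_newton q c f)
  then obtain f' where f': "\<And>h. kernel_poly (Suc q) (3 * real q * c * norm h) (f' h)"
    "\<And>y. y \<noteq> 0 \<Longrightarrow> (f has_derivative (\<lambda>h. f' h y)) (at y)" by blast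
  let ?g = "\<lambda>h y. newton y * f' h y + - 1 * (incl h y * (newton y * f y))"
  have "kernel_poly (Suc (Suc q)) (3 * real q * c * norm h + \<bar>- 1\<bar> * (norm h * c)) (?g h)" for h
    by (rule kernel_poly.kp_add[OF kernel_poly.kp_newton[OF f'(1)]
          kernel_poly_scale[OF kernel_poly.kp_incl[OF kernel_poly.kp_newton[OF kp_newton.hyps]]]])
  then have "kernel_poly (Suc (Suc q)) (3 * real (Suc q) * c * norm h) (?g h)" for h
    by (rule kernel_poly_mono) (use kernel_poly_nonneg[OF kp_newton.hyps] in \<open>simp add: algebra_simps\<close>)
  moreover have "((\<lambda>y. newton y * f y) has_derivative (\<lambda>h. ?g h y)) (at y)" if "y \<noteq> 0" for y
    using has_derivative_mult[OF newton_has_derivative[OF that] f'(2)[OF that]]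
    by (rule has_derivative_eq_rhs) (simp add: fun_eq_iff algebra_simps)
  ultimately show ?case by (intro exI[of _ ?g] conjI allI impI)
next
  case (kp_incl q c f v)
  then obtain f' where f': "\<And>h. kernel_poly (Suc q) (3 * real q * c * norm h) (f' h)"
    "\<And>y. y \<noteq> 0 \<Longrightarrow> (f has_derivative (\<lambda>h. f' h y)) (at y)" by blast
  \<comment> \<open>Differentiating the new factor \<open>incl v\<close> contributes weight
    \<open>1 + 2 = 3\<close>, exactly the increase from \<open>3 * q\<close> to
    \<open>3 * Suc q\<close>.\<close>
  let ?g = "\<lambda>h y. incl v y * f' h y +
    ((v \<bullet> h) * (newton y * (newton y * f y)) + - 2 * (incl h y * (incl v y * f y)))"
  have "kernel_poly (Suc (Suc q)) (norm v * (3 * real q * c * norm h) +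
     (\<bar>v \<bullet> h\<bar> * c + \<bar>- 2\<bar> * (norm h * (norm v * c)))) (?g h)" for h
    by (rule kernel_poly.kp_add[OF kernel_poly.kp_incl[OF f'(1)]
          kernel_poly.kp_add[OF kernel_poly_scale[OF kp_newton[OF kp_newton[OF kp_incl.hyps]]]
            kernel_poly_scale[OF kernel_poly.kp_incl[OF kernel_poly.kp_incl[OF kp_incl.hyps]]]]])
  moreover have "\<bar>v \<bullet> h\<bar> * c \<le> norm v * norm h * c" for h
    using Cauchy_Schwarz_ineq2[of v h] kernel_poly_nonneg[OF kp_incl.hyps] by (intro mult_right_mono) auto
  then have "norm v * (3 * real q * c * norm h) + (\<bar>v \<bullet> h\<bar> * c + \<bar>- 2\<bar> * (norm h * (norm v * c)))
      \<le> 3 * real (Suc q) * (norm v * c) * norm h" for h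
    by (simp add: algebra_simps)
  ultimately have "kernel_poly (Suc (Suc q)) (3 * real (Suc q) * (norm v * c) * norm h) (?g h)" for h
    using kernel_poly_mono by blast
  moreover have "((\<lambda>y. incl v y * f y) has_derivative (\<lambda>h. ?g h y)) (at y)" if "y \<noteq> 0" for y
    using has_derivative_mult[OF incl_has_derivative[OF that] f'(2)[OF that]]
    by (rule has_derivative_eq_rhs) (simp add: fun_eq_iff algebra_simps)
  ultimately show ?case by (intro exI[of _ ?g] conjI allI impI)
next
  case (kp_add q c f d g)
  then obtain f' g' where f': "\<And>h. kernel_poly (Suc q) (3 * real q * c * norm h) (f' h)"
    "\<And>y. y \<noteq> 0 \<Longrightarrow> (f has_derivative (\<lambda>h. f' h y)) (at y)"
    and g': "\<And>h. kernel_poly (Suc q) (3 * real q * d * norm h) (g' h)"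
    "\<And>y. y \<noteq> 0 \<Longrightarrow> (g has_derivative (\<lambda>h. g' h y)) (at y)" by blast
  have "kernel_poly (Suc q) (3 * real q * c * norm h + 3 * real q * d * norm h) (\<lambda>y. f' h y + g' h y)" for h
    by (rule kernel_poly.kp_add[OF f'(1) g'(1)])
  then have "kernel_poly (Suc q) (3 * real q * (c + d) * norm h) (\<lambda>y. f' h y + g' h y)" for h
    by (simp add: algebra_simps)
  moreover have "((\<lambda>y. f y + g y) has_derivative (\<lambda>h. f' h y + g' h y)) (at y)" if "y \<noteq> 0" for y
    by (intro has_derivative_add f' g' that)
  ultimately show ?case by (intro exI[of _ "\<lambda>h y. f' h y + g' h y"] conjI allI impI)
qed

lemma smooth_on_kernel_poly:
  assumes "kernel_poly q c f"
  shows "smooth_on (- {0}) f"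
proof (rule smooth_on_family[where F = "{f. \<exists>q c. kernel_poly q c f}"])
  fix f assume "f \<in> {f. \<exists>q c. kernel_poly q c f}"
  then obtain q c where "kernel_poly q c f" by blast
  from kernel_poly_has_derivative[OF this] show
    "\<exists>f'. (\<forall>b. f' b \<in> {f. \<exists>q c. kernel_poly q c f}) \<and> (\<forall>z\<in>- {0}. (f has_derivative (\<lambda>h. f' h z)) (at z))"
    by fastforce
qed (use assms in auto)

lemma kernel_poly_newton: "kernel_poly 1 1 newton"
  using kp_newton[OF kp_const[of 1 1]] by simp

lemma smooth_on_newton: "smooth_on (- {0}) newton"
  by (rule smooth_on_kernel_poly[OF kernel_poly_newton])

text \<open>Each derivative raises the degree by one, starting from degree 1, so the factors
  \<open>3 * 1\<close>, \<open>3 * 2\<close>, ... multiply to \<open>3 ^ k * fact k\<close>. The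
  single factorial is what makes Taylor remainders geometrically small.\<close>

lemma iter_deriv_newton_kernel_poly:
  "\<exists>f. kernel_poly (Suc (length vs)) (3 ^ length vs * fact (length vs) * prod_list (map norm vs)) f \<and>
     (\<forall>y. y \<noteq> 0 \<longrightarrow> iter_deriv vs newton y = f y)"
proof (induction vs)
  case Nil
  then show ?case using kernel_poly_newton by auto
next
  case (Cons v vs)
  then obtain f where f: "kernel_poly (Suc (length vs)) (3 ^ length vs * fact (length vs) * prod_list (map norm vs)) f"
    "\<And>y. y \<noteq> 0 \<Longrightarrow> iter_deriv vs newton y = f y" by blast
  obtain f' where f': "\<And>h. kernel_poly (Suc (Suc (length vs)))
      (3 * real (Suc (length vs)) * (3 ^ length vs * fact (length vs) * prod_list (map norm vs)) * norm h) (f' h)"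
    "\<And>y. y \<noteq> 0 \<Longrightarrow> (f has_derivative (\<lambda>h. f' h y)) (at y)"
    using kernel_poly_has_derivative[OF f(1)] by blast
  have "iter_deriv (v # vs) newton y = f' v y" if "y \<noteq> 0" for y
  proof -
    have "frechet_derivative (iter_deriv vs newton) (at y) = frechet_derivative f (at y)"
      by (rule frechet_derivative_cong_open[of "- {0}"]) (use that f in auto)
    then show ?thesis using frechet_derivative_at[OF f'(2)[OF that]] by (metis iter_deriv.simps(2))
  qed
  moreover have "3 * real (Suc (length vs)) * (3 ^ length vs * fact (length vs) * prod_list (map norm vs)) * norm v =
    3 ^ length (v # vs) * fact (length (v # vs)) * prod_list (map norm (v # vs))"
    by (simp add: algebra_simps)
  ultimately show ?case using f'(1)[of v] by (metis length_Cons)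
qed

lemma iter_deriv_newton_bound:
  assumes "y \<noteq> 0"
  shows "\<bar>iter_deriv vs newton y\<bar> \<le>
    3 ^ length vs * fact (length vs) * prod_list (map norm vs) / norm y ^ Suc (length vs)"
  using iter_deriv_newton_kernel_poly[of vs] kernel_poly_bound[OF _ assms] assms by metis

text \<open>For \<open>vs = []\<close> the two terms of the Laplacian cancel because the dimension
  is 3. The other cases follow by differentiating this identity, since derivatives commute with the
  Laplacian.\<close>

lemma iter_deriv_newton_harmonic:
  assumes "y \<noteq> 0"
  shows "(\<Sum>b\<in>Basis. iter_deriv (b # b # vs) newton y) = 0"
proof -
  have o: "open (- {0::real^3})" by (rule open_Compl[OF closed_singleton])
  have d1: "iter_deriv [h] newton y = - (incl h y * newton y)" if "y \<noteq> 0" for h y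
    using frechet_derivative_at[OF newton_has_derivative[OF that]] by (metis iter_deriv.simps)
  have d2: "iter_deriv [h, h] newton y = 3 * newton y * (incl h y)\<^sup>2 - (h \<bullet> h) * newton y ^ 3" if "y \<noteq> 0" for h y
  proof -
    have "iter_deriv [h, h] newton y = frechet_derivative (\<lambda>y. - (incl h y * newton y)) (at y) h"
      using frechet_derivative_cong_open[OF o, of y "iter_deriv [h] newton" "\<lambda>y. - (incl h y * newton y)"] d1 that by simp
    also have "\<dots> = - (incl h y * (- (incl h y * newton y)) + ((h \<bullet> h) * (newton y * newton y) - 2 * (incl h y * incl h y)) * newton y)"
      by (rule fun_cong[OF frechet_derivative_at[OF has_derivative_minus[OF
            has_derivative_mult[OF incl_has_derivative[OF that] newton_has_derivative[OF that]]], symmetric]])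
    finally show ?thesis by (simp add: algebra_simps power2_eq_square power3_eq_cube)
  qed
  have lap: "(\<Sum>b\<in>Basis. iter_deriv [b, b] newton y) = 0" if "y \<noteq> 0" for y
  proof -
    have "(\<Sum>b\<in>Basis. (incl b y)\<^sup>2) = (\<Sum>b\<in>Basis. (y \<bullet> b) * (y \<bullet> b)) / (norm y)^4"
      by (simp add: incl_def sum_divide_distrib power_divide power2_eq_square inner_commute power4_eq_xxxx mult.assoc)
    also have "\<dots> = newton y ^ 2"
      using that by (simp add: newton_def euclidean_inner[of y y, symmetric] dot_square_norm power_divide power4_eq_xxxx power2_eq_square)
    finally have i: "(\<Sum>b\<in>Basis. (incl b y)\<^sup>2) = newton y ^ 2" .
    have "(\<Sum>b\<in>Basis. iter_deriv [b, b] newton y) =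
      (\<Sum>b\<in>Basis. 3 * newton y * (incl b y)\<^sup>2 - (b \<bullet> b) * newton y ^ 3)"
      by (rule sum.cong[OF refl d2[OF that]])
    also have "\<dots> = 3 * newton y * newton y ^ 2 - (\<Sum>b\<in>(Basis::(real^3) set). (b \<bullet> b)) * newton y ^ 3"
      by (simp only: sum_subtractf sum_distrib_left[symmetric] sum_distrib_right[symmetric] i)
    also have "(\<Sum>b\<in>(Basis::(real^3) set). b \<bullet> b) = 3"
      by (simp add: dot_square_norm)
    finally show ?thesis by (simp add: power2_eq_square power3_eq_cube)
  qed
  show ?thesis using assms
  proof (induction vs arbitrary: y)
    case Nil
    then show ?case by (rule lap)
  next
    case (Cons v vs)
    let ?h = "\<lambda>y. \<Sum>b\<in>Basis. iter_deriv (b # b # vs) newton y"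
    have "iter_deriv (b # b # v # vs) newton y = iter_deriv (v # b # b # vs) newton y" for b
      using iter_deriv_move[OF smooth_on_newton o, of y "[b, b]" v vs] Cons.prems by simp
    then have "(\<Sum>b\<in>Basis. iter_deriv (b # b # v # vs) newton y) = (\<Sum>b\<in>Basis. iter_deriv [v] (iter_deriv (b # b # vs) newton) y)"
      by simp
    also have "\<dots> = iter_deriv [v] ?h y"
      by (rule iter_deriv_sum[symmetric, OF o smooth_on_iter_deriv[OF smooth_on_newton]]) (use Cons in auto)
    also have "\<dots> = iter_deriv [v] (\<lambda>y. 0) y"
      by (rule iter_deriv_cong_open[OF o]) (use Cons in auto)
    finally show ?case by (simp add: frechet_derivative_const)
  qed
qed

section \<open>Taylor remainders of the kernel along a line\<close>

definition taylor_rem :: "real^3 \<Rightarrow> nat \<Rightarrow> (real^3) list \<Rightarrow> real^3 \<Rightarrow> real \<Rightarrow> real" where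
  "taylor_rem e k vs y s = iter_deriv vs newton (y + s *\<^sub>R e) -
     (\<Sum>i<k. s ^ i / fact i * iter_deriv (replicate i e @ vs) newton y)"

lemma iter_deriv_newton_has_derivative:
  "y \<noteq> 0 \<Longrightarrow> (iter_deriv vs newton has_derivative (\<lambda>h. iter_deriv (h # vs) newton y)) (at y)"
  by (rule iter_deriv_has_derivative[OF smooth_on_newton]) simp

lemma linear_iter_deriv_newton: "y \<noteq> 0 \<Longrightarrow> linear (\<lambda>h. iter_deriv (h # vs) newton y)"
  by (rule linear_iter_deriv[OF smooth_on_newton]) simp

lemma prod_list_norm_nonneg: "0 \<le> prod_list (map norm vs)"
  by (induction vs) auto

text \<open>Lagrange's form of the remainder, evaluated at a point of norm at least
  \<open>norm y / 2\<close>. The base 12 is \<open>3 * 2 * 2\<close>: the 3 of the derivative bound,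
  a 2 from \<open>fact (k + l) \<le> 2 ^ (k + l) * fact k * fact l\<close>, and a 2 from the halved
  distance. So the bound decays at least like \<open>(1/2) ^ k\<close> once
  \<open>24 * \<bar>s\<bar> \<le> norm y\<close>.\<close>

lemma taylor_rem_bound:
  assumes e: "norm e = 1" and y: "y \<noteq> 0" and s: "\<bar>s\<bar> \<le> norm y / 2"
  shows "\<bar>taylor_rem e k vs y s\<bar> \<le> (2 * 12 ^ length vs * fact (length vs) * prod_list (map norm vs)) *
    (12 * \<bar>s\<bar> / norm y) ^ k / norm y ^ Suc (length vs)"
proof -
  define P where "P = prod_list (map norm vs)"
  define l where "l = length vs"
  have P: "P \<ge> 0" by (simp add: P_def prod_list_norm_nonneg)
  have ny: "norm y > 0" using y by simp
  have far: "norm y / 2 \<le> norm (y + t *\<^sub>R e)" if "\<bar>t\<bar> \<le> \<bar>s\<bar>" for t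
    using norm_triangle_ineq4[of "y + t *\<^sub>R e" "t *\<^sub>R e"] that s e by simp
  then have ne: "y + t *\<^sub>R e \<noteq> 0" if "\<bar>t\<bar> \<le> \<bar>s\<bar>" for t
    using ny that by (metis half_gt_zero linorder_not_le norm_zero)
  have "\<exists>t. \<bar>t\<bar> \<le> \<bar>s\<bar> \<and> iter_deriv vs newton (y + s *\<^sub>R e) =
     (\<Sum>i<k. iter_deriv (replicate i e @ vs) newton (y + 0 *\<^sub>R e) / fact i * s ^ i) +
       iter_deriv (replicate k e @ vs) newton (y + t *\<^sub>R e) / fact k * s ^ k"
  proof (rule Maclaurin_bi_le[where diff = "\<lambda>i t. iter_deriv (replicate i e @ vs) newton (y + t *\<^sub>R e)"])
    show "(\<lambda>t. iter_deriv (replicate 0 e @ vs) newton (y + t *\<^sub>R e)) = (\<lambda>s. iter_deriv vs newton (y + s *\<^sub>R e))"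
      by simp
    show "\<forall>m t. m < k \<and> \<bar>t\<bar> \<le> \<bar>s\<bar> \<longrightarrow>
      ((\<lambda>t. iter_deriv (replicate m e @ vs) newton (y + t *\<^sub>R e)) has_real_derivative
        iter_deriv (replicate (Suc m) e @ vs) newton (y + t *\<^sub>R e)) (at t)"
    proof (intro allI impI)
      fix m t assume "m < k \<and> \<bar>t\<bar> \<le> \<bar>s\<bar>"
      then have n: "y + t *\<^sub>R e \<noteq> 0" using ne by blast
      have "((\<lambda>t. y + t *\<^sub>R e) has_derivative (\<lambda>h. h *\<^sub>R e)) (at t)"
        by (auto intro!: derivative_eq_intros)
      from has_derivative_compose[OF this iter_deriv_newton_has_derivative[OF n, of "replicate m e @ vs"]]
      show "((\<lambda>t. iter_deriv (replicate m e @ vs) newton (y + t *\<^sub>R e)) has_real_derivative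
        iter_deriv (replicate (Suc m) e @ vs) newton (y + t *\<^sub>R e)) (at t)"
        unfolding has_field_derivative_def
        using linear_scale[OF linear_iter_deriv_newton[OF n, of "replicate m e @ vs"]]
        by (elim has_derivative_eq_rhs) (auto simp: mult.commute)
    qed
  qed
  then obtain t where t: "\<bar>t\<bar> \<le> \<bar>s\<bar>" and
    eq: "taylor_rem e k vs y s = iter_deriv (replicate k e @ vs) newton (y + t *\<^sub>R e) / fact k * s ^ k"
    unfolding taylor_rem_def by (auto simp: algebra_simps)
  have pr: "prod_list (map norm (replicate k e @ vs)) = P"
    by (simp add: P_def e map_replicate_const prod_list_replicate)
  have "\<bar>iter_deriv (replicate k e @ vs) newton (y + t *\<^sub>R e)\<bar> \<le>
     3 ^ (k + l) * fact (k + l) * P / norm (y + t *\<^sub>R e) ^ Suc (k + l)"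
    using iter_deriv_newton_bound[OF ne[OF t], of "replicate k e @ vs"] unfolding pr by (simp add: l_def)
  also have "\<dots> \<le> 3 ^ (k + l) * fact (k + l) * P / (norm y / 2) ^ Suc (k + l)"
    using far[OF t] ny P by (intro divide_left_mono power_mono mult_nonneg_nonneg mult_pos_pos zero_less_power) auto
  also have "\<dots> \<le> 3 ^ (k + l) * (2 ^ (k + l) * fact k * fact l) * P / (norm y / 2) ^ Suc (k + l)"
  proof -
    have "(fact (k + l) :: real) = real (k + l choose k) * fact k * fact l"
      by (simp add: binomial_fact)
    also have "\<dots> \<le> 2 ^ (k + l) * fact k * fact l"
    proof (intro mult_right_mono)
      show "real (k + l choose k) \<le> 2 ^ (k + l)"
        using binomial_le_pow2[of "k + l" k] by (metis of_nat_le_iff of_nat_numeral of_nat_power)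
    qed auto
    finally have "(fact (k + l) :: real) \<le> 2 ^ (k + l) * fact k * fact l" .
    with P ny show ?thesis by (intro divide_right_mono mult_right_mono mult_left_mono) auto
  qed
  also have "\<dots> = fact k * (2 * 12 ^ l * fact l * P * 12 ^ k / norm y ^ k / norm y ^ Suc l)"
  proof -
    have "(3::real) ^ (k + l) * 2 ^ (k + l) * 2 ^ Suc (k + l) = 2 * 12 ^ k * 12 ^ l"
    proof -
      have "(12::real) ^ i = 3 ^ i * 2 ^ i * 2 ^ i" for i by (simp flip: power_mult_distrib)
      then show ?thesis by (simp add: power_add)
    qed
    then show ?thesis using ny by (simp add: power_divide power_add divide_simps)
  qed
  finally have b: "\<bar>iter_deriv (replicate k e @ vs) newton (y + t *\<^sub>R e)\<bar> / fact k \<le>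
     2 * 12 ^ l * fact l * P * 12 ^ k / norm y ^ k / norm y ^ Suc l"
    by (simp add: pos_divide_le_eq mult.commute)
  have "\<bar>taylor_rem e k vs y s\<bar> = \<bar>iter_deriv (replicate k e @ vs) newton (y + t *\<^sub>R e)\<bar> / fact k * \<bar>s\<bar> ^ k"
    by (simp add: eq abs_mult power_abs)
  also have "\<dots> \<le> 2 * 12 ^ l * fact l * P * 12 ^ k / norm y ^ k / norm y ^ Suc l * \<bar>s\<bar> ^ k"
    by (rule mult_right_mono[OF b]) simp
  also have "\<dots> = 2 * 12 ^ l * fact l * P * (12 * \<bar>s\<bar> / norm y) ^ k / norm y ^ Suc l"
    by (simp add: power_mult_distrib power_divide)
  finally show ?thesis by (simp add: l_def P_def)
qed

text \<open>Base point and shift both vary. A change of the base point puts its direction into the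
  list; a change of the shift turns \<open>s ^ i / fact i\<close> into
  \<open>s ^ (i - 1) / fact (i - 1)\<close>, which leaves a remainder with one term fewer and
  \<open>e\<close> added to the list. Remainders are thus closed under differentiation.\<close>

lemma taylor_rem_has_derivative:
  fixes Y :: "'a::real_normed_vector \<Rightarrow> real^3" and S :: "'a \<Rightarrow> real"
  assumes Y: "(Y has_derivative Y') (at z)" and S: "(S has_derivative S') (at z)"
    and ne: "Y z \<noteq> 0" "Y z + S z *\<^sub>R e \<noteq> 0"
  shows "((\<lambda>z. taylor_rem e k vs (Y z) (S z)) has_derivative
    (\<lambda>h. taylor_rem e k (Y' h # vs) (Y z) (S z) + S' h * taylor_rem e (k - 1) (e # vs) (Y z) (S z))) (at z)"
proof -
  let ?J = "\<lambda>vs. iter_deriv vs newton"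
  have "((\<lambda>z. Y z + S z *\<^sub>R e) has_derivative (\<lambda>h. Y' h + S' h *\<^sub>R e)) (at z)"
    by (intro derivative_intros Y S)
  from has_derivative_compose[OF this iter_deriv_newton_has_derivative[OF ne(2), of vs]]
  have 1: "((\<lambda>z. ?J vs (Y z + S z *\<^sub>R e)) has_derivative
    (\<lambda>h. ?J (Y' h # vs) (Y z + S z *\<^sub>R e) + S' h * ?J (e # vs) (Y z + S z *\<^sub>R e))) (at z)"
    using linear_add[OF linear_iter_deriv_newton[OF ne(2), of vs]] linear_scale[OF linear_iter_deriv_newton[OF ne(2), of vs]]
    by (elim has_derivative_eq_rhs) auto
  have 2: "((\<lambda>z. S z ^ i / fact i * ?J (replicate i e @ vs) (Y z)) has_derivative
      (\<lambda>h. S z ^ i / fact i * ?J (replicate i e @ Y' h # vs) (Y z) +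
        S' h * (real i * S z ^ (i - 1) / fact i * ?J (replicate i e @ vs) (Y z)))) (at z)" for i
  proof -
    have p: "((\<lambda>z. S z ^ i / fact i) has_derivative (\<lambda>h. real i * S' h * S z ^ (i - 1) / fact i)) (at z)"
      by (auto intro!: derivative_eq_intros S simp: field_simps)
    have move: "?J (Y' h # replicate i e @ vs) (Y z) = ?J (replicate i e @ Y' h # vs) (Y z)" for h
      using iter_deriv_move[OF smooth_on_newton open_Compl[OF closed_singleton], of "Y z" "replicate i e" "Y' h" vs] ne by simp
    from has_derivative_mult[OF p has_derivative_compose[OF Y iter_deriv_newton_has_derivative[OF ne(1), of "replicate i e @ vs"]]]
    show ?thesis unfolding move by (rule has_derivative_eq_rhs) (simp add: fun_eq_iff algebra_simps)
  qed
  \<comment> \<open>The term \<open>i = 0\<close> vanishes; the others are re-indexed, the spare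
    \<open>e\<close> going into the list.\<close>
  have shift: "(\<Sum>i<k. real i * S z ^ (i - 1) / fact i * ?J (replicate i e @ vs) (Y z)) =
     (\<Sum>i<k - 1. S z ^ i / fact i * ?J (replicate i e @ e # vs) (Y z))"
  proof (cases k)
    case (Suc m)
    have "(\<Sum>i<Suc m. real i * S z ^ (i - 1) / fact i * ?J (replicate i e @ vs) (Y z)) =
      (\<Sum>i<m. real (Suc i) * S z ^ i / fact (Suc i) * ?J (replicate (Suc i) e @ vs) (Y z))"
      by (subst sum.lessThan_Suc_shift) simp
    also have "\<dots> = (\<Sum>i<m. S z ^ i / fact i * ?J (replicate i e @ e # vs) (Y z))"
      by (intro sum.cong refl) (simp add: replicate_app_Cons_same fact_Suc del: of_nat_Suc)
    finally show ?thesis using Suc by simp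
  qed simp
  show ?thesis
    unfolding taylor_rem_def
    by (rule has_derivative_eq_rhs[OF has_derivative_diff[OF 1 has_derivative_sum[OF 2]]])
      (simp only: fun_eq_iff sum.distrib shift right_diff_distrib sum_distrib_left[symmetric], simp)
qed

section \<open>Moving the pole of a multipole expansion\<close>

abbreviation off_graph :: "(real \<Rightarrow> real^3) \<Rightarrow> spacetime set" where
  "off_graph g \<equiv> {z. fst z \<noteq> g (snd z)}"

lemma open_off_graph:
  assumes "polynomial_function g"
  shows "open (off_graph g)"
proof (rule open_Collect_neq)
  show "continuous_on UNIV (\<lambda>z::spacetime. g (snd z))"
    by (rule continuous_on_compose2[OF continuous_on_polymonial_function[OF assms, of UNIV]])
      (auto intro: continuous_on_snd)
qed (auto intro: continuous_on_fst)

lemma real_polynomial_bounded_on_Icc: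
  fixes c :: "real \<Rightarrow> real"
  assumes "real_polynomial_function c"
  shows "\<exists>M>0. \<forall>t\<in>{0..T}. \<bar>c t\<bar> \<le> M"
proof -
  have "bounded (c ` {0..T})"
    by (intro compact_imp_bounded compact_continuous_image compact_Icc
        continuous_on_polymonial_function) (use assms in \<open>simp add: real_polynomial_function_eq\<close>)
  then show ?thesis by (auto simp: bounded_pos)
qed

text \<open>Polynomial coefficients, together with a polynomial \<open>g\<close>, make the class
  closed under derivatives in \<open>t\<close> as well. The condition \<open>vs \<noteq> []\<close>
  excludes monopoles and is preserved by differentiation.\<close>

inductive multipole :: "(real \<Rightarrow> real^3) \<Rightarrow> (spacetime \<Rightarrow> real) \<Rightarrow> bool" for g where
  mp_term: "real_polynomial_function c \<Longrightarrow> vs \<noteq> [] \<Longrightarrow>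
    multipole g (\<lambda>z. c (snd z) * iter_deriv vs newton (fst z - g (snd z)))"
| mp_add: "multipole g f \<Longrightarrow> multipole g f' \<Longrightarrow> multipole g (\<lambda>z. f z + f' z)"

lemma multipole_zero: "multipole g (\<lambda>z. 0)"
  using mp_term[of "\<lambda>t. 0" "[0]" g] by (simp add: real_polynomial_function_eq)

lemma multipole_sum: "(\<And>i. i \<in> I \<Longrightarrow> multipole g (f i)) \<Longrightarrow> multipole g (\<lambda>z. \<Sum>i\<in>I. f i z)"
  by (induction I rule: infinite_finite_induct) (auto intro: multipole_zero mp_add)

lemma multipole_term_has_derivative:
  assumes c': "\<And>t. (c has_real_derivative c' t) (at t)" and g': "\<And>t. (g has_vector_derivative g' t) (at t)"
    and z: "fst z \<noteq> g (snd z)"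
  shows "((\<lambda>z. c (snd z) * iter_deriv vs newton (fst z - g (snd z))) has_derivative
    (\<lambda>h. snd h * c' (snd z) * iter_deriv vs newton (fst z - g (snd z)) +
      c (snd z) * iter_deriv ((fst h - snd h *\<^sub>R g' (snd z)) # vs) newton (fst z - g (snd z)))) (at z)"
proof -
  have s: "(snd has_derivative snd) (at z)" "(fst has_derivative fst) (at z)"
    by (auto intro: bounded_linear_imp_has_derivative bounded_linear_snd bounded_linear_fst)
  have c: "((\<lambda>z. c (snd z)) has_derivative (\<lambda>h. snd h * c' (snd z))) (at z)"
    using has_derivative_compose[OF s(1) c'[of "snd z", unfolded has_field_derivative_def]]
    by (rule has_derivative_eq_rhs) (simp add: fun_eq_iff mult.commute)
  have "((\<lambda>z. g (snd z)) has_derivative (\<lambda>h. snd h *\<^sub>R g' (snd z))) (at z)"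
    by (rule has_derivative_compose[OF s(1) g'[of "snd z", unfolded has_vector_derivative_def]])
  then have y: "((\<lambda>z. fst z - g (snd z)) has_derivative (\<lambda>h. fst h - snd h *\<^sub>R g' (snd z))) (at z)"
    by (intro has_derivative_diff s)
  have "fst z - g (snd z) \<noteq> 0" using z by simp
  from has_derivative_mult[OF c has_derivative_compose[OF y iter_deriv_newton_has_derivative[OF this, of vs]]]
  show ?thesis by (rule has_derivative_eq_rhs) (simp add: fun_eq_iff)
qed

lemma polynomial_derivatives:
  fixes c :: "real \<Rightarrow> real" and g :: "real \<Rightarrow> 'a::euclidean_space"
  assumes "real_polynomial_function c" "polynomial_function g"
  obtains c' g' where "real_polynomial_function c'" "\<And>t. (c has_real_derivative c' t) (at t)"
    "polynomial_function g'" "\<And>t. (g has_vector_derivative g' t) (at t)"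
  using has_real_derivative_polynomial_function[OF assms(1)] has_vector_derivative_polynomial_function[OF assms(2)]
  by metis

lemma real_polynomial_inner:
  "polynomial_function g \<Longrightarrow> b \<in> Basis \<Longrightarrow> real_polynomial_function (\<lambda>t. g t \<bullet> b)"
  by (metis polynomial_function_iff_Basis_inner)

lemma linear_sum_Basis:
  fixes L :: "'a::euclidean_space \<Rightarrow> real"
  assumes "linear L"
  shows "L v = (\<Sum>b\<in>Basis. (v \<bullet> b) * L b)"
proof -
  have "L v = L (\<Sum>b\<in>Basis. (v \<bullet> b) *\<^sub>R b)" by (simp add: euclidean_representation)
  then show ?thesis by (simp add: linear_sum[OF assms] linear_scale[OF assms])
qed

text \<open>The velocity \<open>g'\<close> of the pole appears as a direction that depends on time.
  Expanded in \<open>Basis\<close>, it becomes fixed directions with the polynomial coefficients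
  \<open>g' t \<bullet> b\<close>, so the result is again a multipole.\<close>

lemma multipole_has_derivative:
  assumes g: "polynomial_function g" and "multipole g f"
  shows "\<exists>f'. (\<forall>h. multipole g (f' h)) \<and> (\<forall>z\<in>off_graph g. (f has_derivative (\<lambda>h. f' h z)) (at z))"
  using assms(2)
proof (induction rule: multipole.induct)
  case (mp_term c vs)
  obtain c' g' where c': "real_polynomial_function c'" "\<And>t. (c has_real_derivative c' t) (at t)"
    and g': "polynomial_function g'" "\<And>t. (g has_vector_derivative g' t) (at t)"
    using polynomial_derivatives[OF mp_term(1) g] by metis
  define J where "J ws z = iter_deriv ws newton (fst z - g (snd z))" for ws z
  define f' where "f' h z = (snd h * c' (snd z)) * J vs z + (c (snd z) * J (fst h # vs) z +
     (\<Sum>b\<in>Basis. (- snd h * (c (snd z) * (g' (snd z) \<bullet> b))) * J (b # vs) z))" for h z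
  have "multipole g (f' h)" for h
    unfolding f'_def[abs_def] J_def
    by (intro mp_add multipole_sum multipole.mp_term real_polynomial_function.intros mp_term c'
        real_polynomial_inner[OF g'(1)]) auto
  moreover have "((\<lambda>z. c (snd z) * iter_deriv vs newton (fst z - g (snd z))) has_derivative (\<lambda>h. f' h z)) (at z)"
    if "z \<in> off_graph g" for z
  proof -
    have ne: "fst z - g (snd z) \<noteq> 0" using that by simp
    have "c (snd z) * J ((fst h - snd h *\<^sub>R g' (snd z)) # vs) z = c (snd z) * J (fst h # vs) z +
       (\<Sum>b\<in>Basis. (- snd h * (c (snd z) * (g' (snd z) \<bullet> b))) * J (b # vs) z)" for h :: spacetime
    proof -
      have "J ((fst h - snd h *\<^sub>R g' (snd z)) # vs) z = J (fst h # vs) z - snd h * J (g' (snd z) # vs) z"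
        using linear_diff[OF linear_iter_deriv_newton[OF ne, of vs]] linear_scale[OF linear_iter_deriv_newton[OF ne, of vs]]
        by (simp add: J_def)
      also have "J (g' (snd z) # vs) z = (\<Sum>b\<in>Basis. (g' (snd z) \<bullet> b) * J (b # vs) z)"
        unfolding J_def by (rule linear_sum_Basis[OF linear_iter_deriv_newton[OF ne]])
      finally show ?thesis
        by (simp add: right_diff_distrib sum_distrib_left sum_negf mult_ac)
    qed
    then show ?thesis
      using multipole_term_has_derivative[OF c'(2) g'(2), of z vs] that
      by (auto simp: f'_def J_def elim!: has_derivative_eq_rhs)
  qed
  ultimately show ?case by (intro exI[of _ f'] conjI allI ballI)
next
  case (mp_add f1 f2)
  obtain f1' where 1: "\<forall>h. multipole g (f1' h)" "\<forall>z\<in>off_graph g. (f1 has_derivative (\<lambda>h. f1' h z)) (at z)"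
    using mp_add.IH(1) by blast
  obtain f2' where 2: "\<forall>h. multipole g (f2' h)" "\<forall>z\<in>off_graph g. (f2 has_derivative (\<lambda>h. f2' h z)) (at z)"
    using mp_add.IH(2) by blast
  show ?case
  proof (intro exI[of _ "\<lambda>h z. f1' h z + f2' h z"] conjI allI ballI)
    show "multipole g (\<lambda>z. f1' h z + f2' h z)" for h
      by (rule multipole.mp_add[OF spec[OF 1(1)] spec[OF 2(1)]])
    show "((\<lambda>z. f1 z + f2 z) has_derivative (\<lambda>h. f1' h z + f2' h z)) (at z)" if "z \<in> off_graph g" for z
      by (rule has_derivative_add[OF bspec[OF 1(2) that] bspec[OF 2(2) that]])
  qed
qed

lemma smooth_on_multipole:
  assumes g: "polynomial_function g" and "multipole g f"
  shows "smooth_on (off_graph g) f"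
  by (rule smooth_on_family[OF open_off_graph[OF g], where F = "Collect (multipole g)"])
    (use assms multipole_has_derivative[OF g] in auto)

lemma iter_deriv_multipole:
  assumes g: "polynomial_function g" and "multipole g f"
  shows "\<exists>f'. multipole g f' \<and> (\<forall>z\<in>off_graph g. iter_deriv bs f z = f' z)"
proof (induction bs)
  case Nil
  then show ?case using assms by auto
next
  case (Cons b bs)
  then obtain f' where f': "multipole g f'" "\<And>z. z \<in> off_graph g \<Longrightarrow> iter_deriv bs f z = f' z" by blast
  obtain f'' where f'': "\<And>h. multipole g (f'' h)"
    "\<And>z. z \<in> off_graph g \<Longrightarrow> (f' has_derivative (\<lambda>h. f'' h z)) (at z)"
    using multipole_has_derivative[OF g f'(1)] by blast
  have "iter_deriv (b # bs) f z = f'' b z" if "z \<in> off_graph g" for z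
  proof -
    have "iter_deriv (b # bs) f z = frechet_derivative f' (at z) b"
      using frechet_derivative_cong_open[OF open_off_graph[OF g] that f'(2)] by simp
    also have "\<dots> = f'' b z"
      by (rule fun_cong[OF frechet_derivative_at[OF f''(2)[OF that], symmetric]])
    finally show ?thesis .
  qed
  with f'' show ?case by blast
qed

text \<open>The exponent is at least 2 since no term is a monopole; the restriction to distances at
  least 1 lets faster decay be absorbed.\<close>

lemma multipole_decay:
  assumes "multipole g f"
  shows "\<exists>C>0. \<forall>x. 1 \<le> norm (x - g t) \<longrightarrow> \<bar>f (x, t)\<bar> \<le> C / (norm (x - g t))\<^sup>2"
  using assms
proof (induction rule: multipole.induct)
  case (mp_term c vs)
  define P where "P = 3 ^ length vs * fact (length vs) * prod_list (map norm vs)"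
  have P: "P \<ge> 0" by (simp add: P_def prod_list_norm_nonneg)
  show ?case
  proof (intro exI[of _ "\<bar>c t\<bar> * P + 1"] conjI allI impI)
    fix x assume x: "1 \<le> norm (x - g t)"
    have "\<bar>iter_deriv vs newton (x - g t)\<bar> \<le> P / norm (x - g t) ^ Suc (length vs)"
      unfolding P_def by (rule iter_deriv_newton_bound) (use x in auto)
    also have "\<dots> \<le> P / norm (x - g t) ^ 2"
      using x mp_term(2) P by (intro divide_left_mono power_increasing mult_pos_pos zero_less_power)
        (cases vs; auto)+
    finally have "\<bar>c t * iter_deriv vs newton (x - g t)\<bar> \<le> \<bar>c t\<bar> * (P / norm (x - g t) ^ 2)"
      unfolding abs_mult by (rule mult_left_mono) simp
    also have "\<dots> \<le> (\<bar>c t\<bar> * P + 1) / (norm (x - g t))\<^sup>2"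
      by (simp add: add_divide_distrib)
    finally show "\<bar>c (snd (x, t)) * iter_deriv vs newton (fst (x, t) - g (snd (x, t)))\<bar> \<le> (\<bar>c t\<bar> * P + 1) / (norm (x - g t))\<^sup>2"
      by simp
  qed (use P in \<open>auto intro: add_nonneg_pos\<close>)
next
  case (mp_add f1 f2)
  then obtain C1 C2 where C: "C1 > 0" "C2 > 0"
    "\<And>x. 1 \<le> norm (x - g t) \<Longrightarrow> \<bar>f1 (x, t)\<bar> \<le> C1 / (norm (x - g t))\<^sup>2"
    "\<And>x. 1 \<le> norm (x - g t) \<Longrightarrow> \<bar>f2 (x, t)\<bar> \<le> C2 / (norm (x - g t))\<^sup>2" by blast
  have "\<bar>f1 (x, t) + f2 (x, t)\<bar> \<le> (C1 + C2) / (norm (x - g t))\<^sup>2" if "1 \<le> norm (x - g t)" for x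
    using C(3,4)[OF that] abs_triangle_ineq[of "f1 (x, t)" "f2 (x, t)"] by (simp add: add_divide_distrib)
  with C show ?case by (intro exI[of _ "C1 + C2"]) auto
qed

text \<open>The directions \<open>(b, 0)\<close> leave \<open>t\<close> fixed, and with it the
  coefficient and the pole, so the Laplacian in \<open>x\<close> acts on \<open>newton\<close>
  alone.\<close>

lemma multipole_harmonic:
  assumes g: "polynomial_function g" and "multipole g f" and z: "z \<in> off_graph g"
  shows "(\<Sum>b\<in>Basis. iter_deriv [(b, 0), (b, 0)] f z) = 0"
  using assms(2)
proof (induction rule: multipole.induct)
  case (mp_term c vs)
  obtain c' g' where c': "real_polynomial_function c'" "\<And>t. (c has_real_derivative c' t) (at t)"
    and g': "polynomial_function g'" "\<And>t. (g has_vector_derivative g' t) (at t)"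
    using polynomial_derivatives[OF mp_term(1) g] by metis
  define F where "F ws z = c (snd z) * iter_deriv ws newton (fst z - g (snd z))" for ws z
  have d: "iter_deriv [(b, 0)] (F ws) z = F (b # ws) z" if "z \<in> off_graph g" for b ws z
  proof -
    have "(F ws has_derivative (\<lambda>h. snd h * c' (snd z) * iter_deriv ws newton (fst z - g (snd z)) +
      c (snd z) * iter_deriv ((fst h - snd h *\<^sub>R g' (snd z)) # ws) newton (fst z - g (snd z)))) (at z)"
      unfolding F_def[abs_def] by (rule multipole_term_has_derivative[OF c'(2) g'(2)]) (use that in simp)
    from fun_cong[OF frechet_derivative_at[OF this], of "(b, 0)"]
    show ?thesis by (simp add: F_def)
  qed
  have "iter_deriv [(b, 0), (b, 0)] (F vs) z = F (b # b # vs) z" for b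
  proof -
    have "iter_deriv [(b, 0), (b, 0)] (F vs) z = iter_deriv [(b, 0)] (iter_deriv [(b, 0)] (F vs)) z" by simp
    also have "\<dots> = iter_deriv [(b, 0)] (F (b # vs)) z"
      by (rule iter_deriv_cong_open[OF open_off_graph[OF g] _ z]) (rule d)
    finally show ?thesis using d[OF z] by simp
  qed
  then have "(\<Sum>b\<in>Basis. iter_deriv [(b, 0), (b, 0)] (F vs) z) = (\<Sum>b\<in>Basis. F (b # b # vs) z)"
    by simp
  also have "\<dots> = 0"
    using iter_deriv_newton_harmonic[of "fst z - g (snd z)" vs] z by (simp add: F_def flip: sum_distrib_left)
  finally show ?case by (simp only: F_def[abs_def])
next
  case (mp_add f1 f2)
  note a = iter_deriv_add[OF smooth_on_multipole[OF g mp_add.hyps(1)] smooth_on_multipole[OF g mp_add.hyps(2)] open_off_graph[OF g] z]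
  show ?case using mp_add.IH by (simp only: a sum.distrib)
qed

text \<open>Sequences (in \<open>k\<close>) of remainders of Taylor's formula in the direction \<open>e\<close>, with \<open>q\<close> the displacement of
  the pole. Differentiating in \<open>t\<close> shortens the Taylor polynomial by one term, hence \<open>k - j\<close>; the
  truncated subtraction is right also for \<open>k < j\<close>, where the Taylor polynomial is empty.\<close>

inductive taylor_err :: "(real \<Rightarrow> real^3) \<Rightarrow> real^3 \<Rightarrow> (real \<Rightarrow> real) \<Rightarrow> (nat \<Rightarrow> spacetime \<Rightarrow> real) \<Rightarrow> bool"
  for g e q where
  te_term: "real_polynomial_function c \<Longrightarrow> vs \<noteq> [] \<Longrightarrow>
    taylor_err g e q (\<lambda>k z. c (snd z) * taylor_rem e (k - j) vs (fst z - g (snd z)) (q (snd z)))"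
| te_add: "taylor_err g e q E \<Longrightarrow> taylor_err g e q E' \<Longrightarrow> taylor_err g e q (\<lambda>k z. E k z + E' k z)"

lemma taylor_err_zero: "taylor_err g e q (\<lambda>k z. 0)"
  using te_term[of "\<lambda>t. 0" "[0]" g e q] by (simp add: real_polynomial_function_eq)

lemma taylor_err_sum: "(\<And>i. i \<in> I \<Longrightarrow> taylor_err g e q (E i)) \<Longrightarrow> taylor_err g e q (\<lambda>k z. \<Sum>i\<in>I. E i k z)"
  by (induction I rule: infinite_finite_induct) (auto intro: taylor_err_zero te_add)

text \<open>Needed to expand the time-dependent velocity of the pole in the fixed basis. In the
  Taylor coefficients \<open>h\<close> stands behind the copies of \<open>e\<close> and is first
  moved to the front.\<close>

lemma linear_taylor_rem:
  assumes "y \<noteq> 0" "y + s *\<^sub>R e \<noteq> 0"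
  shows "linear (\<lambda>h. taylor_rem e k (h # vs) y s)"
proof -
  have mv: "iter_deriv (replicate i e @ h # vs) newton y = iter_deriv (h # replicate i e @ vs) newton y" for i h
    by (rule iter_deriv_move[OF smooth_on_newton open_Compl[OF closed_singleton]]) (use assms in simp)
  note l = linear_iter_deriv_newton[OF assms(1)] linear_iter_deriv_newton[OF assms(2)]
  show ?thesis
    unfolding taylor_rem_def mv
    by (rule linearI) (simp_all only: linear_add[OF l(1)] linear_scale[OF l(1)] linear_add[OF l(2)] linear_scale[OF l(2)]
        distrib_left sum.distrib, simp_all add: algebra_simps sum_distrib_left)
qed

lemma taylor_err_has_derivative:
  assumes g: "polynomial_function g" and q: "real_polynomial_function q" and "taylor_err g e q E"
  shows "\<exists>E'. (\<forall>h. taylor_err g e q (\<lambda>k. E' k h)) \<and>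
    (\<forall>k. \<forall>z\<in>off_graph g \<inter> off_graph (\<lambda>t. g t - q t *\<^sub>R e). (E k has_derivative (\<lambda>h. E' k h z)) (at z))"
  using assms(3)
proof (induction rule: taylor_err.induct)
  case (te_term c vs j)
  obtain c' g' where c': "real_polynomial_function c'" "\<And>t. (c has_real_derivative c' t) (at t)"
    and g': "polynomial_function g'" "\<And>t. (g has_vector_derivative g' t) (at t)"
    using polynomial_derivatives[OF te_term(1) g] by metis
  obtain q' where q': "real_polynomial_function q'" "\<And>t. (q has_real_derivative q' t) (at t)"
    using has_real_derivative_polynomial_function[OF q] by blast
  define R where "R k ws z = taylor_rem e k ws (fst z - g (snd z)) (q (snd z))" for k ws z
  \<comment> \<open>Four contributions: the coefficient, the spatial direction, the velocity of the
    pole expanded in \<open>Basis\<close>, and the change of the displacement \<open>q\<close>, for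
    which \<open>j\<close> becomes \<open>Suc j\<close> and \<open>e\<close> joins the list.\<close>
  define E' where "E' k h z = (snd h * c' (snd z)) * R (k - j) vs z +
     (c (snd z) * R (k - j) (fst h # vs) z +
     ((\<Sum>b\<in>Basis. (- snd h * (c (snd z) * (g' (snd z) \<bullet> b))) * R (k - j) (b # vs) z) +
      (snd h * (c (snd z) * q' (snd z))) * R (k - Suc j) (e # vs) z))" for k h z
  have "taylor_err g e q (\<lambda>k. E' k h)" for h
    unfolding E'_def[abs_def] R_def
    by (intro te_add taylor_err_sum taylor_err.te_term real_polynomial_function.intros te_term c' q'
        real_polynomial_inner[OF g'(1)]) auto
  moreover have "((\<lambda>z. c (snd z) * R (k - j) vs z) has_derivative (\<lambda>h. E' k h z)) (at z)"
    if z: "z \<in> off_graph g \<inter> off_graph (\<lambda>t. g t - q t *\<^sub>R e)" for k z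
  proof -
    have ne: "fst z - g (snd z) \<noteq> 0" "fst z - g (snd z) + q (snd z) *\<^sub>R e \<noteq> 0"
      using z by (auto simp: algebra_simps)
    have s: "(snd has_derivative snd) (at z)" "(fst has_derivative fst) (at z)"
      by (auto intro: bounded_linear_imp_has_derivative bounded_linear_snd bounded_linear_fst)
    have c: "((\<lambda>z. c (snd z)) has_derivative (\<lambda>h. snd h * c' (snd z))) (at z)"
      using has_derivative_compose[OF s(1) c'(2)[of "snd z", unfolded has_field_derivative_def]]
      by (rule has_derivative_eq_rhs) (simp add: fun_eq_iff mult.commute)
    have qd: "((\<lambda>z. q (snd z)) has_derivative (\<lambda>h. snd h * q' (snd z))) (at z)"
      using has_derivative_compose[OF s(1) q'(2)[of "snd z", unfolded has_field_derivative_def]]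
      by (rule has_derivative_eq_rhs) (simp add: fun_eq_iff mult.commute)
    have "((\<lambda>z. g (snd z)) has_derivative (\<lambda>h. snd h *\<^sub>R g' (snd z))) (at z)"
      by (rule has_derivative_compose[OF s(1) g'(2)[of "snd z", unfolded has_vector_derivative_def]])
    then have y: "((\<lambda>z. fst z - g (snd z)) has_derivative (\<lambda>h. fst h - snd h *\<^sub>R g' (snd z))) (at z)"
      by (intro has_derivative_diff s)
    note l = linear_taylor_rem[OF ne, of "k - j" vs]
    have exp: "R (k - j) ((fst h - snd h *\<^sub>R g' (snd z)) # vs) z = R (k - j) (fst h # vs) z -
       snd h * (\<Sum>b\<in>Basis. (g' (snd z) \<bullet> b) * R (k - j) (b # vs) z)" for h :: spacetime
      unfolding R_def using linear_diff[OF l] linear_scale[OF l] linear_sum_Basis[OF l, of "g' (snd z)"] by simp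
    have "((\<lambda>z. c (snd z) * R (k - j) vs z) has_derivative (\<lambda>h. c (snd z) *
        (R (k - j) ((fst h - snd h *\<^sub>R g' (snd z)) # vs) z + (snd h * q' (snd z)) * R (k - j - 1) (e # vs) z) +
        (snd h * c' (snd z)) * R (k - j) vs z)) (at z)"
      unfolding R_def by (rule has_derivative_mult[OF c taylor_rem_has_derivative[OF y qd ne]])
    then show ?thesis
      by (rule has_derivative_eq_rhs)
        (simp add: fun_eq_iff exp E'_def distrib_left right_diff_distrib sum_distrib_left sum_negf mult_ac)
  qed
  ultimately show ?case
    unfolding R_def by (intro exI[of _ E'] conjI allI ballI)
next
  case (te_add E1 E2)
  let ?W = "off_graph g \<inter> off_graph (\<lambda>t. g t - q t *\<^sub>R e)"
  obtain E1' where 1: "\<forall>h. taylor_err g e q (\<lambda>k. E1' k h)"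
    "\<forall>k. \<forall>z\<in>?W. (E1 k has_derivative (\<lambda>h. E1' k h z)) (at z)"
    using te_add.IH(1) by blast
  obtain E2' where 2: "\<forall>h. taylor_err g e q (\<lambda>k. E2' k h)"
    "\<forall>k. \<forall>z\<in>?W. (E2 k has_derivative (\<lambda>h. E2' k h z)) (at z)"
    using te_add.IH(2) by blast
  show ?case
  proof (intro exI[of _ "\<lambda>k h z. E1' k h z + E2' k h z"] conjI allI ballI)
    show "taylor_err g e q (\<lambda>k z. E1' k h z + E2' k h z)" for h
      by (rule taylor_err.te_add[OF spec[OF 1(1)] spec[OF 2(1)]])
    show "((\<lambda>z. E1 k z + E2 k z) has_derivative (\<lambda>h. E1' k h z + E2' k h z)) (at z)" if "z \<in> ?W" for k z
      by (rule has_derivative_add[OF bspec[OF spec[OF 1(2)] that] bspec[OF spec[OF 2(2)] that]])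
  qed
qed

lemma polynomial_function_shift:
  "polynomial_function g \<Longrightarrow> real_polynomial_function q \<Longrightarrow> polynomial_function (\<lambda>t. g t - q t *\<^sub>R e)"
  by (intro polynomial_function_diff polynomial_function_mult) (auto simp: real_polynomial_function_eq)

text \<open>One family \<open>E'\<close> serves all \<open>k\<close>, so the Taylor polynomial can
  be lengthened after the derivatives have been taken.\<close>

lemma iter_deriv_taylor_err:
  assumes g: "polynomial_function g" and q: "real_polynomial_function q" and "taylor_err g e q E"
  shows "\<exists>E'. taylor_err g e q E' \<and>
    (\<forall>k. \<forall>z\<in>off_graph g \<inter> off_graph (\<lambda>t. g t - q t *\<^sub>R e). iter_deriv bs (E k) z = E' k z)"
proof (induction bs)
  case Nil
  then show ?case using assms by auto
next
  case (Cons b bs)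
  let ?W = "off_graph g \<inter> off_graph (\<lambda>t. g t - q t *\<^sub>R e)"
  have o: "open ?W" by (intro open_Int open_off_graph g polynomial_function_shift q)
  obtain E' where E': "taylor_err g e q E'" "\<And>k z. z \<in> ?W \<Longrightarrow> iter_deriv bs (E k) z = E' k z"
    using Cons by blast
  obtain E'' where E'': "\<And>h. taylor_err g e q (\<lambda>k. E'' k h)"
    "\<And>k z. z \<in> ?W \<Longrightarrow> (E' k has_derivative (\<lambda>h. E'' k h z)) (at z)"
    using taylor_err_has_derivative[OF g q E'(1)] by blast
  have "iter_deriv (b # bs) (E k) z = E'' k b z" if "z \<in> ?W" for k z
  proof -
    have "iter_deriv (b # bs) (E k) z = frechet_derivative (E' k) (at z) b"
      using frechet_derivative_cong_open[OF o that E'(2)[of _ k]] by simp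
    also have "\<dots> = E'' k b z"
      by (rule fun_cong[OF frechet_derivative_at[OF E''(2)[OF that, of k], symmetric]])
    finally show ?thesis .
  qed
  with E''(1)[of b] show ?case by (intro exI[of _ "\<lambda>k. E'' k b"]) auto
qed

text \<open>The condition \<open>24 * \<bar>q t\<bar> \<le> \<epsilon> \<le> norm (x - g t)\<close>
  makes the ratio in \<open>taylor_rem_bound\<close> at most 1/2. Powers of the distance beyond the
  second are traded for powers of \<open>\<epsilon>\<close>; the constant \<open>D\<close> that
  results is beaten by \<open>(1/2) ^ (k - j)\<close>.\<close>

lemma taylor_err_uniform:
  assumes "taylor_err g e q E" and e: "norm e = 1" and eps: "0 < \<epsilon>"
    and q: "\<And>t. t \<in> {0..T} \<Longrightarrow> 24 * \<bar>q t\<bar> \<le> \<epsilon>" and "0 < \<eta>"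
  shows "\<exists>K. \<forall>k\<ge>K. \<forall>t\<in>{0..T}. \<forall>x. \<epsilon> \<le> norm (x - g t) \<longrightarrow> \<bar>E k (x, t)\<bar> \<le> \<eta> / (norm (x - g t))\<^sup>2"
  using assms(1) \<open>0 < \<eta>\<close>
proof (induction arbitrary: \<eta> rule: taylor_err.induct)
  case (te_term c vs j)
  obtain M where M: "M > 0" "\<And>t. t \<in> {0..T} \<Longrightarrow> \<bar>c t\<bar> \<le> M"
    using real_polynomial_bounded_on_Icc[OF te_term(1)] by blast
  define C where "C = 2 * 12 ^ length vs * fact (length vs) * prod_list (map norm vs)"
  have C: "C \<ge> 0" by (simp add: C_def prod_list_norm_nonneg)
  define D where "D = M * C / \<epsilon> ^ (length vs - 1)"
  have D: "D \<ge> 0" using M C eps by (simp add: D_def)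
  have "(\<lambda>n. D * (1/2) ^ n) \<longlonglongrightarrow> D * 0"
    by (intro tendsto_mult tendsto_const LIMSEQ_power_zero) simp
  then have "eventually (\<lambda>n. D * (1/2) ^ n < \<eta>) sequentially"
    using te_term(3) by (simp add: order_tendstoD(2))
  then obtain K where K: "\<And>n. n \<ge> K \<Longrightarrow> D * (1/2) ^ n < \<eta>"
    by (auto simp: eventually_sequentially)
  show ?case
  proof (intro exI[of _ "K + j"] allI ballI impI)
    fix k t x assume k: "K + j \<le> k" and t: "t \<in> {0..T}" and x: "\<epsilon> \<le> norm (x - g t)"
    define y where "y = x - g t"
    have y: "\<epsilon> \<le> norm y" "y \<noteq> 0" using x eps by (auto simp: y_def)
    have qy: "24 * \<bar>q t\<bar> \<le> norm y" using q[OF t] y by simp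
    have "\<bar>taylor_rem e (k - j) vs y (q t)\<bar> \<le> C * (12 * \<bar>q t\<bar> / norm y) ^ (k - j) / norm y ^ Suc (length vs)"
      unfolding C_def by (rule taylor_rem_bound[OF e y(2)]) (use qy in simp)
    also have "\<dots> \<le> C * (1/2) ^ (k - j) / norm y ^ Suc (length vs)"
      using qy y C eps by (intro divide_right_mono mult_left_mono power_mono) (auto simp: field_simps)
    also have "norm y ^ Suc (length vs) = norm y ^ (length vs - 1) * (norm y)\<^sup>2"
      using te_term(2) by (cases vs) (auto simp: power2_eq_square)
    also have "C * (1/2) ^ (k - j) / (norm y ^ (length vs - 1) * (norm y)\<^sup>2) \<le>
        C * (1/2) ^ (k - j) / (\<epsilon> ^ (length vs - 1) * (norm y)\<^sup>2)"
      using y C eps by (intro divide_left_mono mult_right_mono power_mono mult_pos_pos zero_less_power) auto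
    finally have "\<bar>c t * taylor_rem e (k - j) vs y (q t)\<bar> \<le> M * (C * (1/2) ^ (k - j) / (\<epsilon> ^ (length vs - 1) * (norm y)\<^sup>2))"
      using M(2)[OF t] by (subst abs_mult, intro mult_mono) auto
    also have "\<dots> = D * (1/2) ^ (k - j) / (norm y)\<^sup>2" by (simp add: D_def)
    also have "\<dots> \<le> \<eta> / (norm y)\<^sup>2"
      using K[of "k - j"] k by (intro divide_right_mono) (auto intro: less_imp_le)
    finally show "\<bar>c (snd (x, t)) * taylor_rem e (k - j) vs (fst (x, t) - g (snd (x, t))) (q (snd (x, t)))\<bar>
        \<le> \<eta> / (norm (x - g t))\<^sup>2" by (simp add: y_def)
  qed
next
  case (te_add E1 E2)
  have h: "0 < \<eta> / 2" using te_add.prems by simp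
  obtain K1 where K1: "\<And>k t x. K1 \<le> k \<Longrightarrow> t \<in> {0..T} \<Longrightarrow> \<epsilon> \<le> norm (x - g t) \<Longrightarrow> \<bar>E1 k (x, t)\<bar> \<le> \<eta> / 2 / (norm (x - g t))\<^sup>2"
    using te_add.IH(1)[OF h] by blast
  obtain K2 where K2: "\<And>k t x. K2 \<le> k \<Longrightarrow> t \<in> {0..T} \<Longrightarrow> \<epsilon> \<le> norm (x - g t) \<Longrightarrow> \<bar>E2 k (x, t)\<bar> \<le> \<eta> / 2 / (norm (x - g t))\<^sup>2"
    using te_add.IH(2)[OF h] by blast
  show ?case
  proof (intro exI[of _ "max K1 K2"] allI ballI impI)
    fix k t x assume "max K1 K2 \<le> k" "t \<in> {0..T}" "\<epsilon> \<le> norm (x - g t)"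
    then have "\<bar>E1 k (x, t)\<bar> \<le> \<eta> / 2 / (norm (x - g t))\<^sup>2" "\<bar>E2 k (x, t)\<bar> \<le> \<eta> / 2 / (norm (x - g t))\<^sup>2"
      using K1 K2 by auto
    then show "\<bar>E1 k (x, t) + E2 k (x, t)\<bar> \<le> \<eta> / (norm (x - g t))\<^sup>2" by simp
  qed
qed

text \<open>As soon as one Taylor term is subtracted, that is for \<open>k > j\<close>, the
  remainder gains a factor \<open>\<bar>q t\<bar> / norm y\<close> over dipole decay. This is what
  preserves the leading dipole at infinity. It holds at every time, with constants depending on
  \<open>t\<close> and \<open>k\<close>.\<close>

lemma taylor_err_far:
  assumes "taylor_err g e q E" and e: "norm e = 1"
  shows "\<exists>K. \<forall>k\<ge>K. \<forall>t. \<exists>C R. 0 < R \<and> (\<forall>x. R \<le> norm (x - g t) \<longrightarrow> \<bar>E k (x, t)\<bar> \<le> C / norm (x - g t) ^ 3)"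
  using assms(1)
proof (induction rule: taylor_err.induct)
  case (te_term c vs j)
  define C where "C = 2 * 12 ^ length vs * fact (length vs) * prod_list (map norm vs)"
  have C: "C \<ge> 0" by (simp add: C_def prod_list_norm_nonneg)
  show ?case
  proof (intro exI[of _ "Suc j"] allI impI)
    fix k t assume k: "Suc j \<le> k"
    have "\<bar>c t * taylor_rem e (k - j) vs (x - g t) (q t)\<bar> \<le> (\<bar>c t\<bar> * (C * (12 * \<bar>q t\<bar>))) / norm (x - g t) ^ 3"
      if x: "max 1 (24 * \<bar>q t\<bar>) \<le> norm (x - g t)" for x
    proof -
      define y where "y = x - g t"
      have y: "1 \<le> norm y" "y \<noteq> 0" and qy: "24 * \<bar>q t\<bar> \<le> norm y" using x by (auto simp: y_def)
      have "\<bar>taylor_rem e (k - j) vs y (q t)\<bar> \<le> C * (12 * \<bar>q t\<bar> / norm y) ^ (k - j) / norm y ^ Suc (length vs)"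
        unfolding C_def by (rule taylor_rem_bound[OF e y(2)]) (use qy in simp)
      also have "\<dots> \<le> C * (12 * \<bar>q t\<bar> / norm y) ^ 1 / norm y ^ Suc (length vs)"
        using qy y C k by (intro divide_right_mono mult_left_mono power_decreasing) (auto simp: field_simps)
      also have "\<dots> \<le> C * (12 * \<bar>q t\<bar> / norm y) ^ 1 / norm y ^ 2"
        using y C te_term(2) by (intro divide_left_mono power_increasing mult_pos_pos zero_less_power mult_nonneg_nonneg)
          (cases vs; auto)+
      also have "\<dots> = C * (12 * \<bar>q t\<bar>) / norm y ^ 3" by (simp add: power2_eq_square power3_eq_cube)
      finally have "\<bar>taylor_rem e (k - j) vs y (q t)\<bar> \<le> C * (12 * \<bar>q t\<bar>) / norm y ^ 3" .
      from mult_left_mono[OF this abs_ge_zero[of "c t"]] show ?thesis by (simp add: abs_mult y_def)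
    qed
    then show "\<exists>C R. 0 < R \<and> (\<forall>x. R \<le> norm (x - g t) \<longrightarrow>
        \<bar>c (snd (x, t)) * taylor_rem e (k - j) vs (fst (x, t) - g (snd (x, t))) (q (snd (x, t)))\<bar> \<le> C / norm (x - g t) ^ 3)"
      by (intro exI[of _ "\<bar>c t\<bar> * (C * (12 * \<bar>q t\<bar>))"] exI[of _ "max 1 (24 * \<bar>q t\<bar>)"]) auto
  qed
next
  case (te_add E1 E2)
  then obtain K1 K2 where
    K1: "\<And>k t. K1 \<le> k \<Longrightarrow> \<exists>C R. 0 < R \<and> (\<forall>x. R \<le> norm (x - g t) \<longrightarrow> \<bar>E1 k (x, t)\<bar> \<le> C / norm (x - g t) ^ 3)"
    and K2: "\<And>k t. K2 \<le> k \<Longrightarrow> \<exists>C R. 0 < R \<and> (\<forall>x. R \<le> norm (x - g t) \<longrightarrow> \<bar>E2 k (x, t)\<bar> \<le> C / norm (x - g t) ^ 3)"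
    by blast
  show ?case
  proof (intro exI[of _ "max K1 K2"] allI impI)
    fix k t assume "max K1 K2 \<le> k"
    then have k: "K1 \<le> k" "K2 \<le> k" by auto
    obtain C1 R1 where 1: "0 < R1" "\<And>x. R1 \<le> norm (x - g t) \<Longrightarrow> \<bar>E1 k (x, t)\<bar> \<le> C1 / norm (x - g t) ^ 3"
      using K1[OF k(1), of t] by blast
    obtain C2 R2 where 2: "0 < R2" "\<And>x. R2 \<le> norm (x - g t) \<Longrightarrow> \<bar>E2 k (x, t)\<bar> \<le> C2 / norm (x - g t) ^ 3"
      using K2[OF k(2), of t] by blast
    have "\<bar>E1 k (x, t) + E2 k (x, t)\<bar> \<le> (C1 + C2) / norm (x - g t) ^ 3" if "max R1 R2 \<le> norm (x - g t)" for x
      using 1(2)[of x] 2(2)[of x] that abs_triangle_ineq[of "E1 k (x, t)" "E2 k (x, t)"]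
      by (simp add: add_divide_distrib)
    with 1(1) show "\<exists>C R. 0 < R \<and> (\<forall>x. R \<le> norm (x - g t) \<longrightarrow> \<bar>E1 k (x, t) + E2 k (x, t)\<bar> \<le> C / norm (x - g t) ^ 3)"
      by (intro exI[of _ "C1 + C2"] exI[of _ "max R1 R2"]) auto
  qed
qed

text \<open>Since \<open>x - (g - q e) = (x - g) + q e\<close>, Taylor's formula along
  \<open>e\<close> with step \<open>q\<close> re-centres each term at \<open>g\<close>; the powers
  of \<open>q\<close> go into the polynomial coefficients. Initially \<open>j = 0\<close>.\<close>

lemma multipole_taylor:
  assumes q: "real_polynomial_function q" and "multipole (\<lambda>t. g t - q t *\<^sub>R e) f"
  shows "\<exists>F. (\<forall>k. multipole g (F k)) \<and> taylor_err g e q (\<lambda>k z. f z - F k z)"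
  using assms(2)
proof (induction rule: multipole.induct)
  case (mp_term c vs)
  let ?F = "\<lambda>k z. \<Sum>i<k. (c (snd z) * (q (snd z) ^ i * (1 / fact i))) * iter_deriv (replicate i e @ vs) newton (fst z - g (snd z))"
  have "multipole g (?F k)" for k
    by (intro multipole_sum multipole.mp_term real_polynomial_function.intros real_polynomial_function_power mp_term q)
      (use mp_term in auto)
  moreover have "c (snd z) * iter_deriv vs newton (fst z - (g (snd z) - q (snd z) *\<^sub>R e)) - ?F k z =
     c (snd z) * taylor_rem e (k - 0) vs (fst z - g (snd z)) (q (snd z))" for k z
    by (simp add: taylor_rem_def right_diff_distrib sum_distrib_left algebra_simps)
  then have "taylor_err g e q (\<lambda>k z. c (snd z) * iter_deriv vs newton (fst z - (g (snd z) - q (snd z) *\<^sub>R e)) - ?F k z)"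
    using te_term[OF mp_term, of g e q 0] by (simp only:)
  ultimately show ?case by (intro exI[of _ ?F] conjI allI)
next
  case (mp_add f1 f2)
  then obtain F1 F2 where F: "\<And>k. multipole g (F1 k)" "\<And>k. multipole g (F2 k)"
    "taylor_err g e q (\<lambda>k z. f1 z - F1 k z)" "taylor_err g e q (\<lambda>k z. f2 z - F2 k z)" by blast
  have "taylor_err g e q (\<lambda>k z. f1 z + f2 z - (F1 k z + F2 k z))"
    using te_add[OF F(3,4)] by (simp add: algebra_simps)
  then show ?case using F(1,2) by (intro exI[of _ "\<lambda>k z. F1 k z + F2 k z"]) (auto intro: multipole.mp_add)
qed

section \<open>Pushing the pole, first along one axis and then along all three\<close>

lemma pole_push_axis:
  assumes g: "polynomial_function g" and q: "real_polynomial_function q" and e: "norm e = 1"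
    and f: "multipole (\<lambda>t. g t - q t *\<^sub>R e) f"
    and eps: "0 < \<epsilon>" and qe: "\<And>t. t \<in> {0..T} \<Longrightarrow> 24 * \<bar>q t\<bar> \<le> \<epsilon>" and eta: "0 < \<eta>"
    and B: "finite B"
  shows "\<exists>f'. multipole g f' \<and>
    (\<forall>bs\<in>B. \<forall>t\<in>{0..T}. \<forall>x. \<epsilon> \<le> norm (x - g t) \<longrightarrow>
      \<bar>iter_deriv bs f (x, t) - iter_deriv bs f' (x, t)\<bar> \<le> \<eta> / (norm (x - g t))\<^sup>2) \<and>
    (\<forall>t. \<exists>C R. 0 < R \<and> (\<forall>x. R \<le> norm (x - g t) \<longrightarrow> \<bar>f (x, t) - f' (x, t)\<bar> \<le> C / norm (x - g t) ^ 3))"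
proof -
  let ?W = "off_graph g \<inter> off_graph (\<lambda>t. g t - q t *\<^sub>R e)"
  have g0: "polynomial_function (\<lambda>t. g t - q t *\<^sub>R e)" by (rule polynomial_function_shift[OF g q])
  have o: "open ?W" by (intro open_Int open_off_graph g g0)
  obtain F where F: "\<And>k. multipole g (F k)" "taylor_err g e q (\<lambda>k z. f z - F k z)"
    using multipole_taylor[OF q f] by blast
  have "\<exists>K. \<forall>k\<ge>K. \<forall>t\<in>{0..T}. \<forall>x. \<epsilon> \<le> norm (x - g t) \<longrightarrow>
      \<bar>iter_deriv bs f (x, t) - iter_deriv bs (F k) (x, t)\<bar> \<le> \<eta> / (norm (x - g t))\<^sup>2" for bs
  proof -
    obtain E' where E': "taylor_err g e q E'"
      "\<And>k z. z \<in> ?W \<Longrightarrow> iter_deriv bs (\<lambda>z. f z - F k z) z = E' k z"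
      using iter_deriv_taylor_err[OF g q F(2), of bs] by blast
    obtain K where K: "\<And>k t x. k \<ge> K \<Longrightarrow> t \<in> {0..T} \<Longrightarrow> \<epsilon> \<le> norm (x - g t) \<Longrightarrow> \<bar>E' k (x, t)\<bar> \<le> \<eta> / (norm (x - g t))\<^sup>2"
      using taylor_err_uniform[OF E'(1) e eps qe eta] by blast
    show ?thesis
    proof (intro exI[of _ K] allI ballI impI)
      fix k t x assume k: "K \<le> k" and t: "t \<in> {0..T}" and x: "\<epsilon> \<le> norm (x - g t)"
      \<comment> \<open>The old pole lies within \<open>\<epsilon> / 24\<close> of
        \<open>g t\<close>, so both expansions are smooth at \<open>(x, t)\<close>.\<close>
      have "norm (q t *\<^sub>R e) < norm (x - g t)" using qe[OF t] x e eps by simp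
      then have "x - g t + q t *\<^sub>R e \<noteq> 0"
        by (metis add_eq_0_iff norm_minus_cancel order_less_irrefl)
      then have "x \<noteq> g t - q t *\<^sub>R e" by (metis add_diff_eq diff_add_eq right_minus_eq diff_diff_eq2)
      then have W: "(x, t) \<in> ?W" using x eps by auto
      have "smooth_on ?W f" "smooth_on ?W (F k)"
        using smooth_on_multipole[OF g0 f] smooth_on_multipole[OF g F(1)] by (auto intro: smooth_on_subset)
      from iter_deriv_diff[OF this o W, of bs] E'(2)[OF W, of k] K[OF k t x]
      show "\<bar>iter_deriv bs f (x, t) - iter_deriv bs (F k) (x, t)\<bar> \<le> \<eta> / (norm (x - g t))\<^sup>2" by simp
    qed
  qed
  then obtain K where K: "\<And>bs k t x. k \<ge> K bs \<Longrightarrow> t \<in> {0..T} \<Longrightarrow> \<epsilon> \<le> norm (x - g t) \<Longrightarrow>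
      \<bar>iter_deriv bs f (x, t) - iter_deriv bs (F k) (x, t)\<bar> \<le> \<eta> / (norm (x - g t))\<^sup>2" by metis
  obtain K' where K': "\<And>k t. k \<ge> K' \<Longrightarrow> \<exists>C R. 0 < R \<and> (\<forall>x. R \<le> norm (x - g t) \<longrightarrow> \<bar>f (x, t) - F k (x, t)\<bar> \<le> C / norm (x - g t) ^ 3)"
    using taylor_err_far[OF F(2) e] by blast
  \<comment> \<open>A sum of naturals exceeds each of the finitely many thresholds, so a single
    Taylor length serves all derivatives in \<open>B\<close> and the behaviour at infinity.\<close>
  define k where "k = K' + (\<Sum>bs\<in>B. K bs)"
  have "K bs \<le> k" if "bs \<in> B" for bs
    using member_le_sum[of bs B K] that B by (simp add: k_def)
  then show ?thesis
    using K K'[of k] F(1)[of k] by (intro exI[of _ "F k"]) (auto simp: k_def)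
qed

text \<open>The coordinates are moved one at a time; \<open>G A\<close> is the centre after those in
  \<open>A\<close> have moved. Every intermediate centre is within
  \<open>3 * norm (g t - g0 t) \<le> \<epsilon> / 16\<close> of \<open>g t\<close>, so a point at
  distance \<open>\<epsilon>\<close> or more from \<open>g t\<close> keeps at least half of its
  distance. Each single push is therefore made with radius \<open>\<epsilon> / 2\<close>, which
  turns 24 into 48.\<close>

lemma pole_push:
  assumes g: "polynomial_function g" and g0: "polynomial_function g0" and f: "multipole g0 f"
    and eps: "0 < \<epsilon>" and near: "\<And>t. t \<in> {0..T} \<Longrightarrow> 48 * norm (g t - g0 t) \<le> \<epsilon>" and "0 < \<eta>"
    and B: "finite B"
  shows "\<exists>f'. multipole g f' \<and>
    (\<forall>bs\<in>B. \<forall>t\<in>{0..T}. \<forall>x. \<epsilon> \<le> norm (x - g t) \<longrightarrow>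
      \<bar>iter_deriv bs f (x, t) - iter_deriv bs f' (x, t)\<bar> \<le> \<eta> / (norm (x - g t))\<^sup>2) \<and>
    (\<forall>t. \<exists>C R. 0 < R \<and> (\<forall>x. R \<le> norm (x - g t) \<longrightarrow> \<bar>f (x, t) - f' (x, t)\<bar> \<le> C / norm (x - g t) ^ 3))"
proof -
  define G where "G A t = g0 t + (\<Sum>b\<in>A. ((g t - g0 t) \<bullet> b) *\<^sub>R b)" for A t
  have G: "G Basis t = g t" for t
    by (simp add: G_def euclidean_representation)
  have polyq: "real_polynomial_function (\<lambda>t. (g t - g0 t) \<bullet> b)" if "b \<in> Basis" for b
    by (intro real_polynomial_inner that polynomial_function_diff g g0)
  have polyG: "polynomial_function (G A)" if "A \<subseteq> Basis" for A
    unfolding G_def[abs_def] using that polyq finite_subset[OF that finite_Basis]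
    by (intro polynomial_function_add g0 polynomial_function_sum polynomial_function_mult)
      (auto simp: real_polynomial_function_eq)
  have dist: "norm (g t - G A t) \<le> 3 * norm (g t - g0 t)" if "A \<subseteq> Basis" for A t
  proof -
    have "g t - G A t = (\<Sum>b\<in>Basis - A. ((g t - g0 t) \<bullet> b) *\<^sub>R b)"
    proof -
      have "g t = g0 t + (\<Sum>b\<in>Basis. ((g t - g0 t) \<bullet> b) *\<^sub>R b)"
        by (simp add: euclidean_representation)
      also have "(\<Sum>b\<in>Basis. ((g t - g0 t) \<bullet> b) *\<^sub>R b) =
        (\<Sum>b\<in>Basis - A. ((g t - g0 t) \<bullet> b) *\<^sub>R b) + (\<Sum>b\<in>A. ((g t - g0 t) \<bullet> b) *\<^sub>R b)"
        by (rule sum.subset_diff[OF that finite_Basis])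
      finally have eq: "g t = g0 t + ((\<Sum>b\<in>Basis - A. ((g t - g0 t) \<bullet> b) *\<^sub>R b) + (\<Sum>b\<in>A. ((g t - g0 t) \<bullet> b) *\<^sub>R b))" .
      have cancel: "a = b + (c + d) \<Longrightarrow> a - (b + d) = c" for a b c d :: "real^3" by simp
      show ?thesis unfolding G_def by (rule cancel[OF eq])
    qed
    also have "norm \<dots> \<le> (\<Sum>b\<in>Basis - A. norm (g t - g0 t))"
      by (rule sum_norm_le) (use Basis_le_norm in auto)
    also have "\<dots> \<le> 3 * norm (g t - g0 t)"
      using card_mono[of "Basis :: (real^3) set" "Basis - A"] by (auto intro: mult_right_mono)
    finally show ?thesis .
  qed
  have "\<exists>f'. multipole (G A) f' \<and>
    (\<forall>bs\<in>B. \<forall>t\<in>{0..T}. \<forall>x. \<epsilon> \<le> norm (x - g t) \<longrightarrow>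
      \<bar>iter_deriv bs f (x, t) - iter_deriv bs f' (x, t)\<bar> \<le> \<eta> / (norm (x - g t))\<^sup>2) \<and>
    (\<forall>t. \<exists>C R. 0 < R \<and> (\<forall>x. R \<le> norm (x - g t) \<longrightarrow> \<bar>f (x, t) - f' (x, t)\<bar> \<le> C / norm (x - g t) ^ 3))"
    if "finite A" "A \<subseteq> Basis" "0 < \<eta>" for A \<eta>
    using that
  proof (induction A arbitrary: \<eta> rule: finite_induct)
    case empty
    have "G {} = g0" by (simp add: G_def fun_eq_iff)
    then show ?case using f empty by (intro exI[of _ f]) (auto intro!: exI[of _ 0] exI[of _ 1])
  next
    case (insert e A)
    have "0 < \<eta> / 2" using insert.prems by simp
    then obtain f1 where f1: "multipole (G A) f1"
      "\<And>bs t x. bs \<in> B \<Longrightarrow> t \<in> {0..T} \<Longrightarrow> \<epsilon> \<le> norm (x - g t) \<Longrightarrow>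
        \<bar>iter_deriv bs f (x, t) - iter_deriv bs f1 (x, t)\<bar> \<le> \<eta> / 2 / (norm (x - g t))\<^sup>2"
      "\<And>t. \<exists>C R. 0 < R \<and> (\<forall>x. R \<le> norm (x - g t) \<longrightarrow> \<bar>f (x, t) - f1 (x, t)\<bar> \<le> C / norm (x - g t) ^ 3)"
      using insert.IH[of "\<eta> / 2"] insert.prems by blast
    let ?G = "G (insert e A)" and ?q = "\<lambda>t. (g t - g0 t) \<bullet> e"
    have e: "e \<in> Basis" "insert e A \<subseteq> Basis" using insert.prems by auto
    have GA: "(\<lambda>t. ?G t - ?q t *\<^sub>R e) = G A"
      using insert.hyps by (simp add: G_def fun_eq_iff)
    have q: "24 * \<bar>?q t\<bar> \<le> \<epsilon> / 2" if "t \<in> {0..T}" for t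
      using near[OF that] Basis_le_norm[OF e(1), of "g t - g0 t"] by simp
    \<comment> \<open>Replacing \<open>norm (x - ?G t)\<close> by \<open>norm (x - g t) / 2\<close>
      in the squared denominator costs a factor 4, so \<open>\<eta> / 8\<close> becomes
      \<open>\<eta> / 2\<close>; the other half of \<open>\<eta>\<close> is spent on the earlier
      pushes.\<close>
    obtain f2 where f2: "multipole ?G f2"
      "\<And>bs t x. bs \<in> B \<Longrightarrow> t \<in> {0..T} \<Longrightarrow> \<epsilon> / 2 \<le> norm (x - ?G t) \<Longrightarrow>
        \<bar>iter_deriv bs f1 (x, t) - iter_deriv bs f2 (x, t)\<bar> \<le> \<eta> / 8 / (norm (x - ?G t))\<^sup>2"
      "\<And>t. \<exists>C R. 0 < R \<and> (\<forall>x. R \<le> norm (x - ?G t) \<longrightarrow> \<bar>f1 (x, t) - f2 (x, t)\<bar> \<le> C / norm (x - ?G t) ^ 3)"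
      using pole_push_axis[of ?G ?q e f1 "\<epsilon> / 2" T "\<eta> / 8" B] polyG[OF e(2)] polyq[OF e(1)] q eps insert.prems B f1(1)
        norm_Basis[OF e(1)] unfolding GA by auto
    have half: "norm (x - g t) / 2 \<le> norm (x - ?G t)" if "6 * norm (g t - g0 t) \<le> norm (x - g t)" for x t
      using norm_triangle_ineq[of "x - ?G t" "?G t - g t"] dist[OF e(2), of t] that by (simp add: norm_minus_commute)
    have "\<bar>iter_deriv bs f (x, t) - iter_deriv bs f2 (x, t)\<bar> \<le> \<eta> / (norm (x - g t))\<^sup>2"
      if bs: "bs \<in> B" and t: "t \<in> {0..T}" and x: "\<epsilon> \<le> norm (x - g t)" for bs t x
    proof -
      have h: "norm (x - g t) / 2 \<le> norm (x - ?G t)" 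
        using half[of t x] near[OF t] x norm_ge_zero[of "g t - g0 t"] by linarith
      have "\<bar>iter_deriv bs f1 (x, t) - iter_deriv bs f2 (x, t)\<bar> \<le> \<eta> / 8 / (norm (x - ?G t))\<^sup>2"
        using f2(2)[OF bs t] h x by simp
      also have "\<dots> \<le> \<eta> / 8 / (norm (x - g t) / 2)\<^sup>2"
        using h x eps insert.prems by (intro divide_left_mono power_mono mult_pos_pos) auto
      finally show ?thesis using f1(2)[OF bs t x] by (simp add: power_divide)
    qed
    moreover have "\<exists>C R. 0 < R \<and> (\<forall>x. R \<le> norm (x - g t) \<longrightarrow> \<bar>f (x, t) - f2 (x, t)\<bar> \<le> C / norm (x - g t) ^ 3)" for t
    proof -
      obtain C1 R1 where 1: "0 < R1" "\<And>x. R1 \<le> norm (x - g t) \<Longrightarrow> \<bar>f (x, t) - f1 (x, t)\<bar> \<le> C1 / norm (x - g t) ^ 3"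
        using f1(3)[of t] by blast
      obtain C2 R2 where 2: "0 < R2" "\<And>x. R2 \<le> norm (x - ?G t) \<Longrightarrow> \<bar>f1 (x, t) - f2 (x, t)\<bar> \<le> C2 / norm (x - ?G t) ^ 3"
        using f2(3)[of t] by blast
      have "\<bar>f (x, t) - f2 (x, t)\<bar> \<le> (C1 + 8 * \<bar>C2\<bar>) / norm (x - g t) ^ 3"
        if x: "R1 + 2 * R2 + 6 * norm (g t - g0 t) \<le> norm (x - g t)" for x
      proof -
        have h: "norm (x - g t) / 2 \<le> norm (x - ?G t)" using half x 1(1) 2(1) by simp
        have p: "norm (x - g t) > 0" using x 1(1) 2(1) by (smt (verit) norm_ge_zero)
        have "\<bar>f1 (x, t) - f2 (x, t)\<bar> \<le> C2 / norm (x - ?G t) ^ 3"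
          using h x 1(1) norm_ge_zero[of "g t - g0 t"] by (intro 2(2)) linarith
        also have "\<dots> \<le> \<bar>C2\<bar> / norm (x - ?G t) ^ 3" by (intro divide_right_mono) auto
        also have "\<dots> \<le> \<bar>C2\<bar> / (norm (x - g t) / 2) ^ 3"
          using h p by (intro divide_left_mono power_mono mult_pos_pos zero_less_power) auto
        finally have "\<bar>f1 (x, t) - f2 (x, t)\<bar> \<le> 8 * \<bar>C2\<bar> / norm (x - g t) ^ 3"
          by (simp add: power_divide mult.commute)
        moreover have "\<bar>f (x, t) - f1 (x, t)\<bar> \<le> C1 / norm (x - g t) ^ 3"
          using x 2(1) norm_ge_zero[of "g t - g0 t"] by (intro 1(2)) linarith
        ultimately show ?thesis by (simp add: add_divide_distrib)
      qed
      then show ?thesis using 1(1) 2(1)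
        by (intro exI[of _ "C1 + 8 * \<bar>C2\<bar>"] exI[of _ "R1 + 2 * R2 + 6 * norm (g t - g0 t)"]) (auto intro: add_pos_nonneg)
    qed
    ultimately show ?case using f2(1) by (intro exI[of _ f2]) auto
  qed
  from this[OF finite_Basis order_refl \<open>0 < \<eta>\<close>] show ?thesis
    unfolding ext[of "G Basis" g, OF G] .
qed

section \<open>Smooth limits\<close>

lemma geometric_Cauchy_limit:
  fixes a :: "nat \<Rightarrow> real"
  assumes "\<And>n. K \<le> n \<Longrightarrow> \<bar>a (Suc n) - a n\<bar> \<le> M * (1/2) ^ n"
  shows "convergent a" and "K \<le> n \<Longrightarrow> \<bar>lim a - a n\<bar> \<le> 2 * M * (1/2) ^ n"
proof -
  have M: "M \<ge> 0"
    using assms[OF order_refl] by (smt (verit) mult_neg_pos zero_less_power half_gt_zero zero_less_one)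
  have diff: "\<bar>a (n + d) - a n\<bar> \<le> 2 * M * (1/2) ^ n" if "K \<le> n" for n d
  proof -
    \<comment> \<open>Keeping the exact partial geometric sum lets the induction close.\<close>
    have "\<bar>a (n + d) - a n\<bar> \<le> 2 * M * ((1/2) ^ n - (1/2) ^ (n + d))"
    proof (induction d)
      case (Suc d)
      have "\<bar>a (Suc (n + d)) - a (n + d)\<bar> \<le> M * (1/2) ^ (n + d)" using that by (intro assms) simp
      with Suc show ?case by (simp add: algebra_simps)
    qed simp
    also have "\<dots> \<le> 2 * M * (1/2) ^ n" using M by (intro mult_left_mono) auto
    finally show ?thesis .
  qed
  have "(\<lambda>n. 2 * M * (1/2) ^ n) \<longlonglongrightarrow> 2 * M * 0"
    by (intro tendsto_mult tendsto_const LIMSEQ_power_zero) simp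
  then have small: "eventually (\<lambda>n. 2 * M * (1/2) ^ n < e) sequentially" if "e > 0" for e
    using that by (simp add: order_tendstoD(2))
  have "Cauchy a"
  proof (rule CauchyI')
    fix e :: real assume "0 < e"
    then obtain N where N: "\<And>n. n \<ge> N \<Longrightarrow> 2 * M * (1/2) ^ n < e"
      using small by (auto simp: eventually_sequentially)
    have "dist (a m) (a n) < e" if "max K N \<le> m" "m < n" for m n
      using diff[of m "n - m"] N[of m] that by (simp add: dist_real_def abs_minus_commute)
    then show "\<exists>M. \<forall>m\<ge>M. \<forall>n>m. dist (a m) (a n) < e" by blast
  qed
  then show c: "convergent a" by (simp add: Cauchy_convergent_iff)
  show "\<bar>lim a - a n\<bar> \<le> 2 * M * (1/2) ^ n" if n: "K \<le> n"
  proof (rule LIMSEQ_le_const2)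
    show "(\<lambda>d. \<bar>a (d + n) - a n\<bar>) \<longlonglongrightarrow> \<bar>lim a - a n\<bar>"
      using LIMSEQ_ignore_initial_segment[OF c[unfolded convergent_LIMSEQ_iff], of n] by (intro tendsto_intros)
    show "\<exists>N. \<forall>d\<ge>N. \<bar>a (d + n) - a n\<bar> \<le> 2 * M * (1/2) ^ n"
      using diff[OF n] by (simp add: add.commute)
  qed
qed

lemma Ck_on_sum:
  "open S \<Longrightarrow> (\<And>i. i \<in> I \<Longrightarrow> Ck_on k S (f i)) \<Longrightarrow> Ck_on k S (\<lambda>z. \<Sum>i\<in>I. f i z)"
proof (induction I rule: infinite_finite_induct)
  case (insert i I)
  then show ?case by (simp add: Ck_on_add)
qed (use smooth_on_const in \<open>auto simp: smooth_on_def\<close>)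

text \<open>The theorem on differentiating sequences, applied to every iterated derivative on a
  convex neighbourhood. The thresholds \<open>N\<close> and \<open>K\<close> and the constant
  \<open>M\<close> may depend on the point, and the last two also on \<open>bs\<close>, since early
  members need not be smooth there and step \<open>n\<close> controls only orders up to
  \<open>n\<close>. Only basis directions are controlled, so derivatives are expanded in
  \<open>Basis\<close>.\<close>

lemma smooth_limit:
  fixes f :: "nat \<Rightarrow> 'a::euclidean_space \<Rightarrow> real"
  assumes S: "open S"
    and loc: "\<And>z. z \<in> S \<Longrightarrow> \<exists>U N. open U \<and> convex U \<and> z \<in> U \<and> U \<subseteq> S \<and> (\<forall>n\<ge>N. smooth_on U (f n)) \<and>
      (\<forall>bs. set bs \<subseteq> Basis \<longrightarrow> (\<exists>M K. \<forall>n\<ge>K. \<forall>w\<in>U.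
        \<bar>iter_deriv bs (f (Suc n)) w - iter_deriv bs (f n) w\<bar> \<le> M * (1/2) ^ n))"
  shows "smooth_on S (\<lambda>z. lim (\<lambda>n. f n z))"
    and "set bs \<subseteq> Basis \<Longrightarrow> z \<in> S \<Longrightarrow> (\<lambda>n. iter_deriv bs (f n) z) \<longlonglongrightarrow> iter_deriv bs (\<lambda>z. lim (\<lambda>n. f n z)) z"
proof -
  define \<Phi> where "\<Phi> bs z = lim (\<lambda>n. iter_deriv bs (f n) z)" for bs z
  have conv: "(\<lambda>n. iter_deriv bs (f n) z) \<longlonglongrightarrow> \<Phi> bs z" if z: "z \<in> S" and bs: "set bs \<subseteq> Basis" for z bs
  proof -
    obtain U where U: "z \<in> U" "\<forall>bs. set bs \<subseteq> Basis \<longrightarrow> (\<exists>M K. \<forall>n\<ge>K. \<forall>w\<in>U.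
        \<bar>iter_deriv bs (f (Suc n)) w - iter_deriv bs (f n) w\<bar> \<le> M * (1/2) ^ n)"
      using loc[OF z] by (elim exE conjE)
    obtain M K where "\<forall>n\<ge>K. \<forall>w\<in>U.
        \<bar>iter_deriv bs (f (Suc n)) w - iter_deriv bs (f n) w\<bar> \<le> M * (1/2) ^ n"
      using U(2)[rule_format, OF bs] by (elim exE)
    with U(1) have "\<And>n. K \<le> n \<Longrightarrow> \<bar>iter_deriv bs (f (Suc n)) z - iter_deriv bs (f n) z\<bar> \<le> M * (1/2) ^ n"
      by simp
    then show ?thesis unfolding \<Phi>_def convergent_LIMSEQ_iff[symmetric]
      by (rule geometric_Cauchy_limit(1)[where K = K and M = M])
  qed
  have deriv: "(\<Phi> bs has_derivative (\<lambda>h. \<Sum>b\<in>Basis. (h \<bullet> b) * \<Phi> (b # bs) z)) (at z)"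
    if z: "z \<in> S" and bs: "set bs \<subseteq> Basis" for z bs
  proof -
    obtain U N where U: "open U" "convex U" "z \<in> U" "U \<subseteq> S" and smU: "\<forall>n\<ge>N. smooth_on U (f n)"
      and bound': "\<forall>bs. set bs \<subseteq> Basis \<longrightarrow> (\<exists>M K. \<forall>n\<ge>K. \<forall>w\<in>U.
        \<bar>iter_deriv bs (f (Suc n)) w - iter_deriv bs (f n) w\<bar> \<le> M * (1/2) ^ n)"
      using loc[OF z] by (elim exE conjE)
    note sm = smU[rule_format] and bound = bound'[rule_format]
    have "\<exists>M K. \<forall>n\<ge>K. \<forall>w\<in>U. \<bar>\<Phi> (b # bs) w - iter_deriv (b # bs) (f n) w\<bar> \<le> M * (1/2) ^ n" if "b \<in> Basis" for b
    proof -
      have "set (b # bs) \<subseteq> Basis" using that bs by simp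
      from bound[OF this] obtain M K where MK: "\<And>n w. K \<le> n \<Longrightarrow> w \<in> U \<Longrightarrow>
        \<bar>iter_deriv (b # bs) (f (Suc n)) w - iter_deriv (b # bs) (f n) w\<bar> \<le> M * (1/2) ^ n" by blast
      have "\<bar>\<Phi> (b # bs) w - iter_deriv (b # bs) (f n) w\<bar> \<le> (2 * M) * (1/2) ^ n" if "K \<le> n" "w \<in> U" for n w
        unfolding \<Phi>_def using geometric_Cauchy_limit(2)[where K = K and M = M, OF MK[OF _ that(2)] that(1)] .
      then show ?thesis by blast
    qed
    then have "\<forall>b\<in>Basis. \<exists>M K. \<forall>n\<ge>K. \<forall>w\<in>U. \<bar>\<Phi> (b # bs) w - iter_deriv (b # bs) (f n) w\<bar> \<le> M * (1/2) ^ n"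
      by (rule ballI)
    from bchoice[OF this]
    obtain M where "\<forall>b\<in>Basis. \<exists>K. \<forall>n\<ge>K. \<forall>w\<in>U. \<bar>\<Phi> (b # bs) w - iter_deriv (b # bs) (f n) w\<bar> \<le> M b * (1/2) ^ n"
      by (elim exE)
    from bchoice[OF this]
    obtain K where "\<forall>b\<in>Basis. \<forall>n\<ge>K b. \<forall>w\<in>U. \<bar>\<Phi> (b # bs) w - iter_deriv (b # bs) (f n) w\<bar> \<le> M b * (1/2) ^ n"
      by (elim exE)
    then have MK: "\<bar>\<Phi> (b # bs) w - iter_deriv (b # bs) (f n) w\<bar> \<le> M b * (1/2) ^ n"
      if "b \<in> Basis" "K b \<le> n" "w \<in> U" for b n w using that by simp
    define K' where "K' = (\<Sum>b\<in>Basis. K b)"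
    have K': "K b \<le> K'" if "b \<in> Basis" for b
      unfolding K'_def using that by (intro member_le_sum) auto
    define M' where "M' = (\<Sum>b\<in>Basis. \<bar>M b\<bar>)"
    \<comment> \<open>The shift by \<open>N\<close> discards the members that may fail to be smooth
      on \<open>U\<close>.\<close>
    have "\<exists>G. \<forall>x\<in>U. (\<lambda>n. iter_deriv bs (f (n + N)) x) \<longlonglongrightarrow> G x \<and>
        (G has_derivative (\<lambda>h. \<Sum>b\<in>Basis. (h \<bullet> b) * \<Phi> (b # bs) x)) (at x within U)"
    proof (rule has_derivative_sequence[OF U(2) _ _ U(3)])
      show "(iter_deriv bs (f (n + N)) has_derivative (\<lambda>h. iter_deriv (h # bs) (f (n + N)) x)) (at x within U)"
        if "x \<in> U" for n x
        by (rule has_derivative_at_withinI[OF iter_deriv_has_derivative[OF sm that]]) simp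
      show "(\<lambda>n. iter_deriv bs (f (n + N)) z) \<longlonglongrightarrow> \<Phi> bs z"
        by (rule LIMSEQ_ignore_initial_segment[OF conv[OF z bs]])
      fix e :: real assume e: "0 < e"
      have "(\<lambda>n. M' * (1/2) ^ n) \<longlonglongrightarrow> M' * 0"
        by (intro tendsto_mult tendsto_const LIMSEQ_power_zero) simp
      then have "eventually (\<lambda>n. M' * (1/2) ^ n < e) sequentially"
        using e by (simp add: order_tendstoD(2))
      then obtain N' where N': "\<And>n. N' \<le> n \<Longrightarrow> M' * (1/2) ^ n < e" by (auto simp: eventually_sequentially)
      have "norm (iter_deriv (h # bs) (f (n + N)) x - (\<Sum>b\<in>Basis. (h \<bullet> b) * \<Phi> (b # bs) x)) \<le> e * norm h"
        if n: "max N' K' \<le> n" and x: "x \<in> U" for n x h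
      proof -
        have "iter_deriv (h # bs) (f (n + N)) x = (\<Sum>b\<in>Basis. (h \<bullet> b) * iter_deriv (b # bs) (f (n + N)) x)"
          by (rule linear_sum_Basis[OF linear_iter_deriv[OF sm x]]) simp
        then have "norm (iter_deriv (h # bs) (f (n + N)) x - (\<Sum>b\<in>Basis. (h \<bullet> b) * \<Phi> (b # bs) x)) =
           norm (\<Sum>b\<in>Basis. (h \<bullet> b) * (iter_deriv (b # bs) (f (n + N)) x - \<Phi> (b # bs) x))"
          by (simp only: sum_subtractf right_diff_distrib)
        also have "\<dots> \<le> (\<Sum>b\<in>Basis. norm h * (\<bar>M b\<bar> * (1/2) ^ n))"
        proof (rule sum_norm_le)
          fix b :: 'a assume b: "b \<in> Basis"
          have "\<bar>iter_deriv (b # bs) (f (n + N)) x - \<Phi> (b # bs) x\<bar> \<le> M b * (1/2) ^ (n + N)"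
            using MK[OF b, of "n + N" x] K'[OF b] n x by (simp add: abs_minus_commute)
          also have "\<dots> \<le> \<bar>M b\<bar> * (1/2) ^ n"
            by (intro mult_mono power_decreasing) auto
          finally show "norm ((h \<bullet> b) * (iter_deriv (b # bs) (f (n + N)) x - \<Phi> (b # bs) x)) \<le> norm h * (\<bar>M b\<bar> * (1/2) ^ n)"
            using Basis_le_norm[OF b, of h] by (simp only: real_norm_def abs_mult) (intro mult_mono; simp)
        qed
        also have "\<dots> = (M' * (1/2) ^ n) * norm h"
          by (simp add: M'_def mult_ac flip: sum_distrib_left sum_distrib_right)
        also have "\<dots> \<le> e * norm h"
          using N'[of n] n by (intro mult_right_mono) auto
        finally show ?thesis .
      qed
      then show "\<forall>\<^sub>F n in sequentially. \<forall>x\<in>U. \<forall>h. norm (iter_deriv (h # bs) (f (n + N)) x - (\<Sum>b\<in>Basis. (h \<bullet> b) * \<Phi> (b # bs) x)) \<le> e * norm h"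
        unfolding eventually_sequentially by blast
    qed
    then obtain G where G: "\<And>x. x \<in> U \<Longrightarrow> (\<lambda>n. iter_deriv bs (f (n + N)) x) \<longlonglongrightarrow> G x"
      "\<And>x. x \<in> U \<Longrightarrow> (G has_derivative (\<lambda>h. \<Sum>b\<in>Basis. (h \<bullet> b) * \<Phi> (b # bs) x)) (at x within U)" by blast
    have "G x = \<Phi> bs x" if "x \<in> U" for x
      using LIMSEQ_unique[OF G(1)[OF that] LIMSEQ_ignore_initial_segment[OF conv[OF subsetD[OF U(4) that] bs]]] .
    then show ?thesis
      using has_derivative_transform_within_open[of G "\<lambda>h. \<Sum>b\<in>Basis. (h \<bullet> b) * \<Phi> (b # bs) z" z UNIV U "\<Phi> bs"]
        G(2)[OF U(3)] U(1,3) at_within_open[OF U(3,1)] by simp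
  qed
  have Ck: "Ck_on k S (\<Phi> bs)" if "set bs \<subseteq> Basis" for k bs
    using that
  proof (induction k arbitrary: bs)
    case 0
    have "\<Phi> bs differentiable (at z)" if "z \<in> S" for z
      using deriv[OF that 0] by (auto simp: differentiable_def)
    then show ?case by (simp add: differentiable_imp_continuous_on differentiable_at_imp_differentiable_on)
  next
    case (Suc k)
    have "Ck_on k S (\<lambda>z. frechet_derivative (\<Phi> bs) (at z) v)" for v
    proof (subst Ck_on_cong_open[OF S])
      show "frechet_derivative (\<Phi> bs) (at z) v = (\<Sum>b\<in>Basis. (v \<bullet> b) * \<Phi> (b # bs) z)" if "z \<in> S" for z
        by (rule fun_cong[OF frechet_derivative_at[OF deriv[OF that Suc.prems], symmetric]])
      show "Ck_on k S (\<lambda>z. \<Sum>b\<in>Basis. (v \<bullet> b) * \<Phi> (b # bs) z)"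
      proof (intro Ck_on_sum Ck_on_mult S)
        show "Ck_on k S (\<lambda>z. v \<bullet> b)" for b
          using smooth_on_const[of S "v \<bullet> b"] by (simp add: smooth_on_def)
        show "Ck_on k S (\<Phi> (b # bs))" if "b \<in> Basis" for b
          using Suc that by simp
      qed
    qed
    then show ?case using deriv[OF _ Suc.prems] by (auto simp: differentiable_def)
  qed
  have \<Phi>0: "(\<lambda>z. lim (\<lambda>n. f n z)) = \<Phi> []" by (simp add: \<Phi>_def fun_eq_iff)
  show "smooth_on S (\<lambda>z. lim (\<lambda>n. f n z))"
    unfolding \<Phi>0 smooth_on_def using Ck by simp
  have eq: "iter_deriv bs (\<Phi> []) z = \<Phi> bs z" if "set bs \<subseteq> Basis" "z \<in> S" for bs z
    using that
  proof (induction bs arbitrary: z)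
    case (Cons b bs)
    have "iter_deriv (b # bs) (\<Phi> []) z = frechet_derivative (\<Phi> bs) (at z) b"
      using frechet_derivative_cong_open[OF S, of z "iter_deriv bs (\<Phi> [])" "\<Phi> bs"] Cons by simp
    also have "\<dots> = (\<Sum>b'\<in>Basis. (b \<bullet> b') * \<Phi> (b' # bs) z)"
      using Cons.prems by (intro fun_cong[OF frechet_derivative_at[OF deriv, symmetric]]) auto
    also have "\<dots> = (\<Sum>b'\<in>Basis. if b' = b then \<Phi> (b' # bs) z else 0)"
      using Cons.prems by (intro sum.cong) (auto simp: inner_Basis)
    also have "\<dots> = \<Phi> (b # bs) z" using Cons.prems by simp
    finally show ?case .
  qed auto
  show "set bs \<subseteq> Basis \<Longrightarrow> z \<in> S \<Longrightarrow> (\<lambda>n. iter_deriv bs (f n) z) \<longlonglongrightarrow> iter_deriv bs (\<lambda>z. lim (\<lambda>n. f n z)) z"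
    unfolding \<Phi>0 using eq conv by simp
qed

lemma norm_shift_ge:
  fixes x a :: "'a::real_normed_vector"
  assumes "2 * norm a \<le> norm x"
  shows "norm x / 2 \<le> norm (x - a)"
  using norm_triangle_ineq2[of x a] assms by simp

section \<open>A potential singular on a rough curve\<close>

lemma mem_off_curve: "(x, t) \<in> off_curve \<gamma> \<longleftrightarrow> 0 < t \<and> x \<noteq> \<gamma> t"
  by (auto simp: off_curve_def curve_graph_def)

text \<open>Bounded times and a uniform distance from the curve bring a whole neighbourhood within
  the range of all late steps of the construction.\<close>

lemma off_curve_local:
  assumes cont: "continuous_on {0..} \<gamma>" and z: "z \<in> off_curve \<gamma>"
  shows "\<exists>\<delta>>0. \<exists>\<rho>>0. \<exists>T. \<forall>x t. (x, t) \<in> ball z \<delta> \<longrightarrow> 0 < t \<and> t \<le> T \<and> 2 * \<rho> \<le> norm (x - \<gamma> t)"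
proof -
  obtain x0 t0 where z0: "z = (x0, t0)" by (cases z)
  have t0: "0 < t0" "x0 \<noteq> \<gamma> t0" using z by (auto simp: z0 mem_off_curve)
  \<comment> \<open>A quarter of the distance: the variation of \<open>x\<close> and that of
    \<open>\<gamma> t\<close> cost at most \<open>\<rho>\<close> each, which leaves
    \<open>2 * \<rho>\<close>.\<close>
  define \<rho> where "\<rho> = norm (x0 - \<gamma> t0) / 4"
  have \<rho>: "\<rho> > 0" using t0 by (simp add: \<rho>_def)
  have "continuous_on {0<..} \<gamma>" by (rule continuous_on_subset[OF cont]) auto
  then have "isCont \<gamma> t0" using t0 by (simp add: continuous_on_eq_continuous_at)
  then obtain d where d: "d > 0" "\<And>t. dist t t0 < d \<Longrightarrow> dist (\<gamma> t) (\<gamma> t0) < \<rho>"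
    unfolding continuous_at_eps_delta using \<rho> by metis
  define \<delta> where "\<delta> = min d (min \<rho> t0)"
  have \<delta>: "\<delta> > 0" using d \<rho> t0 by (simp add: \<delta>_def)
  have "0 < t \<and> t \<le> t0 + \<delta> \<and> 2 * \<rho> \<le> norm (x - \<gamma> t)" if "(x, t) \<in> ball z \<delta>" for x t
  proof -
    have "dist x x0 < \<delta>" "dist t t0 < \<delta>"
      using that dist_fst_le[of "(x, t)" z] dist_snd_le[of "(x, t)" z]
      by (auto simp: z0 dist_commute)
    then have x: "norm (x - x0) < \<rho>" and t: "\<bar>t - t0\<bar> < \<delta>" "norm (\<gamma> t - \<gamma> t0) < \<rho>" "\<bar>t - t0\<bar> < t0"
      using d(2)[of t] by (auto simp: \<delta>_def dist_norm)
    have "norm (x0 - \<gamma> t0) \<le> norm (x - x0) + norm (\<gamma> t - \<gamma> t0) + norm (x - \<gamma> t)"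
      using norm_triangle_ineq4[of "x - \<gamma> t" "x - x0"] norm_triangle_ineq[of "x0 - \<gamma> t" "\<gamma> t - \<gamma> t0"]
      by (simp add: algebra_simps)
    with x t show ?thesis unfolding \<rho>_def by linarith
  qed
  then show ?thesis using \<delta> \<rho> by blast
qed

lemma open_off_curve:
  assumes "continuous_on {0..} \<gamma>"
  shows "open (off_curve \<gamma>)"
  unfolding open_contains_ball
proof
  fix z assume "z \<in> off_curve \<gamma>"
  from off_curve_local[OF assms this] obtain \<delta> \<rho> T where
    *: "\<delta> > 0" "\<rho> > 0" "\<And>x t. (x, t) \<in> ball z \<delta> \<Longrightarrow> 0 < t \<and> t \<le> T \<and> 2 * \<rho> \<le> norm (x - \<gamma> t)" by blast
  have "(x, t) \<in> off_curve \<gamma>" if "(x, t) \<in> ball z \<delta>" for x t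
    using *(2) *(3)[OF that] by (auto simp: mem_off_curve)
  with *(1) show "\<exists>e>0. ball z e \<subseteq> off_curve \<gamma>" by (meson subrelI)
qed

text \<open>The factor 1/64 is chosen for the comparison far out: passing from the distance to the
  pole to \<open>norm x\<close> costs 4 and summing the geometric series costs 2, so the total of
  all late steps is at most 1/8 of \<open>1 / (norm x)\<^sup>2\<close>. The last property records
  that every \<open>f n\<close> has the same leading dipole.\<close>

lemma multipole_sequence:
  fixes \<gamma> :: "real \<Rightarrow> real^3"
  assumes cont: "continuous_on {0..} \<gamma>"
  obtains G f where "\<And>n. polynomial_function (G n)" "\<And>n. multipole (G n) (f n)"
    "\<And>n t. t \<in> {0..real n} \<Longrightarrow> norm (\<gamma> t - G n t) \<le> (1/2) ^ n"
    "\<And>n bs t x. set bs \<subseteq> Basis \<Longrightarrow> length bs \<le> n \<Longrightarrow> t \<in> {0..real n} \<Longrightarrow> (1/2) ^ n \<le> norm (x - G (Suc n) t) \<Longrightarrow>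
      \<bar>iter_deriv bs (f (Suc n)) (x, t) - iter_deriv bs (f n) (x, t)\<bar> \<le> (1/64) * (1/2) ^ n / (norm (x - G (Suc n) t))\<^sup>2"
    "\<And>n t. \<exists>C R. 0 < R \<and> (\<forall>x. R \<le> norm x \<longrightarrow> \<bar>f n (x, t) - iter_deriv [axis 1 1] newton (x - G 0 t)\<bar> \<le> C / norm x ^ 3)"
proof -
  \<comment> \<open>The denominator 100 leaves room for \<open>48 * (1/100 + 1/200) < 1\<close>, the
    closeness that \<open>pole_push\<close> asks of consecutive curves.\<close>
  have "\<exists>g. polynomial_function g \<and> (\<forall>t\<in>{0..real n + 1}. norm (\<gamma> t - g t) < (1/2) ^ n / 100)" for n
    by (rule Stone_Weierstrass_polynomial_function) (auto intro: continuous_on_subset[OF cont])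
  then obtain G where G: "\<And>n. polynomial_function (G n)"
    "\<And>n t. t \<in> {0..real n + 1} \<Longrightarrow> norm (\<gamma> t - G n t) < (1/2) ^ n / 100" by metis
  have near: "48 * norm (G (Suc n) t - G n t) \<le> (1/2) ^ n" if "t \<in> {0..real n}" for n t
  proof -
    have "norm (G (Suc n) t - G n t) \<le> norm (\<gamma> t - G n t) + norm (\<gamma> t - G (Suc n) t)"
      using norm_triangle_ineq4[of "\<gamma> t - G n t" "\<gamma> t - G (Suc n) t"] by simp
    moreover have "norm (\<gamma> t - G n t) < (1/2) ^ n / 100" "norm (\<gamma> t - G (Suc n) t) < (1/2) ^ n / 2 / 100"
      using G(2)[of t n] G(2)[of t "Suc n"] that by simp_all
    ultimately show ?thesis using zero_le_power[of "1/2::real" n] by linarith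
  qed
  define B :: "nat \<Rightarrow> spacetime list set" where "B n = {bs. set bs \<subseteq> Basis \<and> length bs \<le> n}" for n
  have B: "finite (B n)" for n
    unfolding B_def by (rule finite_lists_length_le) simp
  define D where "D t x = iter_deriv [axis 1 1] newton (x - G 0 t)" for t x
  \<comment> \<open>The invariant always compares with the initial dipole at \<open>G 0 t\<close>
    and measures in \<open>norm x\<close>, not in the distance to the current pole, so that the
    bounds of successive steps add up.\<close>
  define P where "P n h \<longleftrightarrow> multipole (G n) h \<and>
    (\<forall>t. \<exists>C R. 0 < R \<and> (\<forall>x. R \<le> norm x \<longrightarrow> \<bar>h (x, t) - D t x\<bar> \<le> C / norm x ^ 3))" for n h
  define Q where "Q n h h' \<longleftrightarrow> (\<forall>bs\<in>B n. \<forall>t\<in>{0..real n}. \<forall>x. (1/2) ^ n \<le> norm (x - G (Suc n) t) \<longrightarrow>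
     \<bar>iter_deriv bs h (x, t) - iter_deriv bs h' (x, t)\<bar> \<le> (1/64) * (1/2) ^ n / (norm (x - G (Suc n) t))\<^sup>2)" for n h h'
  have "\<exists>f. \<forall>n. P n (f n) \<and> Q n (f n) (f (Suc n))"
  proof (rule dependent_nat_choice)
    have "multipole (G 0) (\<lambda>z. 1 * iter_deriv [axis 1 1] newton (fst z - G 0 (snd z)))"
      by (rule mp_term) (auto simp: real_polynomial_function_eq)
    then show "\<exists>h. P 0 h"
      unfolding P_def D_def by (intro exI[of _ "\<lambda>z. 1 * iter_deriv [axis 1 1] newton (fst z - G 0 (snd z))"])
        (auto intro!: exI[of _ 0] exI[of _ 1])
  next
    fix h n assume P: "P n h"
    then have h: "multipole (G n) h" by (simp add: P_def)
    have "\<exists>h'. multipole (G (Suc n)) h' \<and>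
      (\<forall>bs\<in>B n. \<forall>t\<in>{0..real n}. \<forall>x. (1/2) ^ n \<le> norm (x - G (Suc n) t) \<longrightarrow>
        \<bar>iter_deriv bs h (x, t) - iter_deriv bs h' (x, t)\<bar> \<le> (1/64) * (1/2) ^ n / (norm (x - G (Suc n) t))\<^sup>2) \<and>
      (\<forall>t. \<exists>C R. 0 < R \<and> (\<forall>x. R \<le> norm (x - G (Suc n) t) \<longrightarrow> \<bar>h (x, t) - h' (x, t)\<bar> \<le> C / norm (x - G (Suc n) t) ^ 3))"
      by (rule pole_push[OF G(1) G(1)[of n] h _ near]) (use B in auto)
    then obtain h' where h': "multipole (G (Suc n)) h'" "Q n h h'"
      "\<And>t. \<exists>C R. 0 < R \<and> (\<forall>x. R \<le> norm (x - G (Suc n) t) \<longrightarrow> \<bar>h (x, t) - h' (x, t)\<bar> \<le> C / norm (x - G (Suc n) t) ^ 3)"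
      unfolding Q_def by blast
    have "\<exists>C R. 0 < R \<and> (\<forall>x. R \<le> norm x \<longrightarrow> \<bar>h' (x, t) - D t x\<bar> \<le> C / norm x ^ 3)" for t
    proof -
      obtain C1 R1 where 1: "0 < R1" "\<And>x. R1 \<le> norm x \<Longrightarrow> \<bar>h (x, t) - D t x\<bar> \<le> C1 / norm x ^ 3"
        using P unfolding P_def by blast
      obtain C2 R2 where 2: "0 < R2"
        "\<And>x. R2 \<le> norm (x - G (Suc n) t) \<Longrightarrow> \<bar>h (x, t) - h' (x, t)\<bar> \<le> C2 / norm (x - G (Suc n) t) ^ 3"
        using h'(3) by blast
      define R where "R = R1 + 2 * R2 + 2 * norm (G (Suc n) t)"
      have "\<bar>h' (x, t) - D t x\<bar> \<le> (C1 + 8 * \<bar>C2\<bar>) / norm x ^ 3" if x: "R \<le> norm x" for x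
      proof -
        have half: "norm x / 2 \<le> norm (x - G (Suc n) t)"
          using x 1(1) 2(1) by (intro norm_shift_ge) (simp add: R_def)
        have x1: "R1 \<le> norm x" "R2 \<le> norm (x - G (Suc n) t)" "0 < norm x"
          using x 1(1) 2(1) half norm_ge_zero[of "G (Suc n) t"] unfolding R_def by linarith+
        have "\<bar>h (x, t) - h' (x, t)\<bar> \<le> C2 / norm (x - G (Suc n) t) ^ 3" by (rule 2(2)[OF x1(2)])
        also have "\<dots> \<le> \<bar>C2\<bar> / norm (x - G (Suc n) t) ^ 3" by (intro divide_right_mono) auto
        also have "\<dots> \<le> \<bar>C2\<bar> / (norm x / 2) ^ 3"
          using half x1 2(1) by (intro divide_left_mono power_mono mult_pos_pos zero_less_power) auto
        finally have "\<bar>h (x, t) - h' (x, t)\<bar> \<le> 8 * \<bar>C2\<bar> / norm x ^ 3"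
          by (simp add: power_divide mult.commute)
        with 1(2)[OF x1(1)] show ?thesis by (simp add: add_divide_distrib)
      qed
      moreover have "0 < R"
        using 1(1) 2(1) norm_ge_zero[of "G (Suc n) t"] unfolding R_def by linarith
      ultimately show ?thesis by blast
    qed
    with h'(1,2) show "\<exists>h'. P (Suc n) h' \<and> Q n h h'" unfolding P_def by blast
  qed
  then obtain f where f: "\<And>n. P n (f n)" "\<And>n. Q n (f n) (f (Suc n))" by blast
  show thesis
  proof (rule that[of G f])
    show "polynomial_function (G n)" for n by (rule G(1))
    show "multipole (G n) (f n)" for n using f(1) by (simp add: P_def)
    show "norm (\<gamma> t - G n t) \<le> (1/2) ^ n" if "t \<in> {0..real n}" for n t
    proof -
      have "norm (\<gamma> t - G n t) < (1/2) ^ n / 100" using that by (intro G(2)) auto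
      also have "\<dots> \<le> (1/2) ^ n" by simp
      finally show ?thesis by simp
    qed
    show "\<bar>iter_deriv bs (f (Suc n)) (x, t) - iter_deriv bs (f n) (x, t)\<bar> \<le> (1/64) * (1/2) ^ n / (norm (x - G (Suc n) t))\<^sup>2"
      if "set bs \<subseteq> Basis" "length bs \<le> n" "t \<in> {0..real n}" "(1/2) ^ n \<le> norm (x - G (Suc n) t)" for n bs t x
      using f(2)[of n] that unfolding Q_def B_def by (subst abs_minus_commute) blast
    show "\<exists>C R. 0 < R \<and> (\<forall>x. R \<le> norm x \<longrightarrow> \<bar>f n (x, t) - iter_deriv [axis 1 1] newton (x - G 0 t)\<bar> \<le> C / norm x ^ 3)" for n t
      using f(1)[of n] unfolding P_def D_def by blast
  qed
qed

lemma moving_potential_exists: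
  fixes \<gamma> :: "real \<Rightarrow> real^3"
  assumes cont: "continuous_on {0..} \<gamma>"
  obtains \<phi> :: "spacetime \<Rightarrow> real" where "smooth_on (off_curve \<gamma>) \<phi>"
    "\<And>z. z \<in> off_curve \<gamma> \<Longrightarrow> (\<Sum>b\<in>Basis. iter_deriv [(b, 0), (b, 0)] \<phi> z) = 0"
    "\<And>t v. 0 < t \<Longrightarrow> v \<in> Basis \<Longrightarrow> \<exists>C R. \<forall>x. R \<le> norm x \<longrightarrow> \<bar>iter_deriv [v] \<phi> (x, t)\<bar> \<le> C / (norm x)\<^sup>2"
    "\<And>t. 0 < t \<Longrightarrow> \<exists>b\<in>Basis. \<exists>x. x \<noteq> \<gamma> t \<and> iter_deriv [(b, 0)] \<phi> (x, t) \<noteq> 0"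
proof -
  obtain G f where G: "\<And>n. polynomial_function (G n)" and f: "\<And>n. multipole (G n) (f n)"
    and near: "\<And>n t. t \<in> {0..real n} \<Longrightarrow> norm (\<gamma> t - G n t) \<le> (1/2) ^ n"
    and step: "\<And>n bs t x. set bs \<subseteq> Basis \<Longrightarrow> length bs \<le> n \<Longrightarrow> t \<in> {0..real n} \<Longrightarrow> (1/2) ^ n \<le> norm (x - G (Suc n) t) \<Longrightarrow>
      \<bar>iter_deriv bs (f (Suc n)) (x, t) - iter_deriv bs (f n) (x, t)\<bar> \<le> (1/64) * (1/2) ^ n / (norm (x - G (Suc n) t))\<^sup>2"
    and dipole: "\<And>n t. \<exists>C R. 0 < R \<and> (\<forall>x. R \<le> norm x \<longrightarrow> \<bar>f n (x, t) - iter_deriv [axis 1 1] newton (x - G 0 t)\<bar> \<le> C / norm x ^ 3)"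
    using multipole_sequence[OF cont] by metis
  define S where "S = off_curve \<gamma>"
  \<comment> \<open>Off the curve the sequence converges; on the curve the value of
    \<open>lim\<close> is of no concern.\<close>
  define \<phi> where "\<phi> z = lim (\<lambda>n. f n z)" for z
  have S: "open S" unfolding S_def by (rule open_off_curve[OF cont])
  have loc: "\<exists>U N. open U \<and> convex U \<and> z \<in> U \<and> U \<subseteq> S \<and> (\<forall>n\<ge>N. smooth_on U (f n)) \<and> (\<forall>n\<ge>N. U \<subseteq> off_graph (G n)) \<and>
      (\<forall>bs. set bs \<subseteq> Basis \<longrightarrow> (\<exists>M K. \<forall>n\<ge>K. \<forall>w\<in>U.
        \<bar>iter_deriv bs (f (Suc n)) w - iter_deriv bs (f n) w\<bar> \<le> M * (1/2) ^ n))" if z: "z \<in> S" for z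
  proof -
    obtain \<delta> \<rho> T where *: "\<delta> > 0" "\<rho> > 0"
      "\<And>x t. (x, t) \<in> ball z \<delta> \<Longrightarrow> 0 < t \<and> t \<le> T \<and> 2 * \<rho> \<le> norm (x - \<gamma> t)"
      using off_curve_local[OF cont z[unfolded S_def]] by blast
    \<comment> \<open>From \<open>N\<close> on, all times in the ball lie in
      \<open>{0..real n}\<close> and the excluded radius \<open>(1/2) ^ n\<close> is at most
      \<open>\<rho>\<close>.\<close>
    obtain N1 where N1: "T \<le> real N1" using real_arch_simple by blast
    obtain N2 where N2: "(1/2) ^ N2 < \<rho>" using real_arch_pow_inv[OF *(2), of "1/2"] by auto
    define N where "N = max N1 N2"
    have pw: "(1/2) ^ n \<le> \<rho>" if "N \<le> n" for n
    proof -
      have "(1/2 :: real) ^ n \<le> (1/2) ^ N2" using that by (intro power_decreasing) (auto simp: N_def)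
      with N2 show ?thesis by linarith
    qed
    have tn: "t \<in> {0..real n}" if "(x, t) \<in> ball z \<delta>" "N \<le> n" for x t n
      using *(3)[OF that(1)] N1 that(2) by (auto simp: N_def)
    have far: "\<rho> \<le> norm (x - G n t)" if "(x, t) \<in> ball z \<delta>" "N \<le> n" for x t n
      using *(3)[OF that(1)] near[OF tn[OF that]] pw[OF that(2)] norm_triangle_ineq[of "x - G n t" "G n t - \<gamma> t"]
      by (simp add: norm_minus_commute)
    have off: "ball z \<delta> \<subseteq> off_graph (G n)" if "N \<le> n" for n
      using far[OF _ that] *(2) by fastforce
    show ?thesis
    proof (intro exI[of _ "ball z \<delta>"] exI[of _ N] conjI allI impI)
      show "smooth_on (ball z \<delta>) (f n)" if "N \<le> n" for n
        by (rule smooth_on_subset[OF smooth_on_multipole[OF G f] off[OF that]])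
      show "\<exists>M K. \<forall>n\<ge>K. \<forall>w\<in>ball z \<delta>. \<bar>iter_deriv bs (f (Suc n)) w - iter_deriv bs (f n) w\<bar> \<le> M * (1/2) ^ n"
        if bs: "set bs \<subseteq> Basis" for bs
      proof (intro exI[of _ "1 / \<rho>\<^sup>2"] exI[of _ "max N (length bs)"] allI impI ballI)
        fix n w assume n: "max N (length bs) \<le> n" and w: "w \<in> ball z \<delta>"
        obtain x t where wxt: "w = (x, t)" by (cases w)
        have r: "\<rho> \<le> norm (x - G (Suc n) t)" using far[of x t "Suc n"] n w by (simp add: wxt)
        have "\<bar>iter_deriv bs (f (Suc n)) w - iter_deriv bs (f n) w\<bar> \<le> (1/64) * (1/2) ^ n / (norm (x - G (Suc n) t))\<^sup>2"
          unfolding wxt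
        proof (rule step[OF bs])
          show "(1/2) ^ n \<le> norm (x - G (Suc n) t)" using r pw[of n] n by simp
          show "t \<in> {0..real n}" using tn[of x t n] n w by (simp add: wxt)
        qed (use n in simp)
        also have "\<dots> \<le> (1/64) * (1/2) ^ n / \<rho>\<^sup>2"
          using r *(2) by (intro divide_left_mono power_mono mult_pos_pos) auto
        also have "\<dots> \<le> 1 / \<rho>\<^sup>2 * (1/2) ^ n" using *(2) by (simp add: divide_simps)
        finally show "\<bar>iter_deriv bs (f (Suc n)) w - iter_deriv bs (f n) w\<bar> \<le> 1 / \<rho>\<^sup>2 * (1/2) ^ n" .
      qed
      show "ball z \<delta> \<subseteq> S"
      proof
        fix w assume w: "w \<in> ball z \<delta>"
        obtain x t where wxt: "w = (x, t)" by (cases w)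
        show "w \<in> S" using *(2) *(3)[of x t] w by (auto simp: wxt S_def mem_off_curve)
      qed
      show "ball z \<delta> \<subseteq> off_graph (G n)" if "N \<le> n" for n by (rule off[OF that])
    qed (use *(1) in auto)
  qed
  have loc': "\<exists>U N. open U \<and> convex U \<and> z \<in> U \<and> U \<subseteq> S \<and> (\<forall>n\<ge>N. smooth_on U (f n)) \<and>
      (\<forall>bs. set bs \<subseteq> Basis \<longrightarrow> (\<exists>M K. \<forall>n\<ge>K. \<forall>w\<in>U.
        \<bar>iter_deriv bs (f (Suc n)) w - iter_deriv bs (f n) w\<bar> \<le> M * (1/2) ^ n))" if z: "z \<in> S" for z
    using loc[OF z] by (elim exE conjE) (intro exI conjI; assumption)
  have sm: "smooth_on S \<phi>"
    unfolding \<phi>_def[abs_def] by (rule smooth_limit(1)[OF S loc'])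
  have conv: "(\<lambda>n. iter_deriv bs (f n) z) \<longlonglongrightarrow> iter_deriv bs \<phi> z" if "set bs \<subseteq> Basis" "z \<in> S" for bs z
    unfolding \<phi>_def[abs_def] by (rule smooth_limit(2)[OF S loc' that])
  have axes: "(b, 0) \<in> Basis" if "b \<in> Basis" for b :: "real^3"
    using that by (simp add: Basis_prod_def)
  have harm: "(\<Sum>b\<in>Basis. iter_deriv [(b, 0), (b, 0)] \<phi> z) = 0" if z: "z \<in> S" for z
  proof (rule LIMSEQ_unique)
    show "(\<lambda>n. \<Sum>b\<in>Basis. iter_deriv [(b, 0), (b, 0)] (f n) z) \<longlonglongrightarrow> (\<Sum>b\<in>Basis. iter_deriv [(b, 0), (b, 0)] \<phi> z)"
      by (intro tendsto_sum conv z) (auto intro: axes)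
    obtain U N where "z \<in> U" "\<forall>n\<ge>N. U \<subseteq> off_graph (G n)" using loc[OF z] by (elim exE conjE)
    then have "eventually (\<lambda>n. (\<Sum>b\<in>Basis. iter_deriv [(b, 0), (b, 0)] (f n) z) = 0) sequentially"
      unfolding eventually_sequentially by (intro exI[of _ N] allI impI multipole_harmonic[OF G f]) auto
    then show "(\<lambda>n. \<Sum>b\<in>Basis. iter_deriv [(b, 0), (b, 0)] (f n) z) \<longlonglongrightarrow> 0"
      by (rule tendsto_eventually)
  qed
  \<comment> \<open>Far from the origin all steps from \<open>N\<close> on apply at once. The
    increment of step \<open>n\<close> is at most
    \<open>(1/2) ^ n / (16 * (norm x)\<^sup>2)\<close>, and the geometric sum doubles this.\<close>
  have tail: "(x, t) \<in> S \<and> norm x / 2 \<le> norm (x - G N t) \<and>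
      \<bar>iter_deriv bs \<phi> (x, t) - iter_deriv bs (f N) (x, t)\<bar> \<le> 1 / (8 * (norm x)\<^sup>2)"
    if t: "0 < t" "t \<le> real N" and bs: "set bs \<subseteq> Basis" "length bs \<le> N" and x: "2 * (norm (\<gamma> t) + 1) \<le> norm x" for t x bs N
  proof -
    have half: "norm x / 2 \<le> norm (x - G n t)" if "N \<le> n" for n
    proof (rule norm_shift_ge)
      have "norm (G n t) \<le> norm (\<gamma> t) + (1/2) ^ n"
        using near[of t n] t that norm_triangle_ineq2[of "G n t" "\<gamma> t"] by (simp add: norm_minus_commute)
      also have "(1/2) ^ n \<le> (1::real)" by (rule power_le_one) auto
      finally show "2 * norm (G n t) \<le> norm x" using x by simp
    qed
    have nx: "2 \<le> norm x" using x norm_ge_zero[of "\<gamma> t"] by (smt (verit))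
    have xS: "(x, t) \<in> S"
    proof -
      have "norm x \<noteq> norm (\<gamma> t)" using x norm_ge_zero[of "\<gamma> t"] by (smt (verit))
      with t show ?thesis by (auto simp: S_def mem_off_curve)
    qed
    have "\<bar>iter_deriv bs (f (Suc n)) (x, t) - iter_deriv bs (f n) (x, t)\<bar> \<le> (1 / (16 * (norm x)\<^sup>2)) * (1/2) ^ n" if n: "N \<le> n" for n
    proof -
      have h: "norm x / 2 \<le> norm (x - G (Suc n) t)" using half[of "Suc n"] n by simp
      have "(1/2) ^ n \<le> (1::real)" by (rule power_le_one) auto
      then have "(1/2) ^ n \<le> norm (x - G (Suc n) t)" using h nx by linarith
      then have "\<bar>iter_deriv bs (f (Suc n)) (x, t) - iter_deriv bs (f n) (x, t)\<bar> \<le> (1/64) * (1/2) ^ n / (norm (x - G (Suc n) t))\<^sup>2"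
        using t bs n by (intro step) auto
      also have "\<dots> \<le> (1/64) * (1/2) ^ n / (norm x / 2)\<^sup>2"
        using h nx by (intro divide_left_mono power_mono mult_pos_pos) auto
      finally show ?thesis by (simp add: power_divide mult_ac)
    qed
    from geometric_Cauchy_limit(2)[where K = N and n = N, OF this]
    have "\<bar>lim (\<lambda>n. iter_deriv bs (f n) (x, t)) - iter_deriv bs (f N) (x, t)\<bar> \<le> 2 * (1 / (16 * (norm x)\<^sup>2)) * (1/2) ^ N" by simp
    also have "lim (\<lambda>n. iter_deriv bs (f n) (x, t)) = iter_deriv bs \<phi> (x, t)"
      by (rule limI[OF conv[OF bs(1) xS]])
    also have "2 * (1 / (16 * (norm x)\<^sup>2)) * (1/2) ^ N \<le> 2 * (1 / (16 * (norm x)\<^sup>2)) * 1"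
      by (intro mult_left_mono power_le_one) auto
    finally show ?thesis using half[of N] xS by simp
  qed
  \<comment> \<open>For \<open>N\<close> at least \<open>t\<close> and at least the order, the
    derivative of \<open>f N\<close> is a multipole with inverse square decay, and
    \<open>tail\<close> bounds what the later steps add.\<close>
  have decay: "\<exists>C R. 1 \<le> R \<and> (\<forall>x. R \<le> norm x \<longrightarrow> \<bar>iter_deriv bs \<phi> (x, t)\<bar> \<le> C / (norm x)\<^sup>2)"
    if t: "0 < t" and bs: "set bs \<subseteq> Basis" for t bs
  proof -
    obtain N0 where N0: "t \<le> real N0" using real_arch_simple by blast
    define N where "N = max N0 (length bs)"
    have N: "t \<le> real N" "length bs \<le> N" using N0 by (auto simp: N_def)
    obtain h where h: "multipole (G N) h" "\<And>z. z \<in> off_graph (G N) \<Longrightarrow> iter_deriv bs (f N) z = h z"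
      using iter_deriv_multipole[OF G f, of N bs] by blast
    obtain C where C: "C > 0" "\<And>x. 1 \<le> norm (x - G N t) \<Longrightarrow> \<bar>h (x, t)\<bar> \<le> C / (norm (x - G N t))\<^sup>2"
      using multipole_decay[OF h(1), of t] by blast
    have "\<bar>iter_deriv bs \<phi> (x, t)\<bar> \<le> (4 * C + 1) / (norm x)\<^sup>2" if x: "2 * (norm (\<gamma> t) + 1) \<le> norm x" for x
    proof -
      have nx: "2 \<le> norm x" using x norm_ge_zero[of "\<gamma> t"] by (smt (verit))
      have half: "norm x / 2 \<le> norm (x - G N t)"
        and d: "\<bar>iter_deriv bs \<phi> (x, t) - iter_deriv bs (f N) (x, t)\<bar> \<le> 1 / (8 * (norm x)\<^sup>2)"
        using tail[OF t N(1) bs N(2) x] by auto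
      have one: "1 \<le> norm (x - G N t)" using half nx by linarith
      then have "(x, t) \<in> off_graph (G N)" by auto
      from h(2)[OF this] C(2)[OF one] have "\<bar>iter_deriv bs (f N) (x, t)\<bar> \<le> C / (norm (x - G N t))\<^sup>2" by simp
      also have "\<dots> \<le> C / (norm x / 2)\<^sup>2"
        using half nx C(1) by (intro divide_left_mono power_mono mult_pos_pos) auto
      finally have "\<bar>iter_deriv bs (f N) (x, t)\<bar> \<le> 4 * C / (norm x)\<^sup>2" by (simp add: power_divide mult.commute)
      moreover have "1 / (8 * (norm x)\<^sup>2) \<le> 1 / (norm x)\<^sup>2" using nx by (intro divide_left_mono) auto
      ultimately show ?thesis using d by (simp add: add_divide_distrib)
    qed
    moreover have "1 \<le> 2 * (norm (\<gamma> t) + 1)" by simp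
    ultimately show ?thesis by blast
  qed
  \<comment> \<open>If the derivative along \<open>E\<close> vanished, \<open>\<phi>\<close> would
    be constant on a ray in that direction, hence 0 there by decay. Then \<open>f N\<close> would be
    small on the ray, against its dipole, which has size \<open>1 / R\<^sup>2\<close> on its
    axis.\<close>
  have nonzero: "\<exists>b\<in>Basis. \<exists>x. x \<noteq> \<gamma> t \<and> iter_deriv [(b, 0)] \<phi> (x, t) \<noteq> 0" if t: "0 < t" for t
  proof (rule ccontr)
    define E :: "real^3" where "E = axis 1 1"
    have E: "E \<in> Basis" "norm E = 1" by (auto simp: E_def axis_in_Basis_iff)
    assume "\<not> ?thesis"
    then have zero: "iter_deriv [(E, 0)] \<phi> (x, t) = 0" if "x \<noteq> \<gamma> t" for x
      using E that by blast
    obtain N where N: "t \<le> real N" using real_arch_simple by blast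
    obtain C1 R1 where 1: "0 < R1" "\<And>x. R1 \<le> norm x \<Longrightarrow> \<bar>f N (x, t) - iter_deriv [E] newton (x - G 0 t)\<bar> \<le> C1 / norm x ^ 3"
      using dipole[of N t] unfolding E_def by blast
    obtain C2 R2 where 2: "1 \<le> R2" "\<And>x. R2 \<le> norm x \<Longrightarrow> \<bar>\<phi> (x, t)\<bar> \<le> C2 / (norm x)\<^sup>2"
      using decay[OF t, of "[]"] by auto
    define a where "a = G 0 t"
    \<comment> \<open>Large enough for all estimates on the ray. The part
      \<open>64 * \<bar>C1\<bar>\<close> brings the deviation from the dipole below
      \<open>1 / (8 * R\<^sup>2)\<close>; \<open>tail\<close> gives
      \<open>1 / (2 * R\<^sup>2)\<close>, and \<open>1/2 + 1/8 < 1\<close> is the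
      contradiction.\<close>
    define R where "R = 2 * R1 + 2 * R2 + 4 * (norm (\<gamma> t) + 1) + 2 * norm a + 64 * \<bar>C1\<bar>"
    have R: "0 < R" using 1(1) 2(1) unfolding R_def by (intro add_pos_nonneg) auto
    have big: "r / 2 \<le> norm (a + r *\<^sub>R E)" "R1 \<le> norm (a + r *\<^sub>R E)" "R2 \<le> norm (a + r *\<^sub>R E)"
       "2 * (norm (\<gamma> t) + 1) \<le> norm (a + r *\<^sub>R E)" if r: "R \<le> r" for r
    proof -
      have "r \<le> norm (a + r *\<^sub>R E) + norm a"
        using norm_triangle_ineq4[of "a + r *\<^sub>R E" a] r R E by simp
      moreover have "r / 2 \<le> s \<and> R1 \<le> s \<and> R2 \<le> s \<and> 2 * (p + 1) \<le> s"
        if "2 * R1 + 2 * R2 + 4 * (p + 1) + 2 * q + 64 * c \<le> r" "0 \<le> p" "0 \<le> q" "0 \<le> c" "r \<le> s + q"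
        for p q c s :: real using that 1(1) 2(1) unfolding distrib_left by (intro conjI) linarith+
      ultimately show "r / 2 \<le> norm (a + r *\<^sub>R E)" "R1 \<le> norm (a + r *\<^sub>R E)" "R2 \<le> norm (a + r *\<^sub>R E)"
        "2 * (norm (\<gamma> t) + 1) \<le> norm (a + r *\<^sub>R E)"
        using r unfolding R_def by (metis norm_ge_zero abs_ge_zero)+
    qed
    define F where "F r = \<phi> (a + r *\<^sub>R E, t)" for r
    have "\<exists>c. \<forall>r\<in>{R..}. F r = c"
    proof (rule has_derivative_zero_constant)
      fix r assume "r \<in> {R..}"
      then have r: "R \<le> r" by simp
      have S: "(a + r *\<^sub>R E, t) \<in> S" and ne: "a + r *\<^sub>R E \<noteq> \<gamma> t"
        using tail[OF t N, of "[]" "a + r *\<^sub>R E"] big(4)[OF r] by (auto simp: S_def mem_off_curve)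
      have "((\<lambda>r. (a + r *\<^sub>R E, t)) has_derivative (\<lambda>h. h *\<^sub>R (E, 0))) (at r)"
      proof (rule has_derivative_eq_rhs)
        have "((\<lambda>r. a + r *\<^sub>R E) has_derivative (\<lambda>h. h *\<^sub>R E)) (at r)"
          by (auto intro!: derivative_eq_intros)
        then show "((\<lambda>r. (a + r *\<^sub>R E, t)) has_derivative (\<lambda>h. (h *\<^sub>R E, 0))) (at r)"
          by (intro has_derivative_Pair has_derivative_const)
      qed (simp add: fun_eq_iff)
      from has_derivative_compose[OF this iter_deriv_has_derivative[OF sm S, of "[]"]]
      have "(F has_derivative (\<lambda>h. iter_deriv [h *\<^sub>R (E, 0)] \<phi> (a + r *\<^sub>R E, t))) (at r)"
        by (simp add: F_def[abs_def])
      moreover have "iter_deriv [h *\<^sub>R (E, 0)] \<phi> (a + r *\<^sub>R E, t) = 0" for h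
        using linear_scale[OF linear_iter_deriv[OF sm S, of "[]"], of h "(E, 0)"] zero[OF ne] by simp
      ultimately show "(F has_derivative (\<lambda>h. 0)) (at r within {R..})"
        by (simp add: has_derivative_at_withinI del: iter_deriv.simps)
    qed simp
    then obtain c where c: "\<And>r. R \<le> r \<Longrightarrow> F r = c" by auto
    have "c = 0"
    proof -
      have "\<bar>c\<bar> \<le> 4 * \<bar>C2\<bar> / r" if r: "max R 1 \<le> r" for r
      proof -
        have "\<bar>c\<bar> \<le> C2 / (norm (a + r *\<^sub>R E))\<^sup>2"
          using 2(2)[OF big(3)[of r]] c[of r] r by (simp add: F_def)
        also have "\<dots> \<le> \<bar>C2\<bar> / (norm (a + r *\<^sub>R E))\<^sup>2" by (intro divide_right_mono) auto
        also have "\<dots> \<le> \<bar>C2\<bar> / (r / 2)\<^sup>2"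
          using big(1)[of r] r by (intro divide_left_mono power_mono mult_pos_pos zero_less_power) auto
        also have "\<dots> = 4 * \<bar>C2\<bar> / (r * r)" by (simp add: power2_eq_square)
        also have "\<dots> \<le> 4 * \<bar>C2\<bar> / r" using r mult_left_mono[of 1 r r] by (intro divide_left_mono) auto
        finally show ?thesis .
      qed
      then have "eventually (\<lambda>r. \<bar>c\<bar> \<le> 4 * \<bar>C2\<bar> / r) at_top"
        unfolding eventually_at_top_linorder by blast
      moreover have "((\<lambda>r::real. 4 * \<bar>C2\<bar> / r) \<longlongrightarrow> 0) at_top"
        by (rule tendsto_divide_0[OF tendsto_const]) (rule filterlim_at_top_imp_at_infinity[OF filterlim_ident])
      ultimately have "\<bar>c\<bar> \<le> 0"
        by (intro tendsto_lowerbound[where F = at_top]) auto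
      then show ?thesis by simp
    qed
    define x where "x = a + R *\<^sub>R E"
    have nx: "R / 2 \<le> norm x" using big(1)[of R] by (simp add: x_def)
    have "\<phi> (x, t) = 0" using c[of R] \<open>c = 0\<close> by (simp add: F_def x_def)
    then have "\<bar>f N (x, t)\<bar> \<le> 1 / (8 * (norm x)\<^sup>2)"
      using tail[OF t N, of "[]" x] big(4)[of R] by (simp add: x_def)
    also have "\<dots> \<le> 1 / (8 * (R / 2)\<^sup>2)"
      using nx R by (intro divide_left_mono mult_left_mono power_mono mult_pos_pos) auto
    finally have A: "\<bar>f N (x, t)\<bar> \<le> 1 / (2 * R\<^sup>2)" by (simp add: power_divide)
    have "\<bar>f N (x, t) - iter_deriv [E] newton (x - a)\<bar> \<le> C1 / norm x ^ 3"
      unfolding a_def using big(2)[of R] by (intro 1(2)) (simp add: x_def)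
    also have "\<dots> \<le> \<bar>C1\<bar> / norm x ^ 3" by (intro divide_right_mono) auto
    also have "\<dots> \<le> \<bar>C1\<bar> / (R / 2) ^ 3"
      using nx R by (intro divide_left_mono power_mono mult_pos_pos zero_less_power) auto
    also have "\<dots> = (8 * \<bar>C1\<bar> / R) / R\<^sup>2"
      by (simp add: power_divide power3_eq_cube power2_eq_square mult_ac)
    also have "\<dots> \<le> (1/8) / R\<^sup>2"
    proof (rule divide_right_mono)
      have "64 * \<bar>C1\<bar> \<le> R" using 1(1) 2(1) unfolding R_def by (smt (verit) norm_ge_zero)
      then show "8 * \<bar>C1\<bar> / R \<le> 1/8" using R by (simp add: field_simps)
    qed simp
    finally have B: "\<bar>f N (x, t) - iter_deriv [E] newton (x - a)\<bar> \<le> 1 / (8 * R\<^sup>2)" by simp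
    have "iter_deriv [E] newton (R *\<^sub>R E) = - (incl E (R *\<^sub>R E) * newton (R *\<^sub>R E))"
    proof -
      have "E \<noteq> 0" using E(2) by auto
      then have "R *\<^sub>R E \<noteq> 0" using R by simp
      from fun_cong[OF frechet_derivative_at[OF newton_has_derivative[OF this]], of E] show ?thesis by simp
    qed
    also have "\<dots> = - 1 / R\<^sup>2"
      using R E by (simp add: incl_def newton_def power2_eq_square dot_square_norm)
    finally have "\<bar>iter_deriv [E] newton (x - a)\<bar> = 1 / R\<^sup>2" using R by (simp add: x_def)
    with A B have "1 / R\<^sup>2 \<le> 1 / (2 * R\<^sup>2) + 1 / (8 * R\<^sup>2)" by linarith
    then show False using R by (simp add: field_simps)
  qed
  show thesis
  proof (rule that[of \<phi>])
    show "smooth_on (off_curve \<gamma>) \<phi>" using sm by (simp only: S_def)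
    show "(\<Sum>b\<in>Basis. iter_deriv [(b, 0), (b, 0)] \<phi> z) = 0" if "z \<in> off_curve \<gamma>" for z
      using harm that by (simp only: S_def)
    show "\<exists>C R. \<forall>x. R \<le> norm x \<longrightarrow> \<bar>iter_deriv [v] \<phi> (x, t)\<bar> \<le> C / (norm x)\<^sup>2"
      if "0 < t" "v \<in> Basis" for t v
    proof -
      have "set [v] \<subseteq> Basis" using that by simp
      from decay[OF that(1) this] show ?thesis by (elim exE conjE) (intro exI, assumption)
    qed
    show "\<exists>b\<in>Basis. \<exists>x. x \<noteq> \<gamma> t \<and> iter_deriv [(b, 0)] \<phi> (x, t) \<noteq> 0" if "0 < t" for t
      by (rule nonzero[OF that])
  qed
qed

section \<open>Maximum principle and removable singularities\<close>

text \<open>With \<open>c > 0\<close> the first derivative, zero at the maximum, would be positive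
  just to the right of it, and \<open>f\<close> would rise above its maximum.\<close>

lemma second_derivative_local_max:
  fixes f :: "real \<Rightarrow> real"
  assumes "0 < d" and f: "\<And>s. \<bar>s\<bar> < d \<Longrightarrow> (f has_real_derivative f' s) (at s)"
    and f': "(f' has_real_derivative c) (at 0)" and max: "\<And>s. \<bar>s\<bar> < d \<Longrightarrow> f s \<le> f 0"
  shows "c \<le> 0"
proof (rule ccontr)
  assume "\<not> c \<le> 0"
  then have "0 < c" by simp
  from DERIV_pos_inc_right[OF f' this] obtain d' where d': "0 < d'" "\<And>h. 0 < h \<Longrightarrow> h < d' \<Longrightarrow> f' 0 < f' h" by auto
  have "f' 0 = 0"
    by (rule DERIV_local_max[OF f[of 0] \<open>0 < d\<close>]) (use max \<open>0 < d\<close> in auto)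
  define s where "s = min d d' / 2"
  have s: "0 < s" "s < d" "s < d'" using \<open>0 < d\<close> d' by (auto simp: s_def)
  have "\<exists>z>0. z < s \<and> f s - f 0 = (s - 0) * f' z"
    by (rule MVT2[OF s(1)]) (use f s in auto)
  then obtain z where z: "0 < z" "z < s" "f s - f 0 = s * f' z" by auto
  then have "0 < s * f' z" using d'(2)[of z] s \<open>f' 0 = 0\<close> by (intro mult_pos_pos) auto
  then show False using z max[of s] s by auto
qed

definition harmonic_on :: "'a::euclidean_space set \<Rightarrow> ('a \<Rightarrow> real) \<Rightarrow> bool" where
  "harmonic_on S f \<longleftrightarrow> smooth_on S f \<and> (\<forall>x\<in>S. (\<Sum>b\<in>Basis. iter_deriv [b, b] f x) = 0)"

lemma harmonic_on_diff:
  assumes "harmonic_on S f" "harmonic_on S g" "open S"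
  shows "harmonic_on S (\<lambda>x. f x - g x)"
  using assms smooth_on_diff[of S f g] iter_deriv_diff[of S f g]
  unfolding harmonic_on_def by (simp add: sum_subtractf del: iter_deriv.simps)

lemma harmonic_on_cmult:
  assumes "harmonic_on S f" "open S"
  shows "harmonic_on S (\<lambda>x. c * f x)"
  using assms smooth_on_cmult[of S f] iter_deriv_cmult[of S f]
  unfolding harmonic_on_def by (simp del: iter_deriv.simps flip: sum_distrib_left)

lemma harmonic_on_subset: "harmonic_on S f \<Longrightarrow> T \<subseteq> S \<Longrightarrow> harmonic_on T f"
  unfolding harmonic_on_def using smooth_on_subset by blast

lemma harmonic_on_newton: "harmonic_on (- {a}) (\<lambda>x. newton (x - a))"
proof -
  have o: "open (- {0::real^3})" by (rule open_Compl[OF closed_singleton])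
  have l: "linear (\<lambda>x::real^3. x)" by (simp add: linear_iff)
  have e: "iter_deriv vs (\<lambda>x. newton (x - a)) x = iter_deriv vs newton (x - a)" if "x \<noteq> a" for vs x
    using iter_deriv_affine[OF smooth_on_newton l o, of x "- a" vs] that by simp
  have "smooth_on {x. x + - a \<in> - {0}} (\<lambda>x. newton (x + - a))"
    by (rule smooth_on_affine[OF smooth_on_newton l o])
  moreover have "{x. x + - a \<in> - {0}} = - {a}" by auto
  ultimately have "smooth_on (- {a}) (\<lambda>x. newton (x - a))" by simp
  moreover have "(\<Sum>b\<in>Basis. iter_deriv [b, b] (\<lambda>x. newton (x - a)) x) = 0" if "x \<in> - {a}" for x
    using iter_deriv_newton_harmonic[of "x - a" "[]"] that e by (simp del: iter_deriv.simps)
  ultimately show ?thesis unfolding harmonic_on_def by blast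
qed

text \<open>Adding \<open>\<kappa> * (norm x)\<^sup>2\<close> makes the Laplacian positive, so that no interior maximum is left.\<close>

lemma harmonic_max_principle:
  fixes f :: "'a::euclidean_space \<Rightarrow> real"
  assumes h: "harmonic_on S f" and S: "open S" and K: "compact K" "K \<subseteq> S"
    and bd: "\<And>x. x \<in> frontier K \<Longrightarrow> f x \<le> m" and x0: "x0 \<in> K"
  shows "f x0 \<le> m"
proof (rule ccontr)
  assume "\<not> f x0 \<le> m"
  then have gt: "m < f x0" by simp
  have sm: "smooth_on S f" using h by (simp add: harmonic_on_def)
  obtain R where R: "\<And>x. x \<in> K \<Longrightarrow> norm x \<le> R"
    using compact_imp_bounded[OF K(1)] by (auto simp: bounded_iff)
  \<comment> \<open>On \<open>K\<close> the perturbation is at most half of \<open>f x0 - m\<close>,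
    so the maximum of \<open>g\<close> cannot be on the frontier. The \<open>+ 1\<close> keeps the
    denominator positive when \<open>R = 0\<close>.\<close>
  define \<kappa> where "\<kappa> = (f x0 - m) / (2 * (R\<^sup>2 + 1))"
  have R1: "0 < R\<^sup>2 + 1" by (rule add_nonneg_pos) auto
  have \<kappa>: "0 < \<kappa>" using gt R1 by (simp add: \<kappa>_def)
  define g where "g x = f x + \<kappa> * (norm x)\<^sup>2" for x
  have "continuous_on K g"
    unfolding g_def by (intro continuous_intros continuous_on_subset[OF smooth_on_imp_continuous_on[OF sm] K(2)])
  from continuous_attains_sup[OF K(1) _ this] x0 obtain x1 where x1: "x1 \<in> K" "\<And>x. x \<in> K \<Longrightarrow> g x \<le> g x1" by blast
  have "x1 \<notin> frontier K"
  proof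
    assume "x1 \<in> frontier K"
    then have "g x1 \<le> m + \<kappa> * R\<^sup>2"
      unfolding g_def using bd R[OF x1(1)] \<kappa> by (intro add_mono mult_left_mono power_mono) auto
    also have "\<kappa> * R\<^sup>2 \<le> \<kappa> * (R\<^sup>2 + 1)" using \<kappa> by simp
    also have "\<kappa> * (R\<^sup>2 + 1) = (f x0 - m) / 2"
    proof -
      have "p / (2 * q) * q = p / 2" if "0 < q" for p q :: real using that by simp
      from this[OF R1] show ?thesis by (simp only: \<kappa>_def)
    qed
    also have "m + (f x0 - m) / 2 < f x0" using gt by (simp add: field_simps)
    also have "f x0 \<le> g x0" using \<kappa> by (simp add: g_def)
    finally show False using x1(2)[OF x0] by simp
  qed
  then have int: "x1 \<in> interior K"
    using x1(1) K(1) by (simp add: frontier_def closure_closed compact_imp_closed)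
  then obtain d where d: "0 < d" "ball x1 d \<subseteq> interior K"
    using open_contains_ball open_interior by blast
  have "iter_deriv [b, b] f x1 + 2 * \<kappa> \<le> 0" if b: "b \<in> Basis" for b
  proof (rule second_derivative_local_max[OF d(1)])
    have in_ball: "x1 + s *\<^sub>R b \<in> ball x1 d" if "\<bar>s\<bar> < d" for s
      using that b by (simp add: dist_norm)
    then have inS: "x1 + s *\<^sub>R b \<in> S" if "\<bar>s\<bar> < d" for s
      using that d(2) K(2) interior_subset by blast
    have D: "((\<lambda>s. iter_deriv vs f (x1 + s *\<^sub>R b)) has_real_derivative iter_deriv (b # vs) f (x1 + s *\<^sub>R b)) (at s)"
      if "\<bar>s\<bar> < d" for vs s
    proof -
      have "((\<lambda>s. x1 + s *\<^sub>R b) has_derivative (\<lambda>h. h *\<^sub>R b)) (at s)"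
        by (auto intro!: derivative_eq_intros)
      from has_derivative_compose[OF this iter_deriv_has_derivative[OF sm inS[OF that], of vs]]
      show ?thesis unfolding has_field_derivative_def
        using linear_scale[OF linear_iter_deriv[OF sm inS[OF that], of vs]]
        by (elim has_derivative_eq_rhs) (auto simp: mult.commute)
    qed
    have sq: "(norm (x1 + s *\<^sub>R b))\<^sup>2 = (norm x1)\<^sup>2 + 2 * s * (x1 \<bullet> b) + s\<^sup>2" for s
      using b unfolding power2_norm_eq_inner
      by (simp add: inner_add_left inner_add_right inner_commute power2_eq_square algebra_simps)
    show "((\<lambda>s. g (x1 + s *\<^sub>R b)) has_real_derivative iter_deriv [b] f (x1 + s *\<^sub>R b) + \<kappa> * (2 * (x1 \<bullet> b) + 2 * s)) (at s)"
      if "\<bar>s\<bar> < d" for s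
      unfolding g_def sq using D[OF that, of "[]"]
      by (auto intro!: derivative_eq_intros simp: algebra_simps simp del: iter_deriv.simps(2))
    show "((\<lambda>s. iter_deriv [b] f (x1 + s *\<^sub>R b) + \<kappa> * (2 * (x1 \<bullet> b) + 2 * s)) has_real_derivative iter_deriv [b, b] f x1 + 2 * \<kappa>) (at 0)"
      using D[of 0 "[b]"] d(1)
      by (auto intro!: derivative_eq_intros simp: algebra_simps simp del: iter_deriv.simps(2))
    show "g (x1 + s *\<^sub>R b) \<le> g (x1 + 0 *\<^sub>R b)" if "\<bar>s\<bar> < d" for s
    proof -
      have "x1 + s *\<^sub>R b \<in> K" using in_ball[OF that] d(2) interior_subset by blast
      then show ?thesis using x1(2) by simp
    qed
  qed
  then have "(\<Sum>b\<in>(Basis::'a set). iter_deriv [b, b] f x1 + 2 * \<kappa>) \<le> 0" by (rule sum_nonpos)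
  moreover have "(\<Sum>b\<in>(Basis::'a set). iter_deriv [b, b] f x1 + 2 * \<kappa>) = 2 * \<kappa> * DIM('a)"
    using h x1(1) K(2) unfolding harmonic_on_def sum.distrib by (simp add: subset_iff del: iter_deriv.simps)
  ultimately show False using \<kappa> by (simp add: mult_le_0_iff)
qed

text \<open>The comparison function \<open>newton (x - a)\<close>, with a small factor, dominates at the puncture.\<close>

lemma punctured_exterior_max_principle:
  fixes f :: "real^3 \<Rightarrow> real"
  assumes h: "harmonic_on S f" and S: "open S" and V: "open V" "- V - {a} \<subseteq> S" and "a \<notin> V"
    and bd: "\<And>x. x \<in> frontier V \<Longrightarrow> x \<noteq> a \<Longrightarrow> f x \<le> 0"
    and r: "0 < r" and near: "\<And>x. x \<notin> V \<Longrightarrow> x \<noteq> a \<Longrightarrow> norm (x - a) < r \<Longrightarrow> f x \<le> M"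
    and inf: "\<And>e. 0 < e \<Longrightarrow> \<exists>R. \<forall>x. x \<notin> V \<longrightarrow> x \<noteq> a \<longrightarrow> R \<le> norm x \<longrightarrow> f x \<le> e"
    and x0: "x0 \<notin> V" "x0 \<noteq> a"
  shows "f x0 \<le> 0"
proof (rule field_le_epsilon)
  fix e' :: real assume "0 < e'"
  define e where "e = e' / 2"
  have e: "0 < e" using \<open>0 < e'\<close> by (simp add: e_def)
  \<comment> \<open>The barrier \<open>\<eta> * newton (x - a)\<close> then equals \<open>e\<close>
    at \<open>x0\<close>, which gives \<open>f x0 \<le> 2 * e\<close>.\<close>
  define \<eta> where "\<eta> = e * norm (x0 - a)"
  have \<eta>: "0 < \<eta>" using e x0 by (simp add: \<eta>_def)
  obtain R where R: "\<And>x. x \<notin> V \<Longrightarrow> x \<noteq> a \<Longrightarrow> R \<le> norm x \<Longrightarrow> f x \<le> e" using inf[OF e] by blast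
  \<comment> \<open>On the sphere of radius \<open>\<rho>\<close> the barrier is
    \<open>\<eta> / \<rho> \<ge> \<bar>M\<bar> + 1\<close>, more than the upper bound for
    \<open>f\<close> near the puncture.\<close>
  define \<rho> where "\<rho> = min (norm (x0 - a)) (min (r / 2) (\<eta> / (\<bar>M\<bar> + 1)))"
  have \<rho>: "0 < \<rho>" "\<rho> \<le> norm (x0 - a)" "\<rho> < r" "\<rho> \<le> \<eta> / (\<bar>M\<bar> + 1)"
    using x0 r \<eta> by (auto simp: \<rho>_def)
  define R' where "R' = \<bar>R\<bar> + norm a + norm (x0 - a)"
  define g where "g x = f x - \<eta> * newton (x - a)" for x
  define K where "K = (cball a R' - ball a \<rho>) - V"
  have K: "compact K" unfolding K_def by (intro compact_diff compact_cball open_ball V(1))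
  have KS: "K \<subseteq> S - {a}" using V(2) \<rho>(1) by (auto simp: K_def)
  have oS: "open (S - {a})" using S by (intro open_delete)
  have hg: "harmonic_on (S - {a}) g"
    unfolding g_def[abs_def]
    by (intro harmonic_on_diff harmonic_on_cmult oS harmonic_on_subset[OF h] harmonic_on_subset[OF harmonic_on_newton]) auto
  have "g x0 \<le> e"
  proof (rule harmonic_max_principle[OF hg oS K KS])
    show "x0 \<in> K" using x0 \<rho> by (auto simp: K_def R'_def dist_norm norm_minus_commute)
    fix x assume x: "x \<in> frontier K"
    have xK: "x \<in> K" using x K by (metis compact_imp_closed frontier_subset_closed subsetD)
    then have xV: "x \<notin> V" and d: "\<rho> \<le> norm (x - a)" "norm (x - a) \<le> R'" and xa: "x \<noteq> a"
      using \<rho>(1) by (auto simp: K_def dist_norm norm_minus_commute)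
    have npos: "0 \<le> \<eta> * newton (x - a)" using \<eta> by (simp add: newton_def)
    consider "norm (x - a) = \<rho>" | "norm (x - a) = R'" | "\<rho> < norm (x - a)" "norm (x - a) < R'"
      using d by linarith
    then show "g x \<le> e"
    proof cases
      case 1
      have "f x \<le> M" using near[OF xV xa] 1 \<rho>(3) by simp
      also have "M \<le> \<bar>M\<bar> + 1" by simp
      also have "\<bar>M\<bar> + 1 \<le> \<eta> / \<rho>"
        using \<rho>(1,4) by (simp add: field_simps add_pos_nonneg)
      also have "\<dots> = \<eta> * newton (x - a)" by (simp add: newton_def 1)
      finally show ?thesis using e by (simp add: g_def)
    next
      case 2
      have "norm (x - a) \<le> norm x + norm a" by (rule norm_triangle_ineq4)
      then have "R \<le> norm x" using 2 norm_ge_zero[of "x0 - a"] unfolding R'_def by linarith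
      from R[OF xV xa this] show ?thesis using npos by (simp add: g_def)
    next
      case 3
      have "x \<in> closure V"
      proof (rule ccontr)
        assume "x \<notin> closure V"
        define W where "W = (ball a R' - cball a \<rho>) - closure V"
        have "open W" unfolding W_def by (intro open_Diff open_ball closed_cball closed_closure)
        moreover have "x \<in> W" using 3 \<open>x \<notin> closure V\<close> by (auto simp: W_def dist_norm norm_minus_commute)
        moreover have "W \<subseteq> K" using closure_subset[of V] by (auto simp: W_def K_def)
        ultimately have "x \<in> interior K" by (rule interiorI)
        with x show False by (simp add: frontier_def)
      qed
      then have "x \<in> frontier V" using xV V(1) by (simp add: frontier_def interior_open)
      from bd[OF this xa] show ?thesis using npos e by (simp add: g_def)
    qed
  qed
  then have "f x0 \<le> e + \<eta> * newton (x0 - a)" by (simp add: g_def)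
  also have "\<eta> * newton (x0 - a) = e" using x0 by (simp add: \<eta>_def newton_def)
  finally show "f x0 \<le> 0 + e'" by (simp add: e_def)
qed

text \<open>Removal of the singularity and Liouville's theorem in one, in one-sided form. For the
  gradient it is applied to both signs; for the time derivative only an upper bound near the curve
  is available.\<close>

lemma harmonic_removable_nonpos:
  fixes f :: "real^3 \<Rightarrow> real"
  assumes h: "harmonic_on (- {a}) f"
    and r: "0 < r" and near: "\<And>x. x \<noteq> a \<Longrightarrow> norm (x - a) < r \<Longrightarrow> f x \<le> M"
    and decay: "\<exists>C R. \<forall>x. R \<le> norm x \<longrightarrow> \<bar>f x\<bar> \<le> C / (norm x)\<^sup>2" and x: "x \<noteq> a"
  shows "f x \<le> 0"
proof (rule punctured_exterior_max_principle[OF h _ open_empty _ _ _ r near _ _ x])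
  obtain C R where CR: "\<And>x. R \<le> norm x \<Longrightarrow> \<bar>f x\<bar> \<le> C / (norm x)\<^sup>2" using decay by blast
  show "\<exists>R. \<forall>x. x \<notin> {} \<longrightarrow> x \<noteq> a \<longrightarrow> R \<le> norm x \<longrightarrow> f x \<le> e" if e: "0 < e" for e
  proof (intro exI[of _ "max R (max 1 (\<bar>C\<bar> / e))"] allI impI)
    fix x :: "real^3" assume "max R (max 1 (\<bar>C\<bar> / e)) \<le> norm x"
    then have x: "R \<le> norm x" "1 \<le> norm x" "\<bar>C\<bar> / e \<le> norm x" by auto
    have "f x \<le> C / (norm x)\<^sup>2" using CR[OF x(1)] by simp
    also have "\<dots> \<le> \<bar>C\<bar> / (norm x)\<^sup>2" by (intro divide_right_mono) auto
    also have "\<dots> \<le> \<bar>C\<bar> / norm x"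
      using x(2) power_increasing[of 1 2 "norm x"] by (intro divide_left_mono mult_pos_pos) auto
    also have "\<dots> \<le> e"
    proof -
      have "0 < norm x" using x(2) by linarith
      then show ?thesis using x(3) e by (simp add: pos_divide_le_eq mult.commute)
    qed
    finally show "f x \<le> e" .
  qed
qed auto

text \<open>If \<open>v\<close> is positive at \<open>x1\<close>, it is at least \<open>c\<close> on
  a small ball of radius \<open>r\<close> there. Comparison outside that ball gives
  \<open>v x \<ge> c * r / norm (x - x1)\<close>, which is incompatible with inverse square decay.
  The puncture \<open>a\<close> does no harm: \<open>v \<ge> 0\<close> bounds the comparison
  function \<open>f\<close> above near it.\<close>

lemma nonneg_harmonic_decay_zero:
  fixes v :: "real^3 \<Rightarrow> real"
  assumes h: "harmonic_on (- {a}) v" and nonneg: "\<And>x. x \<noteq> a \<Longrightarrow> 0 \<le> v x"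
    and decay: "\<exists>C R. \<forall>x. R \<le> norm x \<longrightarrow> \<bar>v x\<bar> \<le> C / (norm x)\<^sup>2" and x1: "x1 \<noteq> a"
  shows "v x1 = 0"
proof (rule ccontr)
  assume "v x1 \<noteq> 0"
  define c where "c = v x1 / 2"
  have c: "0 < c" using nonneg[OF x1] \<open>v x1 \<noteq> 0\<close> by (simp add: c_def)
  have "continuous_on (- {a}) v"
    using h unfolding harmonic_on_def by (blast intro: smooth_on_imp_continuous_on)
  then have "isCont v x1" using x1 by (simp add: continuous_on_eq_continuous_at open_Compl)
  then obtain d where d: "0 < d" "\<And>x. dist x x1 < d \<Longrightarrow> dist (v x) (v x1) < c"
    unfolding continuous_at_eps_delta using c by metis
  define r where "r = min d (norm (x1 - a)) / 2"
  have r: "0 < r" "r < d" "r < norm (x1 - a)" using d x1 by (auto simp: r_def min_less_iff_disj)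
  have lower: "c \<le> v x" if "norm (x - x1) \<le> r" for x
    using d(2)[of x] that r by (simp add: dist_norm c_def abs_if split: if_splits)
  define f where "f x = (c * r) * newton (x - x1) - v x" for x
  have hf: "harmonic_on (- {x1, a}) f"
    unfolding f_def[abs_def]
    by (intro harmonic_on_diff harmonic_on_cmult harmonic_on_subset[OF h] harmonic_on_subset[OF harmonic_on_newton]
        open_Compl finite_imp_closed) auto
  have upper: "(c * r) * newton (x - x1) \<le> c" if "r \<le> norm (x - x1)" for x
  proof -
    have "0 < norm (x - x1)" using that r(1) by linarith
    then show ?thesis using that c by (simp add: newton_def pos_divide_le_eq)
  qed
  have comp: "f x \<le> 0" if x: "x \<notin> ball x1 r" "x \<noteq> a" for x
  proof (rule punctured_exterior_max_principle[OF hf _ open_ball _ _ _ zero_less_one _ _ x])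
    show "open (- {x1, a})" by (intro open_Compl finite_imp_closed) auto
    show "- ball x1 r - {a} \<subseteq> - {x1, a}" using r by auto
    show "a \<notin> ball x1 r" using r by (simp add: dist_norm)
    show "f x \<le> 0" if "x \<in> frontier (ball x1 r)" for x
    proof -
      have "norm (x - x1) = r" using that r by (simp add: frontier_ball dist_norm norm_minus_commute)
      then show ?thesis using upper[of x] lower[of x] by (simp add: f_def)
    qed
    show "f x \<le> c" if "x \<notin> ball x1 r" "x \<noteq> a" for x
      using upper[of x] nonneg[of x] that by (simp add: f_def dist_norm norm_minus_commute)
    show "\<exists>R. \<forall>x. x \<notin> ball x1 r \<longrightarrow> x \<noteq> a \<longrightarrow> R \<le> norm x \<longrightarrow> f x \<le> e" if e: "0 < e" for e
    proof (intro exI[of _ "norm x1 + c * r / e"] allI impI)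
      fix x assume x: "x \<notin> ball x1 r" "x \<noteq> a" "norm x1 + c * r / e \<le> norm x"
      have "c * r / e \<le> norm (x - x1)" using norm_triangle_ineq2[of x x1] x(3) by linarith
      moreover have "0 < norm (x - x1)" using x(1) r by (auto simp: dist_norm)
      ultimately have "(c * r) * newton (x - x1) \<le> e" using e by (simp add: newton_def field_simps)
      then show "f x \<le> e" using nonneg[OF x(2)] by (simp add: f_def)
    qed
  qed
  obtain C R where CR: "\<And>x. R \<le> norm x \<Longrightarrow> \<bar>v x\<bar> \<le> C / (norm x)\<^sup>2" using decay by blast
  \<comment> \<open>At a point of norm \<open>s\<close> the comparison yields
    \<open>c * r / (2 * s) \<le> C / s\<^sup>2\<close>, which the summand
    \<open>2 * \<bar>C\<bar> / (c * r)\<close> rules out.\<close>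
  define s where "s = \<bar>R\<bar> + (norm x1 + r) + norm a + 2 * \<bar>C\<bar> / (c * r) + 1"
  have cr: "0 < c * r" using c r by simp
  have s: "R \<le> s" "norm x1 + r \<le> s" "norm a < s" "2 * \<bar>C\<bar> / (c * r) < s"
  proof -
    have "0 \<le> norm x1" "0 \<le> norm a" "0 \<le> 2 * \<bar>C\<bar> / (c * r)" using cr by auto
    then show "R \<le> s" "norm x1 + r \<le> s" "norm a < s" "2 * \<bar>C\<bar> / (c * r) < s"
      using r(1) unfolding s_def by linarith+
  qed
  define x :: "real^3" where "x = s *\<^sub>R axis 1 1"
  have spos: "0 < s" using s(3) norm_ge_zero[of a] by linarith
  have nx: "norm x = s" using spos by (simp add: x_def)
  have "x \<noteq> a" using nx s(3) by auto
  moreover have "x \<notin> ball x1 r"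
    using norm_triangle_ineq2[of x x1] nx s(2) by (simp add: dist_norm norm_minus_commute)
  ultimately have "f x \<le> 0" by (intro comp)
  then have "(c * r) * newton (x - x1) \<le> C / s\<^sup>2" using CR[of x] nx s(1) by (simp add: f_def)
  moreover have "(c * r) / (2 * s) \<le> (c * r) * newton (x - x1)"
  proof -
    have "norm (x - x1) \<le> 2 * s" using norm_triangle_ineq4[of x x1] nx s(2) r(1) by simp
    moreover have "0 < norm (x - x1)" using nx s(2) r(1) by auto
    ultimately have "(c * r) / (2 * s) \<le> (c * r) / norm (x - x1)"
      using cr spos by (intro divide_left_mono mult_pos_pos) auto
    then show ?thesis by (simp add: newton_def)
  qed
  ultimately have "(c * r) / (2 * s) \<le> C / s\<^sup>2" by linarith
  then have "s * (c * r) \<le> 2 * C" using spos by (simp add: field_simps power2_eq_square)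
  then show False using s(4) cr by (simp add: field_simps abs_if split: if_splits)
qed

section \<open>Potential flows\<close>

lemma locally_holder_continuous_on:
  assumes "locally_holder \<alpha> g" and "0 < \<alpha>"
  shows "continuous_on {0..} g"
  unfolding continuous_on_iff
proof (intro ballI allI impI)
  fix t e :: real assume t: "t \<in> {0..}" and e: "0 < e"
  have "0 < t + 1" using t by simp
  with assms(1) obtain C where C: "0 < C"
    "\<And>s s'. s \<in> {0..t + 1} \<Longrightarrow> s' \<in> {0..t + 1} \<Longrightarrow> norm (g s - g s') \<le> C * \<bar>s - s'\<bar> powr \<alpha>"
    unfolding locally_holder_def by blast
  \<comment> \<open>The bound 1 keeps \<open>s\<close> within \<open>{0..t + 1}\<close>; the other
    term solves \<open>C * d powr \<alpha> = e / 2\<close>.\<close>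
  define d where "d = min 1 ((e / (2 * C)) powr (1 / \<alpha>))"
  have d: "0 < d" using e C by (simp add: d_def)
  have "dist (g s) (g t) < e" if s: "s \<in> {0..}" "dist s t < d" for s
  proof -
    have "s \<in> {0..t + 1}" "t \<in> {0..t + 1}" using s t by (auto simp: dist_real_def d_def)
    then have "norm (g s - g t) \<le> C * \<bar>s - t\<bar> powr \<alpha>" by (rule C(2))
    also have "\<dots> \<le> C * ((e / (2 * C)) powr (1 / \<alpha>)) powr \<alpha>"
      using s(2) C(1) assms(2) by (intro mult_left_mono powr_mono2) (auto simp: dist_real_def d_def)
    also have "\<dots> = e / 2" using C(1) e assms(2) by (simp add: powr_powr)
    also have "\<dots> < e" using e by simp
    finally show ?thesis by (simp add: dist_norm)
  qed
  with d show "\<exists>d>0. \<forall>x'\<in>{0..}. dist x' t < d \<longrightarrow> dist (g x') (g t) < e" by blast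
qed

section \<open>The operators of the system as iterated derivatives\<close>

lemma sum_Basis_axis: "(\<Sum>b\<in>(Basis :: (real^3) set). F b) = (\<Sum>i\<in>UNIV. F (axis i 1))"
proof -
  have "(Basis :: (real^3) set) = range (\<lambda>i. axis i 1)" by (auto simp: Basis_vec_def)
  then have "(\<Sum>b\<in>(Basis :: (real^3) set). F b) = sum F (range (\<lambda>i. axis i 1))" by (rule arg_cong)
  also have "\<dots> = (\<Sum>i\<in>UNIV. F (axis i 1))"
    by (subst sum.reindex) (auto simp: inj_on_def axis_eq_axis)
  finally show ?thesis .
qed

text \<open>Agreement of \<open>f\<close> and \<open>g\<close> merely on \<open>S\<close> matters
  for nested operators: in \<open>laplacian\<close> the inner \<open>dx i u\<close> is known to be
  an iterated derivative only on \<open>S\<close>.\<close>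

lemma dx_eq_iter_deriv:
  assumes g: "smooth_on S g" and S: "open S" and z: "z \<in> S" and eq: "\<And>w. w \<in> S \<Longrightarrow> f w = g w"
  shows "dx i f z = iter_deriv [(axis i 1, 0)] g z"
proof -
  let ?l = "\<lambda>h. (fst z + h *\<^sub>R axis i 1, snd z)"
  have L: "(?l has_derivative (\<lambda>h. h *\<^sub>R (axis i 1, 0))) (at h)" for h
  proof (rule has_derivative_eq_rhs)
    have "((\<lambda>h. fst z + h *\<^sub>R axis i 1) has_derivative (\<lambda>h. h *\<^sub>R axis i 1)) (at h)"
      by (auto intro!: derivative_eq_intros)
    then show "(?l has_derivative (\<lambda>h. (h *\<^sub>R axis i 1, 0))) (at h)"
      by (intro has_derivative_Pair has_derivative_const)
  qed (simp add: fun_eq_iff)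
  have l0: "?l 0 = z" by simp
  have o: "open (?l -` S)"
    by (rule open_vimage[OF S]) (intro continuous_intros)
  have "((\<lambda>h. g (?l h)) has_vector_derivative iter_deriv [(axis i 1, 0)] g z) (at 0)"
    unfolding has_vector_derivative_def
    using has_derivative_compose[OF L[of 0], of g "\<lambda>v. iter_deriv [v] g z"] iter_deriv_has_derivative[OF g z, of "[]"]
      linear_scale[OF linear_iter_deriv[OF g z, of "[]"]]
    unfolding l0 iter_deriv.simps(1) by (simp del: iter_deriv.simps(2) scaleR_Pair)
  then have "((\<lambda>h. f (?l h)) has_vector_derivative iter_deriv [(axis i 1, 0)] g z) (at 0)"
    by (rule has_vector_derivative_transform_within_open[OF _ o]) (use z in \<open>simp_all add: eq\<close>)
  then show ?thesis unfolding dx_def by (rule vector_derivative_at)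
qed

lemma dt_eq_iter_deriv:
  assumes f: "smooth_on S f" and z: "z \<in> S"
  shows "dt f z = iter_deriv [(0, 1)] f z"
proof -
  let ?l = "\<lambda>s. (fst z, s)"
  have L: "(?l has_derivative (\<lambda>h. h *\<^sub>R (0, 1))) (at s)" for s
    by (rule has_derivative_eq_rhs[OF has_derivative_Pair[OF has_derivative_const has_derivative_ident]])
      (simp add: fun_eq_iff)
  have l: "?l (snd z) = z" by simp
  have "((\<lambda>s. f (?l s)) has_vector_derivative iter_deriv [(0, 1)] f z) (at (snd z))"
    unfolding has_vector_derivative_def
    using has_derivative_compose[OF L[of "snd z"], of f "\<lambda>v. iter_deriv [v] f z"] iter_deriv_has_derivative[OF f z, of "[]"]
      linear_scale[OF linear_iter_deriv[OF f z, of "[]"]]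
    unfolding l iter_deriv.simps(1) by (simp del: iter_deriv.simps(2) scaleR_Pair)
  then show ?thesis unfolding dt_def by (rule vector_derivative_at)
qed

lemma iter_deriv_square:
  fixes f :: "'a::euclidean_space \<Rightarrow> real"
  assumes f: "smooth_on S f" and z: "z \<in> S"
  shows "iter_deriv [v] (\<lambda>z. f z * f z) z = 2 * (f z * iter_deriv [v] f z)"
proof -
  have d: "(f has_derivative (\<lambda>h. iter_deriv [h] f z)) (at z)"
    using iter_deriv_has_derivative[OF f z, of "[]"] by simp
  show ?thesis
    using fun_cong[OF frechet_derivative_at[OF has_derivative_mult[OF d d]], of v] by simp
qed

definition potential_velocity :: "(spacetime \<Rightarrow> real) \<Rightarrow> spacetime \<Rightarrow> real^3" where
  "potential_velocity \<phi> z = (\<Sum>i\<in>UNIV. iter_deriv [(axis i 1, 0)] \<phi> z *\<^sub>R axis i 1)"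

text \<open>Bernoulli's law for unsteady flow, written with constant factors and products so that
  the rules for \<open>smooth_on\<close> and \<open>iter_deriv\<close> apply literally.\<close>

definition bernoulli_pressure :: "(spacetime \<Rightarrow> real) \<Rightarrow> spacetime \<Rightarrow> real" where
  "bernoulli_pressure \<phi> z = (- 1) * iter_deriv [(0, 1)] \<phi> z +
     (- 1/2) * (\<Sum>i\<in>UNIV. iter_deriv [(axis i 1, 0)] \<phi> z * iter_deriv [(axis i 1, 0)] \<phi> z)"

lemma potential_velocity_nth: "potential_velocity \<phi> z $ j = iter_deriv [(axis j 1, 0)] \<phi> z"
  by (simp add: potential_velocity_def axis_def if_distrib cong: if_cong)

lemma
  assumes \<phi>: "smooth_on S \<phi>" and S: "open S"
  shows smooth_on_potential_velocity: "smooth_on S (potential_velocity \<phi>)"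
    and iter_deriv_potential_velocity_nth: "z \<in> S \<Longrightarrow>
      iter_deriv vs (potential_velocity \<phi>) z $ j = iter_deriv (vs @ [(axis j 1, 0)]) \<phi> z"
    and smooth_on_bernoulli_pressure: "smooth_on S (bernoulli_pressure \<phi>)"
proof -
  have sm: "smooth_on S (\<lambda>z. iter_deriv [(axis i 1, 0)] \<phi> z *\<^sub>R axis i 1)" for i
    using smooth_on_bounded_linear[OF smooth_on_iter_deriv[OF \<phi>] bounded_linear_scaleR_left S] by blast
  show "smooth_on S (potential_velocity \<phi>)"
    unfolding potential_velocity_def[abs_def] by (rule smooth_on_sum[OF S sm])
  show "iter_deriv vs (potential_velocity \<phi>) z $ j = iter_deriv (vs @ [(axis j 1, 0)]) \<phi> z" if z: "z \<in> S"
  proof -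
    have "iter_deriv vs (potential_velocity \<phi>) z = (\<Sum>i\<in>UNIV. iter_deriv vs (\<lambda>z. iter_deriv [(axis i 1, 0)] \<phi> z *\<^sub>R axis i 1) z)"
      unfolding potential_velocity_def[abs_def] by (rule iter_deriv_sum[OF S sm z])
    also have "\<dots> = (\<Sum>i\<in>UNIV. iter_deriv vs (iter_deriv [(axis i 1, 0)] \<phi>) z *\<^sub>R axis i 1)"
      by (intro sum.cong refl iter_deriv_bounded_linear[OF smooth_on_iter_deriv[OF \<phi>] bounded_linear_scaleR_left S z])
    finally show ?thesis
      by (simp add: axis_def if_distrib iter_deriv_append cong: if_cong)
  qed
  show "smooth_on S (bernoulli_pressure \<phi>)"
    unfolding bernoulli_pressure_def[abs_def]
    by (intro smooth_on_add smooth_on_cmult smooth_on_sum smooth_on_mult smooth_on_iter_deriv \<phi> S)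
qed

text \<open>The components of the velocity are derivatives of a harmonic function, so the viscous
  term vanishes. By symmetry of second derivatives the convection term is the gradient of half the
  squared speed, and the pressure cancels it together with the time derivative.\<close>

lemma potential_flow_navier_stokes:
  assumes \<phi>: "smooth_on S \<phi>" and S: "open S" and z: "z \<in> S"
    and harm: "\<And>z. z \<in> S \<Longrightarrow> (\<Sum>b\<in>Basis. iter_deriv [(b, 0), (b, 0)] \<phi> z) = 0"
  shows "navier_stokes_at (potential_velocity \<phi>) (bernoulli_pressure \<phi>) z"
proof -
  define e :: "3 \<Rightarrow> spacetime" where "e i = (axis i 1, 0)" for i
  define \<tau> :: spacetime where "\<tau> = (0, 1)"
  define D where "D vs = iter_deriv vs \<phi> z" for vs
  let ?u = "potential_velocity \<phi>" and ?p = "bernoulli_pressure \<phi>"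
  note su = smooth_on_potential_velocity[OF \<phi> S] and sp = smooth_on_bernoulli_pressure[OF \<phi> S]
  note nth = iter_deriv_potential_velocity_nth[OF \<phi> S z]
  have comm: "D [v, w] = D [w, v]" for v w
    unfolding D_def by (rule iter_deriv_commute2[OF \<phi> S z])
  have lap: "(\<Sum>i\<in>UNIV. D [e i, e i, v]) = 0" for v
  proof -
    have "D [e i, e i, v] = D [v, e i, e i]" for i
      unfolding D_def using iter_deriv_move[OF \<phi> S z, of "[e i, e i]" v "[]"] by simp
    then have "(\<Sum>i\<in>UNIV. D [e i, e i, v]) = (\<Sum>i\<in>UNIV. iter_deriv [v] (iter_deriv [e i, e i] \<phi>) z)"
      by (simp add: D_def)
    also have "\<dots> = iter_deriv [v] (\<lambda>w. \<Sum>i\<in>UNIV. iter_deriv [e i, e i] \<phi> w) z"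
      by (rule iter_deriv_sum[symmetric, OF S smooth_on_iter_deriv[OF \<phi>] z])
    also have "\<dots> = iter_deriv [v] (\<lambda>w. 0) z"
      by (rule iter_deriv_cong_open[OF S _ z]) (use harm in \<open>simp add: sum_Basis_axis e_def del: iter_deriv.simps\<close>)
    finally show ?thesis by (simp add: frechet_derivative_const)
  qed
  have dxu: "dx i ?u w = iter_deriv [e i] ?u w" if "w \<in> S" for i w
    unfolding e_def by (rule dx_eq_iter_deriv[OF su S that refl])
  have "dx i (dx i ?u) z = iter_deriv [e i] (iter_deriv [e i] ?u) z" for i
    unfolding e_def by (rule dx_eq_iter_deriv[OF smooth_on_iter_deriv[OF su] S z]) (use dxu e_def in simp)
  then have L: "laplacian ?u z $ j = 0" for j
    using lap[of "e j"] by (simp add: laplacian_def nth[of "[_, _]", unfolded iter_deriv.simps] D_def e_def)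
  have T: "dt ?u z $ j = D [\<tau>, e j]" for j
    unfolding dt_eq_iter_deriv[OF su z] nth D_def e_def \<tau>_def by simp
  have C: "convection ?u z $ j = (\<Sum>i\<in>UNIV. D [e i] * D [e i, e j])" for j
    unfolding convection_def dxu[OF z] by (simp add: nth potential_velocity_nth D_def e_def del: iter_deriv.simps)
  have P: "grad ?p z $ j = - D [\<tau>, e j] - (\<Sum>i\<in>UNIV. D [e i] * D [e i, e j])" for j
  proof -
    have s1: "smooth_on S (\<lambda>z. (- 1) * iter_deriv [\<tau>] \<phi> z)"
      by (intro smooth_on_cmult smooth_on_iter_deriv \<phi> S)
    have sq: "smooth_on S (\<lambda>z. iter_deriv [e i] \<phi> z * iter_deriv [e i] \<phi> z)" for i
      by (intro smooth_on_mult smooth_on_iter_deriv \<phi> S)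
    have s3: "smooth_on S (\<lambda>z. \<Sum>i\<in>UNIV. iter_deriv [e i] \<phi> z * iter_deriv [e i] \<phi> z)"
      by (rule smooth_on_sum[OF S sq])
    have s2: "smooth_on S (\<lambda>z. (- 1/2) * (\<Sum>i\<in>UNIV. iter_deriv [e i] \<phi> z * iter_deriv [e i] \<phi> z))"
      by (rule smooth_on_cmult[OF s3 S])
    have peq: "?p = (\<lambda>z. (- 1) * iter_deriv [\<tau>] \<phi> z + (- 1/2) * (\<Sum>i\<in>UNIV. iter_deriv [e i] \<phi> z * iter_deriv [e i] \<phi> z))"
      by (simp only: bernoulli_pressure_def[abs_def] e_def \<tau>_def)
    have "grad ?p z $ j = iter_deriv [e j] ?p z"
      unfolding grad_def e_def using dx_eq_iter_deriv[OF sp S z refl, of j] by simp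
    also have "\<dots> = (- 1) * iter_deriv [e j] (iter_deriv [\<tau>] \<phi>) z +
       (- 1/2) * (\<Sum>i\<in>UNIV. iter_deriv [e j] (\<lambda>z. iter_deriv [e i] \<phi> z * iter_deriv [e i] \<phi> z) z)"
      unfolding peq
      by (simp only: iter_deriv_add[OF s1 s2 S z] iter_deriv_cmult[OF smooth_on_iter_deriv[OF \<phi>] S z]
          iter_deriv_cmult[OF s3 S z] iter_deriv_sum[OF S sq z])
    also have "(\<lambda>i. iter_deriv [e j] (\<lambda>z. iter_deriv [e i] \<phi> z * iter_deriv [e i] \<phi> z) z) =
       (\<lambda>i. 2 * (D [e i] * D [e i, e j]))"
      unfolding iter_deriv_square[OF smooth_on_iter_deriv[OF \<phi>] z] comm[of "e _" "e j"] by (simp add: D_def)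
    also have "iter_deriv [e j] (iter_deriv [\<tau>] \<phi>) z = D [\<tau>, e j]"
      unfolding comm[of \<tau>] by (simp add: D_def)
    finally show ?thesis by (simp add: sum_distrib_left flip: sum_negf)
  qed
  have "dt ?u z - laplacian ?u z + convection ?u z + grad ?p z = 0"
    unfolding vec_eq_iff by (simp add: L T C P)
  moreover have "divergence ?u z = 0"
  proof -
    have "dx i (\<lambda>w. ?u w $ i) z = D [e i, e i]" for i
      unfolding D_def e_def using dx_eq_iter_deriv[OF smooth_on_iter_deriv[OF \<phi>, of "[(axis i 1, 0)]"] S z potential_velocity_nth, of i]
      by simp
    then show ?thesis
      using harm[OF z] by (simp add: divergence_def D_def e_def sum_Basis_axis del: iter_deriv.simps)
  qed
  ultimately show ?thesis unfolding navier_stokes_at_def by blast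
qed

text \<open>Derivatives in a constant direction \<open>v\<close>, time included, commute with the
  Laplacian in \<open>x\<close>. So the removability and decay lemmas apply to the time derivative
  of \<open>\<phi>\<close> as well as to its gradient.\<close>

lemma harmonic_slice:
  assumes \<phi>: "smooth_on (off_curve \<gamma>) \<phi>" and S: "open (off_curve \<gamma>)" and t: "0 < t"
    and harm: "\<And>z. z \<in> off_curve \<gamma> \<Longrightarrow> (\<Sum>b\<in>Basis. iter_deriv [(b, 0), (b, 0)] \<phi> z) = 0"
  shows "harmonic_on (- {\<gamma> t}) (\<lambda>x. iter_deriv [v] \<phi> (x, t))"
proof -
  let ?A = "\<lambda>x::real^3. (x, 0::real)" and ?w = "iter_deriv [v] \<phi>"
  have A: "linear ?A" by (simp add: linear_iff)
  have sw: "smooth_on (off_curve \<gamma>) ?w" by (rule smooth_on_iter_deriv[OF \<phi>])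
  have dom: "{x. ?A x + (0, t) \<in> off_curve \<gamma>} = - {\<gamma> t}" using t by (auto simp: mem_off_curve)
  have sm: "smooth_on (- {\<gamma> t}) (\<lambda>x. ?w (x, t))"
    using smooth_on_affine[OF sw A S, of "(0, t)"] unfolding dom by simp
  have "(\<Sum>b\<in>Basis. iter_deriv [b, b] (\<lambda>x. ?w (x, t)) x) = 0" if "x \<in> - {\<gamma> t}" for x
  proof -
    have z: "(x, t) \<in> off_curve \<gamma>" using that t by (simp add: mem_off_curve)
    have "iter_deriv [b, b] (\<lambda>x. ?w (x, t)) x = iter_deriv [v] (iter_deriv [(b, 0), (b, 0)] \<phi>) (x, t)" for b
    proof -
      have "iter_deriv [b, b] (\<lambda>x. ?w (x, t)) x = iter_deriv [(b, 0), (b, 0)] ?w (x, t)"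
        using iter_deriv_affine[OF sw A S, of x "(0, t)" "[b, b]"] z by simp
      also have "\<dots> = iter_deriv [(b, 0), (b, 0), v] \<phi> (x, t)" by simp
      also have "\<dots> = iter_deriv [v, (b, 0), (b, 0)] \<phi> (x, t)"
        using iter_deriv_move[OF \<phi> S z, of "[(b, 0), (b, 0)]" v "[]"] by simp
      finally show ?thesis by simp
    qed
    then have "(\<Sum>b\<in>Basis. iter_deriv [b, b] (\<lambda>x. ?w (x, t)) x) = (\<Sum>b\<in>Basis. iter_deriv [v] (iter_deriv [(b, 0), (b, 0)] \<phi>) (x, t))"
      by (simp only:)
    also have "\<dots> = iter_deriv [v] (\<lambda>w. \<Sum>b\<in>Basis. iter_deriv [(b, 0), (b, 0)] \<phi> w) (x, t)"
      by (rule iter_deriv_sum[symmetric, OF S smooth_on_iter_deriv[OF \<phi>] z])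
    also have "\<dots> = iter_deriv [v] (\<lambda>w. 0) (x, t)"
      by (rule iter_deriv_cong_open[OF S harm z])
    finally show ?thesis by (simp add: frechet_derivative_const)
  qed
  with sm show ?thesis unfolding harmonic_on_def by blast
qed

theorem theorem1p1:
  fixes \<gamma> :: "real \<Rightarrow> real^3" and \<alpha> :: real
  assumes "3 / 4 < \<alpha>" and "\<alpha> \<le> 1"
    and "locally_holder \<alpha> \<gamma>"
  shows "\<exists>(u :: spacetime \<Rightarrow> real^3) (p :: spacetime \<Rightarrow> real).
    smooth_on (off_curve \<gamma>) u \<and>
    smooth_on (off_curve \<gamma>) p \<and>
    (\<forall>z\<in>off_curve \<gamma>. navier_stokes_at u p z) \<and>
    singular_on_curve \<gamma> u p"
proof -
  have cont: "continuous_on {0..} \<gamma>"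
    by (rule locally_holder_continuous_on[OF assms(3)]) (use assms(1) in simp)
  have S: "open (off_curve \<gamma>)" by (rule open_off_curve[OF cont])
  obtain \<phi> where \<phi>: "smooth_on (off_curve \<gamma>) \<phi>"
    and harm: "\<And>z. z \<in> off_curve \<gamma> \<Longrightarrow> (\<Sum>b\<in>Basis. iter_deriv [(b, 0), (b, 0)] \<phi> z) = 0"
    and decay: "\<And>t v. 0 < t \<Longrightarrow> v \<in> Basis \<Longrightarrow> \<exists>C R. \<forall>x. R \<le> norm x \<longrightarrow> \<bar>iter_deriv [v] \<phi> (x, t)\<bar> \<le> C / (norm x)\<^sup>2"
    and nonzero: "\<And>t. 0 < t \<Longrightarrow> \<exists>b\<in>Basis. \<exists>x. x \<noteq> \<gamma> t \<and> iter_deriv [(b, 0)] \<phi> (x, t) \<noteq> 0"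
    using moving_potential_exists[OF cont] by blast
  let ?u = "potential_velocity \<phi>" and ?p = "bernoulli_pressure \<phi>"
  have slice: "harmonic_on (- {\<gamma> t}) (\<lambda>x. iter_deriv [v] \<phi> (x, t))" if "0 < t" for t v
    by (rule harmonic_slice[OF \<phi> S that harm])
  have minus_slice: "harmonic_on (- {\<gamma> t}) (\<lambda>x. - iter_deriv [v] \<phi> (x, t))" if "0 < t" for t v
    using harmonic_on_cmult[OF slice[OF that], of "- 1" v] by (simp add: open_Compl del: iter_deriv.simps)
  have unbounded_grad: False
    if t: "0 < t" and r: "0 < r" and M: "\<And>x i. x \<noteq> \<gamma> t \<Longrightarrow> norm (x - \<gamma> t) < r \<Longrightarrow> \<bar>iter_deriv [(axis i 1, 0)] \<phi> (x, t)\<bar> \<le> M"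
    for t r M
  proof -
    obtain b x where b: "b \<in> Basis" "x \<noteq> \<gamma> t" "iter_deriv [(b, 0)] \<phi> (x, t) \<noteq> 0" using nonzero[OF t] by blast
    then obtain i where i: "b = axis i 1" by (auto simp: Basis_vec_def)
    have d: "\<exists>C R. \<forall>x. R \<le> norm x \<longrightarrow> \<bar>iter_deriv [(b, 0)] \<phi> (x, t)\<bar> \<le> C / (norm x)\<^sup>2"
      by (rule decay[OF t]) (use b in \<open>simp add: Basis_prod_def\<close>)
    have "iter_deriv [(b, 0)] \<phi> (x, t) \<le> 0"
      by (rule harmonic_removable_nonpos[OF slice[OF t] r _ d b(2), where M = M]) (use M i in \<open>auto simp: abs_le_iff simp del: iter_deriv.simps\<close>)
    moreover have "- iter_deriv [(b, 0)] \<phi> (x, t) \<le> 0"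
      by (rule harmonic_removable_nonpos[OF minus_slice[OF t] r _ _ b(2), where M = M]) (use M i d in \<open>auto simp: abs_le_iff simp del: iter_deriv.simps\<close>)
    ultimately show False using b(3) by simp
  qed
  have "singular_on_curve \<gamma> ?u ?p"
    unfolding singular_on_curve_def
  proof (intro allI impI conjI notI)
    fix t :: real and U assume t: "0 < t" and U: "open U \<and> \<gamma> t \<in> U"
    then obtain r where r: "0 < r" "ball (\<gamma> t) r \<subseteq> U" using open_contains_ball by blast
    have inU: "x \<in> U - {\<gamma> t}" if "x \<noteq> \<gamma> t" "norm (x - \<gamma> t) < r" for x
      using that r(2) by (auto simp: subset_iff dist_norm norm_minus_commute)
    show False if bu: "bounded ((\<lambda>x. ?u (x, t)) ` (U - {\<gamma> t}))"
    proof -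
      obtain M where M: "\<And>x. x \<in> U - {\<gamma> t} \<Longrightarrow> norm (?u (x, t)) \<le> M"
        using bu by (auto simp: bounded_iff)
      have "\<bar>iter_deriv [(axis i 1, 0)] \<phi> (x, t)\<bar> \<le> M" if "x \<noteq> \<gamma> t" "norm (x - \<gamma> t) < r" for x i
        using M[OF inU[OF that]] component_le_norm_cart[of "?u (x, t)" i] unfolding potential_velocity_nth by linarith
      then show False by (rule unbounded_grad[OF t r(1)])
    qed
    show False if bp: "bounded ((\<lambda>x. ?p (x, t)) ` (U - {\<gamma> t}))"
    proof -
      obtain M where M: "\<And>x. x \<in> U - {\<gamma> t} \<Longrightarrow> \<bar>?p (x, t)\<bar> \<le> M"
        using bp by (auto simp: bounded_iff)
      define ke where "ke x = (\<Sum>i\<in>UNIV. iter_deriv [(axis i 1, 0)] \<phi> (x, t) * iter_deriv [(axis i 1, 0)] \<phi> (x, t))" for x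
      have p: "?p (x, t) = - iter_deriv [(0, 1)] \<phi> (x, t) - ke x / 2" for x
        by (simp add: bernoulli_pressure_def ke_def)
      have ke: "0 \<le> ke x" for x unfolding ke_def by (intro sum_nonneg) simp
      have d: "\<exists>C R. \<forall>x. R \<le> norm x \<longrightarrow> \<bar>iter_deriv [(0, 1)] \<phi> (x, t)\<bar> \<le> C / (norm x)\<^sup>2"
        by (rule decay[OF t]) (simp add: Basis_prod_def)
      have near: "iter_deriv [(0, 1)] \<phi> (x, t) \<le> M" if "x \<noteq> \<gamma> t" "norm (x - \<gamma> t) < r" for x
        using M[OF inU[OF that]] ke[of x] unfolding p by linarith
      have nonpos: "iter_deriv [(0, 1)] \<phi> (x, t) \<le> 0" if "x \<noteq> \<gamma> t" for x
        by (rule harmonic_removable_nonpos[OF slice[OF t] r(1) near d that])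
      have zero: "iter_deriv [(0, 1)] \<phi> (x, t) = 0" if "x \<noteq> \<gamma> t" for x
      proof -
        have "- iter_deriv [(0, 1)] \<phi> (x, t) = 0"
          by (rule nonneg_harmonic_decay_zero[OF minus_slice[OF t] _ _ that])
            (use nonpos d in \<open>simp_all del: iter_deriv.simps\<close>)
        then show ?thesis by simp
      qed
      \<comment> \<open>Without the time derivative the pressure is \<open>- ke / 2\<close>, so each
        squared component is at most \<open>2 * M\<close>; the \<open>+ 1\<close> comes from
        \<open>\<bar>a\<bar> \<le> \<bar>a\<bar> * \<bar>a\<bar> + 1\<close>.\<close>
      have "\<bar>iter_deriv [(axis i 1, 0)] \<phi> (x, t)\<bar> \<le> 2 * M + 1" if x: "x \<noteq> \<gamma> t" "norm (x - \<gamma> t) < r" for x i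
      proof -
        define a where "a = iter_deriv [(axis i 1, 0)] \<phi> (x, t)"
        have "a * a \<le> ke x"
          unfolding ke_def a_def by (rule member_le_sum) auto
        also have "\<dots> \<le> 2 * M"
          using M[OF inU[OF x]] zero[OF x(1)] unfolding p by linarith
        finally have "\<bar>a\<bar> * \<bar>a\<bar> \<le> 2 * M" by simp
        moreover have "\<bar>a\<bar> \<le> \<bar>a\<bar> * \<bar>a\<bar> + 1"
          using sum_squares_bound[of "\<bar>a\<bar>" 1] by (simp add: power2_eq_square)
        ultimately show ?thesis unfolding a_def by linarith
      qed
      then show False by (rule unbounded_grad[OF t r(1)])
    qed
  qed
  then show ?thesis
    using smooth_on_potential_velocity[OF \<phi> S] smooth_on_bernoulli_pressure[OF \<phi> S]
      potential_flow_navier_stokes[OF \<phi> S _ harm] by blast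
qed

end
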